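(* A second order ODE $y''=\Phi(x,y,y')$ is (locally) point equivalent to the derivative of a first order ODE, i.e. to an equation of the form $y''=\partial_xG(x,y)+\partial_yG(x,y)\,y'$ for some smooth function $G(x,y)$, if and only if its dual equation is (locally) point equivalent to an equation $z''=F(t,z,z')$ for which $$K_0=-\partial_zF+\tfrac12X_F(\partial_{z'}F)-\tfrac14(\partial_{z'}F)^2$$ vanishes identically, where $X_F=\partial_t+z'\partial_z+F\partial_{z'}$.
   Context: Everything is smooth and local: second order ODEs are considered as germs at a point of the $(x,y,y')$-space, and two ODEs are point equivalent if there is a local diffeomorphism $(x,y)\mapsto(\tilde x,\tilde y)$ of the plane of dependent and independent variables whose prolongation (to first jets) maps base point to base point and carries solutions of one to solutions of the other. Dual equation (Cartan duality): the solutions of $y''=\Phi(x,y,y')$ near the given solution form a two-dimensional manifold $Z$ (the solution space, or twistor space). Each point $(x,y)$ defines a curve in $Z$, consisting of the solutions passing through $(x,y)$ (with derivative close to the given one). In local coordinates $(t,z)$ on $Z$ in which the curve of solutions through the base point $(x_0,y_0)$ is transverse to $\{t=\mathrm{const}\}$ at the given solution, this two-parameter family of curves is the set of solutions of a second order ODE $z''=F(t,z,z')$, called the dual equation. It is well defined up to point equivalence, and the dual of the dual equation is point equivalent to the original one. *)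

theory Defs
  imports "HOL-Analysis.Analysis"
begin

section \<open>Smooth maps\<close>

text \<open>Only used on open sets of Euclidean spaces, where continuity of all iterated directional
  derivatives is the usual \<open>C\<^sup>k\<close> condition.\<close>

primrec Ck_on :: "nat \<Rightarrow> 'a::euclidean_space set \<Rightarrow> ('a \<Rightarrow> 'b::euclidean_space) \<Rightarrow> bool" where
  "Ck_on 0 U f \<longleftrightarrow> continuous_on U f"
| "Ck_on (Suc k) U f \<longleftrightarrow>
     (\<forall>x\<in>U. f differentiable (at x)) \<and>
     (\<forall>v. Ck_on k U (\<lambda>x. frechet_derivative f (at x) v))"

definition smooth_on :: "'a::euclidean_space set \<Rightarrow> ('a \<Rightarrow> 'b::euclidean_space) \<Rightarrow> bool" where
  "smooth_on U f \<longleftrightarrow> open U \<and> (\<forall>k. Ck_on k U f)"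

definition smooth_near :: "'a::euclidean_space \<Rightarrow> ('a \<Rightarrow> 'b::euclidean_space) \<Rightarrow> bool" where
  "smooth_near a f \<longleftrightarrow> (\<exists>U. a \<in> U \<and> smooth_on U f)"

definition diffeo_on ::
  "'a::euclidean_space set \<Rightarrow> 'b::euclidean_space set \<Rightarrow> ('a \<Rightarrow> 'b) \<Rightarrow> bool" where
  "diffeo_on U V f \<longleftrightarrow> bij_betw f U V \<and> smooth_on U f \<and> smooth_on V (inv_into U f)"


section \<open>Second order ODEs\<close>

text \<open>A germ of a second order ODE \<open>y'' = \<Phi>(x,y,y')\<close> is a function \<open>\<Phi>\<close>, smooth near a base point
  \<open>(x\<^sub>0,y\<^sub>0,y\<^sub>0')\<close>.  Functions are total, so only the values of \<open>\<Phi>\<close> near the base point are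
  meaningful; the open sets \<open>W\<close> of 1-jets below can always be shrunk.\<close>

type_synonym jet = "real \<times> real \<times> real"
type_synonym ode = "jet \<Rightarrow> real"

definition jet_pt :: "jet \<Rightarrow> real \<times> real" where
  "jet_pt = (\<lambda>(x, y, p). (x, y))"

definition solves :: "ode \<Rightarrow> real set \<Rightarrow> (real \<Rightarrow> real) \<Rightarrow> bool" where
  "solves \<Phi> I u \<longleftrightarrow> open I \<and> is_interval I \<and>
     (\<forall>x\<in>I. u differentiable (at x) \<and>
            (deriv u has_real_derivative \<Phi> (x, u x, deriv u x)) (at x))"

definition jets_in :: "jet set \<Rightarrow> real set \<Rightarrow> (real \<Rightarrow> real) \<Rightarrow> bool" where
  "jets_in W I u \<longleftrightarrow> open I \<and> is_interval I \<and>
     (\<forall>x\<in>I. u differentiable (at x) \<and> (x, u x, deriv u x) \<in> W)"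

definition graph_on :: "real set \<Rightarrow> (real \<Rightarrow> real) \<Rightarrow> (real \<times> real) set" where
  "graph_on I u = (\<lambda>x. (x, u x)) ` I"

text \<open>Right-hand side of the derivative of \<open>y' = G(x,y)\<close>.\<close>

definition derived_ode :: "(real \<times> real \<Rightarrow> real) \<Rightarrow> ode" where
  "derived_ode G = (\<lambda>(x, y, p). deriv (\<lambda>s. G (s, y)) x + deriv (\<lambda>s. G (x, s)) y * p)"


section \<open>Point equivalence\<close>

text \<open>The prolongation sends the direction \<open>(1,p)\<close> at \<open>(x,y)\<close> to the direction of its image under
  the differential of \<open>f\<close>; it is defined at those 1-jets where the image is not vertical.\<close>

definition prolongable :: "(real \<times> real \<Rightarrow> real \<times> real) \<Rightarrow> jet \<Rightarrow> bool" where
  "prolongable f = (\<lambda>(x, y, p). fst (frechet_derivative f (at (x, y)) (1, p)) \<noteq> 0)"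

definition prolong :: "(real \<times> real \<Rightarrow> real \<times> real) \<Rightarrow> jet \<Rightarrow> jet" where
  "prolong f = (\<lambda>(x, y, p).
     (fst (f (x, y)), snd (f (x, y)),
      snd (frechet_derivative f (at (x, y)) (1, p)) / fst (frechet_derivative f (at (x, y)) (1, p))))"

definition point_equivalent :: "ode \<Rightarrow> jet \<Rightarrow> ode \<Rightarrow> jet \<Rightarrow> bool" where
  "point_equivalent \<Phi> a \<Psi> b \<longleftrightarrow>
     (\<exists>f U V W. diffeo_on U V f \<and> open W \<and> a \<in> W \<and> jet_pt ` W \<subseteq> U \<and>
        prolongable f a \<and> prolong f a = b \<and>
        (\<forall>I u. jets_in W I u \<longrightarrow>
           (solves \<Phi> I u \<longleftrightarrow> (\<exists>J v. solves \<Psi> J v \<and> f ` graph_on I u = graph_on J v))))"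


section \<open>The dual equation\<close>

text \<open>Local coordinates \<open>(t,z) \<in> \<Omega>\<close>, centred at \<open>(t\<^sub>0,z\<^sub>0)\<close>, on the manifold \<open>Z\<close> of solutions of
  \<open>y'' = \<Phi>(x,y,y')\<close> near the solution through the 1-jet \<open>(x\<^sub>0,y\<^sub>0,y\<^sub>0')\<close>: the solution with
  coordinates \<open>(t,z)\<close> is \<open>x \<mapsto> s(x,(t,z))\<close> on \<open>I\<close>.  The manifold structure of \<open>Z\<close> is the one given by
  the initial values \<open>(y(x\<^sub>0), y'(x\<^sub>0))\<close>.\<close>

definition solution_chart ::
  "ode \<Rightarrow> jet \<Rightarrow> (real \<times> (real \<times> real) \<Rightarrow> real) \<Rightarrow> real set \<Rightarrow> (real \<times> real) set
     \<Rightarrow> real \<times> real \<Rightarrow> bool" where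
  "solution_chart \<Phi> a s I \<Omega> c \<longleftrightarrow>
     (case a of (x0, y0, p0) \<Rightarrow>
        open I \<and> is_interval I \<and> x0 \<in> I \<and> open \<Omega> \<and> c \<in> \<Omega> \<and> smooth_on (I \<times> \<Omega>) s \<and>
        (\<forall>\<zeta>\<in>\<Omega>. solves \<Phi> I (\<lambda>x. s (x, \<zeta>))) \<and>
        (\<exists>V. diffeo_on \<Omega> V (\<lambda>\<zeta>. (s (x0, \<zeta>), deriv (\<lambda>x. s (x, \<zeta>)) x0))) \<and>
        s (x0, c) = y0 \<and> deriv (\<lambda>x. s (x, c)) x0 = p0)"

definition point_curve ::
  "(real \<times> (real \<times> real) \<Rightarrow> real) \<Rightarrow> (real \<times> real) set \<Rightarrow> real \<times> real \<Rightarrow> (real \<times> real) set" where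
  "point_curve s \<Omega> = (\<lambda>(x, y). {\<zeta> \<in> \<Omega>. s (x, \<zeta>) = y})"

text \<open>The curve of the base point is the level set of \<open>\<sigma> = s(x\<^sub>0,\<cdot>)\<close> through \<open>(t\<^sub>0,z\<^sub>0)\<close>.  It is
  transverse to \<open>t = const\<close> there iff \<open>\<partial>\<^sub>z\<sigma> \<noteq> 0\<close>, and its slope \<open>z\<^sub>0'\<close>, which completes the base
  point of the dual equation, is then given by \<open>\<partial>\<^sub>t\<sigma> + z\<^sub>0' \<partial>\<^sub>z\<sigma> = 0\<close>.  The last clause says that,
  near the base points, the solutions of \<open>z'' = F(t,z,z')\<close> are exactly the curves of the points
  \<open>(x,y)\<close>.\<close>

definition dual_ode :: "ode \<Rightarrow> jet \<Rightarrow> ode \<Rightarrow> jet \<Rightarrow> bool" where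
  "dual_ode \<Phi> a F b \<longleftrightarrow>
     (case a of (x0, y0, p0) \<Rightarrow> case b of (t0, z0, q0) \<Rightarrow>
        (\<exists>s I \<Omega> P W.
           solution_chart \<Phi> a s I \<Omega> (t0, z0) \<and>
           deriv (\<lambda>z. s (x0, (t0, z))) z0 \<noteq> 0 \<and>
           deriv (\<lambda>t. s (x0, (t, z0))) t0 + q0 * deriv (\<lambda>z. s (x0, (t0, z))) z0 = 0 \<and>
           open P \<and> (x0, y0) \<in> P \<and> fst ` P \<subseteq> I \<and>
           open W \<and> b \<in> W \<and> jet_pt ` W \<subseteq> \<Omega> \<and>
           (\<forall>J w. jets_in W J w \<longrightarrow>
              (solves F J w \<longleftrightarrow> (\<exists>m\<in>P. graph_on J w \<subseteq> point_curve s \<Omega> m)))))"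


section \<open>The invariant \<open>K\<^sub>0\<close>\<close>

definition dt :: "ode \<Rightarrow> ode" where
  "dt h = (\<lambda>(t, z, p). deriv (\<lambda>r. h (r, z, p)) t)"

definition dz :: "ode \<Rightarrow> ode" where
  "dz h = (\<lambda>(t, z, p). deriv (\<lambda>r. h (t, r, p)) z)"

definition dp :: "ode \<Rightarrow> ode" where
  "dp h = (\<lambda>(t, z, p). deriv (\<lambda>r. h (t, z, r)) p)"

definition X_field :: "ode \<Rightarrow> (jet \<Rightarrow> real) \<Rightarrow> jet \<Rightarrow> real" where
  "X_field F h = (\<lambda>(t, z, p). dt h (t, z, p) + p * dz h (t, z, p) + F (t, z, p) * dp h (t, z, p))"

definition K0 :: "ode \<Rightarrow> jet \<Rightarrow> real" where
  "K0 F a = - dz F a + (1/2) * X_field F (dp F) a - (1/4) * (dp F a)\<^sup>2"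

end

(*
  Let w(t,x,y) be the curve of the point (x,y) in the solution space with coordinates (t,z). Along
  it the derivatives w_x and w_y solve the linearised dual equation and -w_x / w_y is the slope
  p = y' at x of the solution (t,z). Hence K_0 is half the Schwarzian derivative of t |-> p, and
  K_0 = 0 means that at each point (x,y) the slope p is a Moebius function of t.

  If K_0 = 0, fix c close to but different from t_0 and take X = w(c,x,y), Y = w_t(c,x,y) as
  coordinates of the point (x,y); the Moebius relation becomes
  dY/dX = F_p(c,X,Y)/2 - 1/(t - c), where t is constant on solutions. This explicit choice needs no
  integration. Conversely, for an equation equivalent to the derivative of y' = G, the first
  integral Y' - G(X,Y) is a Moebius function of p, and taking it as the coordinate t makes K_0 = 0.
*)
theory Submission
  imports Defs
begin

section \<open>Calculus of smooth maps\<close>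

text \<open>Along a solution, K_0 is the potential of the linearised dual equation: dividing by the
  exponential of half the integral of F_{z'} does not change ratios of solutions and brings the
  equation to v'' + K_0 v = 0, so a ratio p of two solutions has Schwarzian derivative 2 K_0. The
  integrating factor is never formed; the logarithmic derivative of w_y and its Riccati equation
  replace it.

  The obstacle is that duality and point equivalence are both given through sets of solution graphs,
  so identities between right-hand sides have to be extracted from them. This is done on two
  families that describe one incidence relation: the solutions, parametrised by (t,z), and the
  curves of points, parametrised by (x,y). What is obtained in this way holds only at the jets of
  these families, and inverse function arguments show that such jets fill a neighbourhood of the
  base jet. For the passage back, from an identity at each jet to an equivalence of solution sets,
  it suffices to differentiate the slope of the image.\<close>

lemma Ck_on_SucD: "Ck_on (Suc k) U f \<Longrightarrow> Ck_on k U f"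
proof (induction k arbitrary: f)
  case 0
  then show ?case
    by (auto intro!: continuous_at_imp_continuous_on differentiable_imp_continuous_within)
qed auto

lemma frechet_derivative_cong_open:
  assumes "open U" "x \<in> U" "\<And>x. x \<in> U \<Longrightarrow> f x = g x"
  shows "frechet_derivative f (at x) = frechet_derivative g (at x)"
proof -
  have "(f has_derivative D) (at x) \<longleftrightarrow> (g has_derivative D) (at x)" for D
    using has_derivative_transform_within_open[OF _ assms(1,2)] assms(3) by metis
  then show ?thesis by (simp add: frechet_derivative_def)
qed

lemma differentiable_cong_open:
  assumes "open U" "x \<in> U" "\<And>x. x \<in> U \<Longrightarrow> f x = g x" "f differentiable (at x)"
  shows "g differentiable (at x)"
  using assms(4) has_derivative_transform_within_open[OF _ assms(1,2)] assms(3)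
  unfolding differentiable_def by metis

lemma Ck_on_cong:
  assumes "open U" "\<And>x. x \<in> U \<Longrightarrow> f x = g x" "Ck_on k U f"
  shows "Ck_on k U g"
  using assms(2,3)
proof (induction k arbitrary: f g)
  case 0
  then show ?case using continuous_on_cong by force
next
  case (Suc k)
  have "Ck_on k U (\<lambda>x. frechet_derivative g (at x) v)" for v
  proof (rule Suc.IH)
    show "Ck_on k U (\<lambda>x. frechet_derivative f (at x) v)"
      using Suc.prems(2) by simp
    show "frechet_derivative f (at x) v = frechet_derivative g (at x) v" if "x \<in> U" for x
      by (rule fun_cong[OF frechet_derivative_cong_open[OF \<open>open U\<close> that Suc.prems(1)]])
  qed
  moreover have "g differentiable (at x)" if "x \<in> U" for x
    using differentiable_cong_open[OF \<open>open U\<close> that Suc.prems(1)] Suc.prems(2) that by simp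
  ultimately show ?case by simp
qed

text \<open>\<open>Ck_on\<close> recurses on \<open>frechet_derivative\<close>, while in practice
  the derivative comes as a formula \<open>D\<close>. On an open set the two agree, so smoothness of
  the formula is enough; most closure properties are inductions through this rule.\<close>

lemma Ck_on_SucI:
  assumes "open U" "\<And>x. x \<in> U \<Longrightarrow> (f has_derivative D x) (at x)"
    and "\<And>v. Ck_on k U (\<lambda>x. D x v)"
  shows "Ck_on (Suc k) U f"
proof -
  have "Ck_on k U (\<lambda>x. frechet_derivative f (at x) v)" for v
    by (rule Ck_on_cong[OF assms(1) _ assms(3)[of v]])
       (rule fun_cong[OF frechet_derivative_at[OF assms(2)]])
  then show ?thesis using assms(2) by (auto simp: differentiable_def)
qed

lemma Ck_on_has_derivative:
  assumes "Ck_on (Suc k) U f" "x \<in> U"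
  shows "(f has_derivative frechet_derivative f (at x)) (at x)"
  using assms frechet_derivative_works by auto

lemma Ck_on_subset: "Ck_on k U f \<Longrightarrow> V \<subseteq> U \<Longrightarrow> Ck_on k V f"
  by (induction k arbitrary: f) (auto intro: continuous_on_subset)

lemma Ck_on_const: "open U \<Longrightarrow> Ck_on k U (\<lambda>x. c)"
proof (induction k arbitrary: c)
  case (Suc k)
  then show ?case by (intro Ck_on_SucI[where D = "\<lambda>_ _. 0"]) auto
qed auto

lemma Ck_on_linear_compose:
  assumes "bounded_linear L" "open U" "Ck_on k U f"
  shows "Ck_on k U (\<lambda>x. L (f x))"
  using assms(3)
proof (induction k arbitrary: f)
  case 0
  then show ?case using assms(1) by (simp add: bounded_linear.continuous_on)
next
  case (Suc k)
  have "Ck_on k U (\<lambda>x. L (frechet_derivative f (at x) v))" for v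
    using Suc.prems by (intro Suc.IH) simp
  then show ?case
    using Ck_on_has_derivative[OF Suc.prems]
    by (intro Ck_on_SucI[where D = "\<lambda>x v. L (frechet_derivative f (at x) v)"] assms(2)
        bounded_linear.has_derivative[OF assms(1)])
qed

lemma Ck_on_linear:
  assumes "bounded_linear L" "open U"
  shows "Ck_on k U L"
proof (cases k)
  case 0
  then show ?thesis using assms by (simp add: linear_continuous_on)
next
  case (Suc k)
  show ?thesis
    unfolding Suc by (rule Ck_on_SucI[where D = "\<lambda>x. L"])
      (use assms in \<open>auto intro: bounded_linear_imp_has_derivative Ck_on_const\<close>)
qed

lemma Ck_on_add:
  assumes "open U" "Ck_on k U f" "Ck_on k U g"
  shows "Ck_on k U (\<lambda>x. f x + g x)"
  using assms(2,3)
proof (induction k arbitrary: f g)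
  case 0
  then show ?case by (auto intro: continuous_intros)
next
  case (Suc k)
  have "Ck_on k U (\<lambda>x. frechet_derivative f (at x) v + frechet_derivative g (at x) v)" for v
    using Suc.prems by (intro Suc.IH) simp_all
  then show ?case
    using Ck_on_has_derivative[OF Suc.prems(1)] Ck_on_has_derivative[OF Suc.prems(2)]
    by (intro Ck_on_SucI[where D = "\<lambda>x v. frechet_derivative f (at x) v + frechet_derivative g (at x) v"]
        assms(1) has_derivative_add)
qed

lemma Ck_on_bilinear:
  assumes "bounded_bilinear pr" "open U" "Ck_on k U f" "Ck_on k U g"
  shows "Ck_on k U (\<lambda>x. pr (f x) (g x))"
  using assms(3,4)
proof (induction k arbitrary: f g)
  case 0
  then show ?case using assms(1) by (auto intro: bounded_bilinear.continuous_on)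
next
  case (Suc k)
  note IH = Suc.IH and f = Suc.prems(1) and g = Suc.prems(2)
  have "Ck_on k U (\<lambda>x. pr (f x) (frechet_derivative g (at x) v) + pr (frechet_derivative f (at x) v) (g x))"
    for v
    using f g Ck_on_SucD[OF f] Ck_on_SucD[OF g] by (intro Ck_on_add assms IH) auto
  then show ?case
    using Ck_on_has_derivative[OF f] Ck_on_has_derivative[OF g]
    by (intro Ck_on_SucI[where D = "\<lambda>x v. pr (f x) (frechet_derivative g (at x) v)
          + pr (frechet_derivative f (at x) v) (g x)"]
        assms(2) bounded_bilinear.FDERIV[OF assms(1)])
qed

lemma Ck_on_sum:
  assumes "open U" "\<And>i. i \<in> A \<Longrightarrow> Ck_on k U (f i)"
  shows "Ck_on k U (\<lambda>x. \<Sum>i\<in>A. f i x)"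
  using assms by (induction A rule: infinite_finite_induct) (auto intro!: Ck_on_add Ck_on_const)

lemma linear_eq_sum_Basis:
  fixes L :: "'a::euclidean_space \<Rightarrow> 'b::real_vector"
  assumes "linear L"
  shows "L v = (\<Sum>b\<in>Basis. (v \<bullet> b) *\<^sub>R L b)"
  by (metis (no_types, lifting) assms euclidean_representation linear_sum linear_cmul sum.cong)

lemma Ck_on_compose:
  assumes "open U" "open V" "f ` U \<subseteq> V" "Ck_on k U f" "Ck_on k V g"
  shows "Ck_on k U (\<lambda>x. g (f x))"
  using assms(4,5)
proof (induction k arbitrary: g)
  case 0
  then show ?case using assms(3) by (auto intro: continuous_on_compose2)
next
  case (Suc k)
  note f = Suc.prems(1) and g = Suc.prems(2)
  let ?D = "\<lambda>x v. frechet_derivative g (at (f x)) (frechet_derivative f (at x) v)"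
  \<comment> \<open>The induction hypothesis concerns derivatives of \<open>g\<close> in a fixed
    direction, whereas the chain rule has a direction that moves with \<open>x\<close>. Expanding it
    in \<open>Basis\<close> leaves a finite sum of products of functions already known to be
    \<open>Ck_on k\<close>.\<close>
  have eq: "?D x v = (\<Sum>b\<in>Basis. (frechet_derivative f (at x) v \<bullet> b) *\<^sub>R frechet_derivative g (at (f x)) b)"
    if "x \<in> U" for x v
    using Ck_on_has_derivative[OF g, of "f x"] that assms(3)
    by (intro linear_eq_sum_Basis) (auto dest: has_derivative_linear)
  have "Ck_on k U (\<lambda>x. \<Sum>b\<in>Basis. (frechet_derivative f (at x) v \<bullet> b) *\<^sub>R frechet_derivative g (at (f x)) b)" for v
    using f g Ck_on_SucD[OF f]
    by (intro Ck_on_sum assms Ck_on_bilinear[OF bounded_bilinear_scaleR] Suc.IH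
        Ck_on_linear_compose[OF bounded_linear_inner_left]) auto
  then have "Ck_on k U (\<lambda>x. ?D x v)" for v
    by (rule Ck_on_cong[OF assms(1), rotated]) (simp only: eq)
  moreover have "((\<lambda>x. g (f x)) has_derivative ?D x) (at x)" if "x \<in> U" for x
    using that assms(3)
    by (intro has_derivative_compose[OF Ck_on_has_derivative[OF f] Ck_on_has_derivative[OF g]]) auto
  ultimately show ?case
    by (intro Ck_on_SucI[where D = ?D] assms(1))
qed

text \<open>The derivative of \<open>inverse\<close> is a product of copies of
  \<open>inverse\<close> and a constant, so the induction on \<open>k\<close> feeds itself.\<close>

lemma Ck_on_inverse: "Ck_on k (- {0}) (inverse :: real \<Rightarrow> real)"
proof (induction k)
  case 0
  then show ?case by (auto intro: continuous_intros)
next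
  case (Suc k)
  have "Ck_on k (- {0}) (\<lambda>x::real. - (inverse x * v * inverse x))" for v
    using Suc by (intro Ck_on_linear_compose[OF bounded_linear_minus[OF bounded_linear_ident]]
        Ck_on_bilinear[OF bounded_bilinear_mult] Ck_on_const) auto
  then show ?case
    by (intro Ck_on_SucI[where D = "\<lambda>x v. - (inverse x * v * inverse x)"]) (auto intro!: derivative_eq_intros)
qed

lemma smooth_onD: "smooth_on U f \<Longrightarrow> Ck_on k U f" "smooth_on U f \<Longrightarrow> open U"
  by (auto simp: smooth_on_def)

lemma smooth_on_subset: "smooth_on U f \<Longrightarrow> open V \<Longrightarrow> V \<subseteq> U \<Longrightarrow> smooth_on V f"
  by (auto simp: smooth_on_def intro: Ck_on_subset)

lemma smooth_on_cong:
  assumes "smooth_on U f" "\<And>x. x \<in> U \<Longrightarrow> f x = g x" shows "smooth_on U g"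
  using assms Ck_on_cong unfolding smooth_on_def by metis

lemma smooth_on_const: "open U \<Longrightarrow> smooth_on U (\<lambda>x. c)"
  by (auto simp: smooth_on_def intro: Ck_on_const)

lemma smooth_on_linear: "bounded_linear L \<Longrightarrow> open U \<Longrightarrow> smooth_on U L"
  by (auto simp: smooth_on_def intro: Ck_on_linear)

lemma smooth_on_ident: "open U \<Longrightarrow> smooth_on U (\<lambda>x. x)"
  by (rule smooth_on_linear) (auto simp: bounded_linear_ident)

lemma smooth_on_linear_compose:
  "bounded_linear L \<Longrightarrow> smooth_on U f \<Longrightarrow> smooth_on U (\<lambda>x. L (f x))"
  by (auto simp: smooth_on_def intro: Ck_on_linear_compose)

lemmas smooth_on_fst = smooth_on_linear_compose[OF bounded_linear_fst]
  and smooth_on_snd = smooth_on_linear_compose[OF bounded_linear_snd]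
  and smooth_on_inner_left = smooth_on_linear_compose[OF bounded_linear_inner_left]
  and smooth_on_uminus = smooth_on_linear_compose[OF bounded_linear_minus[OF bounded_linear_ident]]

lemma smooth_on_add: "smooth_on U f \<Longrightarrow> smooth_on U g \<Longrightarrow> smooth_on U (\<lambda>x. f x + g x)"
  by (auto simp: smooth_on_def intro: Ck_on_add)

lemma smooth_on_diff: "smooth_on U f \<Longrightarrow> smooth_on U g \<Longrightarrow> smooth_on U (\<lambda>x. f x - g x)"
  using smooth_on_add[OF _ smooth_on_uminus] by fastforce

lemma smooth_on_sum:
  "open U \<Longrightarrow> (\<And>i. i \<in> A \<Longrightarrow> smooth_on U (f i)) \<Longrightarrow> smooth_on U (\<lambda>x. \<Sum>i\<in>A. f i x)"
  by (auto simp: smooth_on_def intro: Ck_on_sum)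

lemma smooth_on_bilinear:
  "bounded_bilinear pr \<Longrightarrow> smooth_on U f \<Longrightarrow> smooth_on U g \<Longrightarrow> smooth_on U (\<lambda>x. pr (f x) (g x))"
  by (auto simp: smooth_on_def intro: Ck_on_bilinear)

lemmas smooth_on_mult = smooth_on_bilinear[OF bounded_bilinear_mult]
  and smooth_on_scaleR = smooth_on_bilinear[OF bounded_bilinear_scaleR]

lemma smooth_on_compose:
  "smooth_on U f \<Longrightarrow> smooth_on V g \<Longrightarrow> f ` U \<subseteq> V \<Longrightarrow> smooth_on U (\<lambda>x. g (f x))"
  unfolding smooth_on_def using Ck_on_compose by blast

lemma smooth_on_divide:
  fixes f g :: "'a::euclidean_space \<Rightarrow> real"
  assumes "smooth_on U f" "smooth_on U g" "\<And>x. x \<in> U \<Longrightarrow> g x \<noteq> 0"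
  shows "smooth_on U (\<lambda>x. f x / g x)"
proof -
  have "smooth_on (- {0}) (inverse :: real \<Rightarrow> real)"
    by (simp add: smooth_on_def Ck_on_inverse open_delete open_Compl)
  then have "smooth_on U (\<lambda>x. inverse (g x))"
    by (rule smooth_on_compose[OF assms(2)]) (use assms(3) in auto)
  from smooth_on_mult[OF assms(1) this] show ?thesis by (simp add: divide_inverse)
qed

lemma smooth_on_Pair:
  fixes f :: "'a::euclidean_space \<Rightarrow> 'b::euclidean_space" and g :: "'a \<Rightarrow> 'c::euclidean_space"
  assumes "smooth_on U f" "smooth_on U g" shows "smooth_on U (\<lambda>x. (f x, g x))"
proof -
  have "smooth_on U (\<lambda>x. (f x, 0) + (0, g x))"
    by (intro smooth_on_add smooth_on_linear_compose[OF _ assms(1)] smooth_on_linear_compose[OF _ assms(2)]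
        bounded_linear_Pair bounded_linear_ident bounded_linear_zero)
  then show ?thesis by simp
qed

lemma smooth_on_has_derivative:
  assumes "smooth_on U f" "x \<in> U"
  shows "(f has_derivative frechet_derivative f (at x)) (at x)"
  using Ck_on_has_derivative[OF smooth_onD(1)[OF assms(1)]] assms(2) by blast

lemma smooth_on_linear_derivative:
  "smooth_on U f \<Longrightarrow> x \<in> U \<Longrightarrow> linear (frechet_derivative f (at x))"
  using smooth_on_has_derivative has_derivative_linear by blast

lemma smooth_on_continuous_on: "smooth_on U f \<Longrightarrow> continuous_on U f"
  using smooth_onD(1)[of U f 0] by simp

lemma smooth_on_continuous_at: "smooth_on U f \<Longrightarrow> x \<in> U \<Longrightarrow> isCont f x"
  using smooth_on_continuous_on smooth_onD(2) continuous_on_eq_continuous_at by blast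

lemma smooth_on_frechet_const:
  "smooth_on U f \<Longrightarrow> smooth_on U (\<lambda>x. frechet_derivative f (at x) v)"
  unfolding smooth_on_def by (metis Ck_on.simps(2))

text \<open>Point and direction vary together here; the expansion in \<open>Basis\<close> separates
  them into smooth coefficients and derivatives in fixed directions.\<close>

lemma smooth_on_frechet:
  assumes f: "smooth_on V f" and g: "smooth_on U g" "g ` U \<subseteq> V" and h: "smooth_on U h"
  shows "smooth_on U (\<lambda>x. frechet_derivative f (at (g x)) (h x))"
proof -
  have "smooth_on U (\<lambda>x. \<Sum>b\<in>Basis. (h x \<bullet> b) *\<^sub>R frechet_derivative f (at (g x)) b)"
    by (intro smooth_on_sum smooth_on_scaleR smooth_on_inner_left h smooth_onD(2)[OF g(1)] g(2)
        smooth_on_compose[OF g(1) smooth_on_frechet_const[OF f]])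
  then show ?thesis
  proof (rule smooth_on_cong)
    fix x assume "x \<in> U"
    then show "(\<Sum>b\<in>Basis. (h x \<bullet> b) *\<^sub>R frechet_derivative f (at (g x)) b)
        = frechet_derivative f (at (g x)) (h x)"
      using g(2) by (intro linear_eq_sum_Basis[symmetric] smooth_on_linear_derivative[OF f]) auto
  qed
qed

lemmas smooth_intros = smooth_on_const smooth_on_ident smooth_on_fst smooth_on_snd smooth_on_add
  smooth_on_diff smooth_on_uminus smooth_on_mult smooth_on_divide smooth_on_Pair

lemma smooth_on_curve_vector:
  assumes "smooth_on U h" "\<gamma> r \<in> U" "(\<gamma> has_vector_derivative \<gamma>') (at r)"
  shows "((\<lambda>r. h (\<gamma> r)) has_vector_derivative frechet_derivative h (at (\<gamma> r)) \<gamma>') (at r)"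
proof -
  note d = smooth_on_has_derivative[OF assms(1,2)]
  have "((\<lambda>r. h (\<gamma> r)) has_derivative (\<lambda>x. frechet_derivative h (at (\<gamma> r)) (x *\<^sub>R \<gamma>'))) (at r)"
    using has_derivative_compose[OF assms(3)[unfolded has_vector_derivative_def] d] .
  then show ?thesis
    unfolding has_vector_derivative_def linear_cmul[OF has_derivative_linear[OF d]] .
qed

lemma smooth_on_curve:
  fixes h :: "'a::euclidean_space \<Rightarrow> real"
  assumes "smooth_on U h" "\<gamma> r \<in> U" "(\<gamma> has_vector_derivative \<gamma>') (at r)"
  shows "((\<lambda>r. h (\<gamma> r)) has_real_derivative frechet_derivative h (at (\<gamma> r)) \<gamma>') (at r)"
  using smooth_on_curve_vector[OF assms] by (simp add: has_real_derivative_iff_has_vector_derivative)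

section \<open>Symmetry of second derivatives\<close>

lemma mixed_difference_mvt:
  fixes h :: "'a::euclidean_space \<Rightarrow> real"
  assumes h: "smooth_on U h" and r: "r > 0"
    and box: "\<And>s t. \<bar>s\<bar> \<le> r \<Longrightarrow> \<bar>t\<bar> \<le> r \<Longrightarrow> x + s *\<^sub>R u + t *\<^sub>R v \<in> U"
  obtains s t where "0 < s" "s < r" "0 < t" "t < r"
    "h (x + r *\<^sub>R u + r *\<^sub>R v) - h (x + r *\<^sub>R u) - h (x + r *\<^sub>R v) + h x
      = r * r * frechet_derivative (\<lambda>y. frechet_derivative h (at y) u) (at (x + s *\<^sub>R u + t *\<^sub>R v)) v"
proof -
  define D where "D = (\<lambda>y. frechet_derivative h (at y) u)"
  have D: "smooth_on U D" unfolding D_def by (rule smooth_on_frechet_const[OF h])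
  have d1: "((\<lambda>s. h (x + s *\<^sub>R u + t *\<^sub>R v)) has_real_derivative D (x + s *\<^sub>R u + t *\<^sub>R v)) (at s)"
    if "\<bar>s\<bar> \<le> r" "\<bar>t\<bar> \<le> r" for s t
    unfolding D_def by (rule smooth_on_curve[OF h]) (use box[OF that] in \<open>auto intro!: derivative_eq_intros\<close>)
  have d2: "((\<lambda>t. D (x + s *\<^sub>R u + t *\<^sub>R v)) has_real_derivative
      frechet_derivative D (at (x + s *\<^sub>R u + t *\<^sub>R v)) v) (at t)"
    if "\<bar>s\<bar> \<le> r" "\<bar>t\<bar> \<le> r" for s t
    by (rule smooth_on_curve[OF D]) (use box[OF that] in \<open>auto intro!: derivative_eq_intros\<close>)
  \<comment> \<open>The second difference is the increment over \<open>[0, r]\<close> of a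
    difference in direction \<open>v\<close>. The mean value theorem, once in \<open>s\<close> and
    once in \<open>t\<close>, turns it into a mixed derivative at an interior point. Exchanging
    \<open>u\<close> and \<open>v\<close> does not change the second difference.\<close>
  define \<psi> where "\<psi> = (\<lambda>s. h (x + s *\<^sub>R u + r *\<^sub>R v) - h (x + s *\<^sub>R u))"
  have "(\<psi> has_real_derivative D (x + s *\<^sub>R u + r *\<^sub>R v) - D (x + s *\<^sub>R u)) (at s)"
    if "0 \<le> s" "s \<le> r" for s
    unfolding \<psi>_def using d1[of s r] d1[of s 0] that r by (auto intro!: derivative_intros)
  from MVT2[OF r this] obtain s where s: "0 < s" "s < r"
    "\<psi> r - \<psi> 0 = r * (D (x + s *\<^sub>R u + r *\<^sub>R v) - D (x + s *\<^sub>R u))"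
    by auto
  have "((\<lambda>t. D (x + s *\<^sub>R u + t *\<^sub>R v)) has_real_derivative
      frechet_derivative D (at (x + s *\<^sub>R u + t *\<^sub>R v)) v) (at t)" if "0 \<le> t" "t \<le> r" for t
    using d2[of s t] s that by auto
  from MVT2[OF r this] obtain t where t: "0 < t" "t < r"
    "D (x + s *\<^sub>R u + r *\<^sub>R v) - D (x + s *\<^sub>R u) = r * frechet_derivative D (at (x + s *\<^sub>R u + t *\<^sub>R v)) v"
    by auto
  show ?thesis
    by (rule that[OF s(1,2) t(1,2)]) (use s(3) t(3) in \<open>simp add: \<psi>_def D_def\<close>)
qed

text \<open>One second difference equals \<open>r * r * A\<close> at one nearby point and
  \<open>r * r * B\<close> at another, where \<open>A\<close> and \<open>B\<close> are the two
  iterated derivatives. Continuity of both at \<open>x\<close> then identifies their values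
  there.\<close>

lemma smooth_on_frechet_commute:
  fixes h :: "'a::euclidean_space \<Rightarrow> real"
  assumes h: "smooth_on U h" and x: "x \<in> U"
  shows "frechet_derivative (\<lambda>y. frechet_derivative h (at y) u) (at x) v
       = frechet_derivative (\<lambda>y. frechet_derivative h (at y) v) (at x) u"
proof -
  define A where "A = (\<lambda>y. frechet_derivative (\<lambda>y. frechet_derivative h (at y) u) (at y) v)"
  define B where "B = (\<lambda>y. frechet_derivative (\<lambda>y. frechet_derivative h (at y) v) (at y) u)"
  have "isCont A x" "isCont B x"
    unfolding A_def B_def
    by (rule smooth_on_continuous_at[OF smooth_on_frechet_const[OF smooth_on_frechet_const[OF h]] x])+
  have "\<bar>A x - B x\<bar> \<le> e" if "e > 0" for e
  proof -
    have "e / 2 > 0" using that by simp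
    then obtain d1 d2 where d1: "d1 > 0" "\<And>y. dist y x < d1 \<Longrightarrow> dist (A y) (A x) < e / 2"
      and d2: "d2 > 0" "\<And>y. dist y x < d2 \<Longrightarrow> dist (B y) (B x) < e / 2"
      using \<open>isCont A x\<close> \<open>isCont B x\<close> unfolding continuous_at_eps_delta by metis
    obtain d3 where d3: "d3 > 0" "ball x d3 \<subseteq> U"
      using smooth_onD(2)[OF h] x open_contains_ball by blast
    define d where "d = min d1 (min d2 d3)"
    have d: "d > 0" using d1 d2 d3 by (simp add: d_def)
    \<comment> \<open>This size keeps all \<open>x + s u + t v\<close> with \<open>s\<close>,
      \<open>t\<close> of modulus at most \<open>r\<close> within distance \<open>d\<close> of
      \<open>x\<close>; the summand 1 covers \<open>u = v = 0\<close>.\<close>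
    define r where "r = d / (2 * (norm u + norm v + 1))"
    have r: "r > 0" using d by (simp add: r_def add_nonneg_pos)
    have near: "dist (x + s *\<^sub>R u + t *\<^sub>R v) x < d" if "\<bar>s\<bar> \<le> r" "\<bar>t\<bar> \<le> r" for s t
    proof -
      have "dist (x + s *\<^sub>R u + t *\<^sub>R v) x \<le> \<bar>s\<bar> * norm u + \<bar>t\<bar> * norm v"
        using norm_triangle_ineq[of "s *\<^sub>R u" "t *\<^sub>R v"] by (simp add: dist_norm)
      also have "\<dots> \<le> r * norm u + r * norm v"
        using that by (intro add_mono mult_right_mono) auto
      also have "\<dots> \<le> r * (norm u + norm v + 1)" using r by (simp add: algebra_simps)
      also have "\<dots> = d / 2"
        using add_nonneg_pos[of "norm u + norm v" 1] by (simp add: r_def field_simps)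
      finally show ?thesis using d by simp
    qed
    have box: "x + s *\<^sub>R u + t *\<^sub>R v \<in> U" if "\<bar>s\<bar> \<le> r" "\<bar>t\<bar> \<le> r" for s t
      using near[OF that] d3 by (auto simp: d_def dist_commute)
    have box': "x + s *\<^sub>R v + t *\<^sub>R u \<in> U" if "\<bar>s\<bar> \<le> r" "\<bar>t\<bar> \<le> r" for s t
      using box[OF that(2,1)] by (simp add: algebra_simps)
    obtain s t where st: "0 < s" "s < r" "0 < t" "t < r"
      "h (x + r *\<^sub>R u + r *\<^sub>R v) - h (x + r *\<^sub>R u) - h (x + r *\<^sub>R v) + h x = r * r * A (x + s *\<^sub>R u + t *\<^sub>R v)"
      using mixed_difference_mvt[OF h r box] unfolding A_def by metis
    obtain s' t' where st': "0 < s'" "s' < r" "0 < t'" "t' < r"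
      "h (x + r *\<^sub>R v + r *\<^sub>R u) - h (x + r *\<^sub>R v) - h (x + r *\<^sub>R u) + h x = r * r * B (x + s' *\<^sub>R v + t' *\<^sub>R u)"
      using mixed_difference_mvt[OF h r box'] unfolding B_def by metis
    have "r * r * A (x + s *\<^sub>R u + t *\<^sub>R v) = r * r * B (x + t' *\<^sub>R u + s' *\<^sub>R v)"
      using st(5) st'(5) by (simp add: algebra_simps)
    then have "A (x + s *\<^sub>R u + t *\<^sub>R v) = B (x + t' *\<^sub>R u + s' *\<^sub>R v)" using r by simp
    moreover have "dist (A (x + s *\<^sub>R u + t *\<^sub>R v)) (A x) < e / 2"
      using near[of s t] st by (intro d1) (simp add: d_def)
    moreover have "dist (B (x + t' *\<^sub>R u + s' *\<^sub>R v)) (B x) < e / 2"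
      using near[of t' s'] st' by (intro d2) (simp add: d_def)
    ultimately show ?thesis unfolding dist_real_def by linarith
  qed
  then have "\<bar>A x - B x\<bar> \<le> 0" by (rule field_le_epsilon) (simp add: dual_order.trans)
  then show ?thesis by (simp add: A_def B_def)
qed

section \<open>Smooth inverse functions\<close>

text \<open>The classical inverse function theorem wants the derivative as a continuous map into
  bounded linear maps, with a left inverse at \<open>a\<close>. In finite dimension continuity of
  the directional derivatives gives the former and injectivity gives the latter. Bijectivity is
  recorded at every \<open>g y\<close>, since the derivative of \<open>g\<close> is to be inverted
  there.\<close>

lemma C1_local_inverse:
  fixes f :: "'a::euclidean_space \<Rightarrow> 'a"
  assumes f: "smooth_on U f" and a: "a \<in> U" and inj: "\<And>v. frechet_derivative f (at a) v = 0 \<Longrightarrow> v = 0"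
  obtains V W g where "open V" "V \<subseteq> U" "a \<in> V" "open W" "homeomorphism V W f g"
    "\<And>y. y \<in> W \<Longrightarrow> g differentiable (at y)"
    "\<And>y. y \<in> W \<Longrightarrow> bij (frechet_derivative f (at (g y)))"
proof -
  define f' where "f' x = Blinfun (frechet_derivative f (at x))" for x
  have f': "blinfun_apply (f' x) = frechet_derivative f (at x)" if "x \<in> U" for x
    unfolding f'_def using smooth_on_has_derivative[OF f that]
    by (intro bounded_linear_Blinfun_apply) (rule has_derivative_bounded_linear)
  have lin: "linear (frechet_derivative f (at a))" by (rule smooth_on_linear_derivative[OF f a])
  then have "inj (frechet_derivative f (at a))" using inj linear_injective_0 by blast
  then obtain L where L: "linear L" "L \<circ> frechet_derivative f (at a) = id"
    using linear_injective_left_inverse[OF lin] by blast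
  have "Blinfun L o\<^sub>L f' a = id_blinfun"
    using L by (intro blinfun_eqI)
      (auto simp: f'[OF a] bounded_linear_Blinfun_apply linear_conv_bounded_linear[symmetric] fun_eq_iff)
  moreover have "continuous_on U f'"
  proof (rule continuous_on_blinfun_componentwise)
    fix i :: 'a
    show "continuous_on U (\<lambda>x. blinfun_apply (f' x) i)"
      using smooth_on_continuous_on[OF smooth_on_frechet_const[OF f, of i]]
      by (rule continuous_on_eq) (simp add: f')
  qed
  moreover have "(f has_derivative blinfun_apply (f' x)) (at x)" if "x \<in> U" for x
    using smooth_on_has_derivative[OF f that] by (simp add: f'[OF that])
  ultimately obtain V W g g' where *: "open V" "V \<subseteq> U" "a \<in> V" "open W" "homeomorphism V W f g"
    "\<And>y. y \<in> W \<Longrightarrow> (g has_derivative (g' y)) (at y)"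
    "\<And>y. y \<in> W \<Longrightarrow> bij (blinfun_apply (f' (g y)))"
    using inverse_function_theorem[OF smooth_onD(2)[OF f], of f f' a] a by metis
  have "bij (frechet_derivative f (at (g y)))" if "y \<in> W" for y
  proof -
    have "g y \<in> U" using that *(2,5) by (auto simp: homeomorphism_def)
    then show ?thesis using *(7)[OF that] f' by simp
  qed
  then show ?thesis using that *(1-6) unfolding differentiable_def by metis
qed

text \<open>Differentiability comes from the local inverse of \<open>(x, u) \<mapsto> (x, f'(x) u)\<close>.\<close>

lemma differentiable_inv_derivative:
  fixes f :: "'a::euclidean_space \<Rightarrow> 'a"
  assumes f: "smooth_on U f" and bij: "\<And>x. x \<in> U \<Longrightarrow> bij (frechet_derivative f (at x))" and x: "x \<in> U"
  shows "(\<lambda>x. inv (frechet_derivative f (at x)) v) differentiable (at x)"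
proof -
  define h where "h x = inv (frechet_derivative f (at x)) v" for x
  have h: "frechet_derivative f (at y) u = v \<longleftrightarrow> u = h y" if "y \<in> U" for y u
    unfolding h_def using bij[OF that] by (metis bij_inv_eq_iff)
  define F where "F = (\<lambda>z. (fst z, frechet_derivative f (at (fst z)) (snd z)))"
  have F: "smooth_on (U \<times> UNIV) F"
    unfolding F_def using smooth_onD(2)[OF f]
    by (intro smooth_on_Pair smooth_on_frechet[OF f] smooth_on_fst smooth_on_snd smooth_on_ident)
       (auto intro: open_Times)
  define a where "a = (x, h x)"
  have a: "a \<in> U \<times> UNIV" using x by (simp add: a_def)
  note dF = smooth_on_has_derivative[OF F a]
  note lin = smooth_on_linear_derivative[OF f x]
  \<comment> \<open>The derivative of \<open>F\<close> at \<open>a\<close> is block triangular: its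
    first component returns \<open>fst w\<close>, and on vectors \<open>(0, u)\<close> it acts as
    the derivative of \<open>f\<close> at \<open>x\<close>. Both blocks are injective.\<close>
  have inj: "w = 0" if w: "frechet_derivative F (at a) w = 0" for w
  proof -
    have "((\<lambda>z. fst (F z)) has_derivative (\<lambda>w. fst (frechet_derivative F (at a) w))) (at a)"
      using bounded_linear.has_derivative[OF bounded_linear_fst dF] .
    moreover have "((\<lambda>z. fst (F z)) has_derivative fst) (at a)"
      by (simp add: F_def bounded_linear_imp_has_derivative bounded_linear_fst)
    ultimately have "fst w = fst (frechet_derivative F (at a) w)"
      using has_derivative_unique by metis
    then have w1: "w = (0, snd w)" using w by (simp add: prod_eq_iff)
    have "((\<lambda>u. (x, u)) has_derivative (\<lambda>u. (0, u))) (at (h x))"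
      by (auto intro!: derivative_eq_intros)
    then have "((\<lambda>u. F (x, u)) has_derivative (\<lambda>u. frechet_derivative F (at a) (0, u))) (at (h x))"
      using has_derivative_compose dF unfolding a_def by blast
    moreover have "((\<lambda>u. F (x, u)) has_derivative (\<lambda>u. (0, frechet_derivative f (at x) u))) (at (h x))"
      using lin unfolding F_def
      by (auto intro!: derivative_eq_intros linear_imp_has_derivative)
    ultimately have "frechet_derivative F (at a) (0, snd w) = (0, frechet_derivative f (at x) (snd w))"
      using has_derivative_unique by (metis (no_types, lifting))
    then have "frechet_derivative f (at x) (snd w) = 0" using w w1 by (metis Pair_inject zero_prod_def)
    then have "snd w = 0" using bij[OF x] linear_0[OF lin] by (metis bij_inv_eq_iff)
    then show ?thesis using w1 by (simp add: zero_prod_def)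
  qed
  obtain V W G where VW: "open V" "V \<subseteq> U \<times> UNIV" "a \<in> V" "open W" "homeomorphism V W F G"
    "\<And>y. y \<in> W \<Longrightarrow> G differentiable (at y)"
    using C1_local_inverse[OF F a inj] by metis
  have Fa: "F a = (x, v)" using h[OF x] by (simp add: F_def a_def)
  then have xv: "(x, v) \<in> W" using VW(3,5) by (metis homeomorphism_def imageI)
  then obtain A B where AB: "open A" "open B" "x \<in> A" "v \<in> B" "A \<times> B \<subseteq> W"
    using VW(4) open_prod_elim by (metis mem_Sigma_iff)
  have eq: "snd (G (y, v)) = h y" if "y \<in> A" for y
  proof -
    have "(y, v) \<in> W" using AB that by auto
    then have "F (G (y, v)) = (y, v)" "G (y, v) \<in> V"
      using VW(5) by (auto simp: homeomorphism_def)
    then show ?thesis using VW(2) h[of y "snd (G (y, v))"] by (auto simp: F_def)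
  qed
  obtain G' where G': "(G has_derivative G') (at (x, v))"
    using VW(6)[OF xv] by (auto simp: differentiable_def)
  have "((\<lambda>y. (y, v)) has_derivative (\<lambda>y. (y, 0))) (at x)"
    by (auto intro!: derivative_eq_intros)
  from bounded_linear.has_derivative[OF bounded_linear_snd has_derivative_compose[OF this G']]
  have "(\<lambda>y. snd (G (y, v))) differentiable (at x)"
    by (rule differentiableI)
  then have "h differentiable (at x)"
    by (rule differentiable_cong_open[OF AB(1,3) eq, rotated])
  then show ?thesis by (simp add: h_def[abs_def])
qed

text \<open>Differentiating the identity \<open>f'(y) (h v y) = v\<close> in \<open>y\<close>
  expresses the derivative of \<open>h v\<close> through the second derivative of \<open>f\<close>
  and \<open>h\<close> itself, as \<open>- h (R v u x) x\<close>. Written out in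
  \<open>Basis\<close> this is \<open>E\<close>, so \<open>Ck_on k\<close> for all
  \<open>h v\<close> yields \<open>Ck_on (Suc k)\<close>.\<close>

lemma smooth_on_inv_derivative:
  fixes f :: "'a::euclidean_space \<Rightarrow> 'a"
  assumes f: "smooth_on U f" and bij: "\<And>x. x \<in> U \<Longrightarrow> bij (frechet_derivative f (at x))"
  shows "smooth_on U (\<lambda>x. inv (frechet_derivative f (at x)) v)"
proof -
  define h where "h v x = inv (frechet_derivative f (at x)) v" for v x
  have op: "open U" by (rule smooth_onD(2)[OF f])
  have h: "frechet_derivative f (at y) u = v \<longleftrightarrow> u = h v y" if "y \<in> U" for y u v
    unfolding h_def using bij[OF that] by (metis bij_inv_eq_iff)
  have dh: "(h v has_derivative frechet_derivative (h v) (at x)) (at x)" if "x \<in> U" for v x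
    using differentiable_inv_derivative[OF f bij that, of v] frechet_derivative_works
    unfolding h_def[abs_def] by blast
  define D2 where "D2 b u x = frechet_derivative (\<lambda>y. frechet_derivative f (at y) b) (at x) u" for b u x
  define R where "R v u x = (\<Sum>b\<in>Basis. (h v x \<bullet> b) *\<^sub>R D2 b u x)" for v u x
  define E where "E v x u = - (\<Sum>c\<in>Basis. (R v u x \<bullet> c) *\<^sub>R h c x)" for v x u
  have dh': "(h v has_derivative E v x) (at x)" if x: "x \<in> U" for v x
  proof -
    note lin = smooth_on_linear_derivative[OF f x]
    have hlin: "linear (\<lambda>v. h v x)"
      by (rule linearI) (metis h[OF x] linear_add[OF lin] linear_cmul[OF lin])+
    let ?dh = "frechet_derivative (h v) (at x)"
    have "((\<lambda>y. \<Sum>b\<in>Basis. (h v y \<bullet> b) *\<^sub>R frechet_derivative f (at y) b) has_derivative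
       (\<lambda>u. \<Sum>b\<in>Basis. (h v x \<bullet> b) *\<^sub>R D2 b u x + (?dh u \<bullet> b) *\<^sub>R frechet_derivative f (at x) b)) (at x)"
      unfolding D2_def
      by (intro has_derivative_sum has_derivative_scaleR has_derivative_inner_left dh x
          smooth_on_has_derivative[OF smooth_on_frechet_const[OF f]])
    moreover have "((\<lambda>y. \<Sum>b\<in>Basis. (h v y \<bullet> b) *\<^sub>R frechet_derivative f (at y) b) has_derivative (\<lambda>u. 0)) (at x)"
    proof (rule has_derivative_transform_within_open[OF has_derivative_const op x])
      fix y assume y: "y \<in> U"
      show "v = (\<Sum>b\<in>Basis. (h v y \<bullet> b) *\<^sub>R frechet_derivative f (at y) b)"
        using h[OF y] linear_eq_sum_Basis[OF smooth_on_linear_derivative[OF f y]] by metis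
    qed
    ultimately have z: "(\<Sum>b\<in>Basis. (h v x \<bullet> b) *\<^sub>R D2 b u x + (?dh u \<bullet> b) *\<^sub>R frechet_derivative f (at x) b) = 0" for u
      using has_derivative_unique by (metis (no_types, lifting))
    have "frechet_derivative f (at x) (?dh u) = - R v u x" for u
      using z[of u] linear_eq_sum_Basis[OF lin, of "?dh u"]
      by (simp add: sum.distrib R_def eq_neg_iff_add_eq_0 add.commute)
    then have "?dh u = h (- R v u x) x" for u using h[OF x] by blast
    also have "h (- R v u x) x = E v x u" for u
      using linear_neg[OF hlin] linear_eq_sum_Basis[OF hlin, of "R v u x"] by (simp add: E_def)
    finally have "?dh = E v x" by (rule ext)
    then show ?thesis using dh[OF x, of v] by metis
  qed
  have "Ck_on k U (h v)" for k v
  proof (induction k arbitrary: v)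
    case 0
    show ?case
      using dh' op by (auto simp: continuous_on_eq_continuous_at intro: has_derivative_continuous)
  next
    case (Suc k)
    have "Ck_on k U (D2 b u)" for b u
      using smooth_onD(1)[OF smooth_on_frechet_const[OF smooth_on_frechet_const[OF f]]]
      unfolding D2_def[abs_def] .
    then have "Ck_on k U (\<lambda>x. E v x u)" for u
      unfolding E_def R_def
      by (intro Ck_on_linear_compose[OF bounded_linear_minus[OF bounded_linear_ident]] op
          Ck_on_sum Ck_on_bilinear[OF bounded_bilinear_scaleR]
          Ck_on_linear_compose[OF bounded_linear_inner_left] Suc.IH)
    then show ?case by (intro Ck_on_SucI[OF op dh'])
  qed
  then show ?thesis by (simp add: smooth_on_def op h_def[abs_def])
qed

text \<open>A bootstrap: the derivative of the inverse \<open>g\<close> is the inverse of the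
  derivative of \<open>f\<close> at \<open>g y\<close>, which is \<open>Ck_on k\<close> as soon as
  \<open>g\<close> is.\<close>

theorem smooth_inverse_function:
  fixes f :: "'a::euclidean_space \<Rightarrow> 'a"
  assumes f: "smooth_on U f" and a: "a \<in> U" and inj: "\<And>v. frechet_derivative f (at a) v = 0 \<Longrightarrow> v = 0"
  obtains V W where "open V" "V \<subseteq> U" "a \<in> V" "open W" "diffeo_on V W f"
proof -
  obtain V W g where VW: "open V" "V \<subseteq> U" "a \<in> V" "open W" "homeomorphism V W f g"
    "\<And>y. y \<in> W \<Longrightarrow> g differentiable (at y)"
    "\<And>y. y \<in> W \<Longrightarrow> bij (frechet_derivative f (at (g y)))"
    using C1_local_inverse[OF f a inj] by metis
  have gf: "g (f x) = x" "f x \<in> W" if "x \<in> V" for x using VW(5) that by (auto simp: homeomorphism_def)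
  have fg: "f (g y) = y" "g y \<in> V" if "y \<in> W" for y using VW(5) that by (auto simp: homeomorphism_def)
  have fV: "smooth_on V f" using smooth_on_subset[OF f VW(1,2)] .
  have bij: "bij (frechet_derivative f (at x))" if "x \<in> V" for x
    using VW(7)[of "f x"] gf[OF that] by simp
  note h = smooth_on_inv_derivative[OF fV bij]
  have dg: "(g has_derivative (\<lambda>v. inv (frechet_derivative f (at (g y))) v)) (at y)" if y: "y \<in> W" for y
  proof -
    let ?g' = "frechet_derivative g (at y)" and ?f' = "frechet_derivative f (at (g y))"
    have g': "(g has_derivative ?g') (at y)" using VW(6)[OF y] frechet_derivative_works by blast
    have "((\<lambda>z. f (g z)) has_derivative (\<lambda>v. ?f' (?g' v))) (at y)"
      by (rule has_derivative_compose[OF g' smooth_on_has_derivative[OF fV fg(2)[OF y]]])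
    moreover have "((\<lambda>z. f (g z)) has_derivative (\<lambda>v. v)) (at y)"
      by (rule has_derivative_transform_within_open[OF has_derivative_ident VW(4) y]) (simp add: fg)
    ultimately have "?f' (?g' v) = v" for v using has_derivative_unique by (metis (no_types, lifting))
    then have "?g' v = inv ?f' v" for v using VW(7)[OF y] by (metis bij_inv_eq_iff)
    then have "?g' = (\<lambda>v. inv ?f' v)" by (rule ext)
    then show ?thesis using g' by metis
  qed
  have "Ck_on k W g" for k
  proof (induction k)
    case 0
    show ?case using VW(5) by (simp add: homeomorphism_def)
  next
    case (Suc k)
    have "Ck_on k W (\<lambda>y. inv (frechet_derivative f (at (g y))) v)" for v
      by (rule Ck_on_compose[OF VW(4,1) _ Suc smooth_onD(1)[OF h[of v]]]) (use fg in auto)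
    then show ?case by (intro Ck_on_SucI[OF VW(4) dg])
  qed
  then have "smooth_on W g" by (simp add: smooth_on_def VW(4))
  moreover have inj: "inj_on f V" by (metis gf(1) inj_onI)
  moreover have "f ` V = W" using VW(5) by (simp add: homeomorphism_def)
  moreover have "inv_into V f y = g y" if "y \<in> W" for y
    using fg[OF that] inj by (intro inv_into_f_eq)
  ultimately have "bij_betw f V W" "smooth_on W (inv_into V f)"
    using smooth_on_cong[of W g "inv_into V f"] by (auto simp: bij_betw_def)
  then show ?thesis using that VW(1-4) fV unfolding diffeo_on_def by metis
qed

lemma diffeo_onD:
  assumes "diffeo_on U V f"
  shows "smooth_on U f" "smooth_on V (inv_into U f)" "open U" "open V" "f ` U = V"
    "x \<in> U \<Longrightarrow> f x \<in> V" "x \<in> U \<Longrightarrow> inv_into U f (f x) = x"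
    "y \<in> V \<Longrightarrow> inv_into U f y \<in> U" "y \<in> V \<Longrightarrow> f (inv_into U f y) = y"
  using assms smooth_onD(2)
  by (auto simp: diffeo_on_def bij_betw_def inv_into_into intro!: inv_into_f_f f_inv_into_f)

lemma diffeo_on_inverse_derivative:
  assumes f: "diffeo_on U V f" and x: "x \<in> U"
  shows "frechet_derivative (inv_into U f) (at (f x)) (frechet_derivative f (at x) v) = v"
proof -
  note d = diffeo_onD[OF f]
  have "((\<lambda>z. inv_into U f (f z)) has_derivative
      (\<lambda>v. frechet_derivative (inv_into U f) (at (f x)) (frechet_derivative f (at x) v))) (at x)"
    by (rule has_derivative_compose[OF smooth_on_has_derivative[OF d(1) x]
          smooth_on_has_derivative[OF d(2) d(6)[OF x]]])
  moreover have "((\<lambda>z. inv_into U f (f z)) has_derivative (\<lambda>v. v)) (at x)"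
    by (rule has_derivative_transform_within_open[OF has_derivative_ident d(3) x]) (simp add: d(7))
  ultimately show ?thesis using has_derivative_unique by (metis (no_types, lifting))
qed

lemma diffeo_on_derivative_eq_0:
  assumes f: "diffeo_on U V f" and x: "x \<in> U" and v: "frechet_derivative f (at x) v = 0"
  shows "v = 0"
  using diffeo_on_inverse_derivative[OF f x, of v] v
    linear_0[OF smooth_on_linear_derivative[OF diffeo_onD(2)[OF f] diffeo_onD(6)[OF f x]]] by simp

section \<open>Prolongation and point equivalence\<close>

lemma smooth_on_jet_pt: "open U \<Longrightarrow> smooth_on U jet_pt"
proof -
  assume "open U"
  then have "smooth_on U (\<lambda>j. (fst j, fst (snd j)))" by (intro smooth_intros)
  then show ?thesis by (rule smooth_on_cong) (simp add: jet_pt_def split_beta)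
qed

definition run :: "(real \<times> real \<Rightarrow> real \<times> real) \<Rightarrow> jet \<Rightarrow> real" where
  "run f j = fst (frechet_derivative f (at (jet_pt j)) (1, snd (snd j)))"

definition rise :: "(real \<times> real \<Rightarrow> real \<times> real) \<Rightarrow> jet \<Rightarrow> real" where
  "rise f j = snd (frechet_derivative f (at (jet_pt j)) (1, snd (snd j)))"

definition slope :: "(real \<times> real \<Rightarrow> real \<times> real) \<Rightarrow> jet \<Rightarrow> real" where
  "slope f j = rise f j / run f j"

lemma prolongable_eq: "prolongable f j \<longleftrightarrow> run f j \<noteq> 0"
  by (cases j) (simp add: prolongable_def run_def jet_pt_def)

lemma prolong_eq: "prolong f j = (fst (f (jet_pt j)), snd (f (jet_pt j)), slope f j)"
  by (cases j) (simp add: prolong_def slope_def run_def rise_def jet_pt_def)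

lemma run_prolong_image: "frechet_derivative f (at (jet_pt j)) (1, snd (snd j)) = (run f j, rise f j)"
  by (simp add: run_def rise_def)

lemma jet_pt_prolong: "jet_pt (prolong f j) = f (jet_pt j)"
  by (simp add: prolong_eq jet_pt_def)

lemma snd_snd_prolong: "snd (snd (prolong f j)) = slope f j"
  by (simp add: prolong_eq)

text \<open>The open set of jets where the denominator of the slope does not vanish; smoothness of
  \<open>prolong f\<close> is asserted there.\<close>

definition jets_over :: "(real \<times> real) set \<Rightarrow> (real \<times> real \<Rightarrow> real \<times> real) \<Rightarrow> jet set" where
  "jets_over U f = {j. jet_pt j \<in> U \<and> prolongable f j}"

lemma
  assumes f: "smooth_on U f"
  shows smooth_on_run: "smooth_on {j. jet_pt j \<in> U} (run f)"
    and open_jets_over: "open (jets_over U f)"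
    and smooth_on_slope: "smooth_on (jets_over U f) (slope f)"
    and smooth_on_prolong: "smooth_on (jets_over U f) (prolong f)"
proof -
  let ?A = "{j. jet_pt j \<in> U}"
  have "open (jet_pt -` U)"
    using smooth_on_continuous_on[OF smooth_on_jet_pt[OF open_UNIV]] smooth_onD(2)[OF f]
    by (simp add: continuous_on_open_vimage)
  then have A: "open ?A" by (simp add: vimage_def)
  have *: "smooth_on ?A (\<lambda>j. frechet_derivative f (at (jet_pt j)) (1, snd (snd j)))"
    using A by (intro smooth_on_frechet[OF f] smooth_on_jet_pt smooth_intros) auto
  show run: "smooth_on ?A (run f)"
    unfolding run_def[abs_def] by (intro smooth_on_fst *)
  have rise: "smooth_on ?A (rise f)"
    unfolding rise_def[abs_def] by (intro smooth_on_snd *)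
  have eq: "jets_over U f = ?A \<inter> run f -` (- {0})"
    by (auto simp: jets_over_def prolongable_eq)
  show op: "open (jets_over U f)"
    unfolding eq by (intro continuous_open_preimage smooth_on_continuous_on[OF run] A) auto
  have sub: "jets_over U f \<subseteq> ?A" by (auto simp: jets_over_def)
  show slope: "smooth_on (jets_over U f) (slope f)"
    unfolding slope_def[abs_def]
    by (intro smooth_on_divide smooth_on_subset[OF run op sub] smooth_on_subset[OF rise op sub])
       (simp add: jets_over_def prolongable_eq)
  have "smooth_on (jets_over U f) (\<lambda>j. f (jet_pt j))"
    by (rule smooth_on_compose[OF smooth_on_jet_pt[OF op] f]) (auto simp: jets_over_def)
  then show "smooth_on (jets_over U f) (prolong f)"
    unfolding prolong_eq[abs_def] by (intro smooth_on_Pair smooth_on_fst smooth_on_snd slope)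
qed

text \<open>The derivative of the inverse map takes \<open>(run, rise)\<close> back to
  \<open>(1, p)\<close>. By linearity it takes \<open>(1, slope)\<close> to
  \<open>(1, p) / run\<close>, which is not vertical and has slope \<open>p\<close>.\<close>

lemma prolong_inverse:
  assumes f: "diffeo_on U V f" and j: "j \<in> jets_over U f"
  shows "prolong f j \<in> jets_over V (inv_into U f)" "prolong (inv_into U f) (prolong f j) = j"
proof -
  let ?g = "inv_into U f"
  have jU: "jet_pt j \<in> U" and r: "run f j \<noteq> 0" using j by (auto simp: jets_over_def prolongable_eq)
  have "frechet_derivative ?g (at (f (jet_pt j))) (1, slope f j)
      = (1 / run f j) *\<^sub>R frechet_derivative ?g (at (f (jet_pt j))) (run f j, rise f j)"
    using linear_cmul[OF smooth_on_linear_derivative[OF diffeo_onD(2)[OF f] diffeo_onD(6)[OF f jU]],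
        of "1 / run f j" "(run f j, rise f j)"] r by (simp add: slope_def)
  also have "\<dots> = (1 / run f j) *\<^sub>R (1, snd (snd j))"
    using diffeo_on_inverse_derivative[OF f jU, of "(1, snd (snd j))"] by (simp only: run_prolong_image)
  finally have *: "frechet_derivative ?g (at (f (jet_pt j))) (1, slope f j)
      = (1 / run f j, snd (snd j) / run f j)" by simp
  have "run ?g (prolong f j) = 1 / run f j" "rise ?g (prolong f j) = snd (snd j) / run f j"
    unfolding run_def[of ?g] rise_def[of ?g] jet_pt_prolong snd_snd_prolong by (simp_all add: *)
  then show "prolong f j \<in> jets_over V ?g" "prolong ?g (prolong f j) = j"
    using r diffeo_onD(6,7)[OF f jU]
    by (simp_all add: jets_over_def prolongable_eq jet_pt_prolong prolong_eq[of ?g] slope_def[of ?g])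
       (simp add: jet_pt_def split_beta)
qed

text \<open>\<open>prolong f\<close> has a differentiable left inverse, the prolongation of the
  inverse map. Applied to vectors \<open>(1, p, k)\<close>, injectivity recovers a second derivative
  \<open>k\<close> from the derivative of the image slope.\<close>

lemma prolong_derivative_inj:
  assumes f: "diffeo_on U V f" and j: "j \<in> jets_over U f"
    and eq: "frechet_derivative (prolong f) (at j) v = frechet_derivative (prolong f) (at j) w"
  shows "v = w"
proof -
  let ?g = "inv_into U f"
  note sf = smooth_on_prolong[OF diffeo_onD(1)[OF f]] and sg = smooth_on_prolong[OF diffeo_onD(2)[OF f]]
  have "((\<lambda>z. prolong ?g (prolong f z)) has_derivative
     (\<lambda>v. frechet_derivative (prolong ?g) (at (prolong f j)) (frechet_derivative (prolong f) (at j) v))) (at j)"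
    by (rule has_derivative_compose[OF smooth_on_has_derivative[OF sf j]
          smooth_on_has_derivative[OF sg prolong_inverse(1)[OF f j]]])
  moreover have "((\<lambda>z. prolong ?g (prolong f z)) has_derivative (\<lambda>v. v)) (at j)"
    by (rule has_derivative_transform_within_open[OF has_derivative_ident smooth_onD(2)[OF sf] j])
       (simp add: prolong_inverse(2)[OF f])
  ultimately have "frechet_derivative (prolong ?g) (at (prolong f j)) (frechet_derivative (prolong f) (at j) v) = v"
    for v using has_derivative_unique by (metis (no_types, lifting))
  then show ?thesis using eq by metis
qed

section \<open>Transport of graphs and their jets along a prolongation\<close>

lemma has_vector_derivative_graph:
  "(u has_real_derivative u') (at x) \<Longrightarrow> ((\<lambda>x. (x, u x)) has_vector_derivative (1, u')) (at x)"
  by (auto intro!: derivative_eq_intros simp: has_real_derivative_iff_has_vector_derivative)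

lemma image_graph_derivative:
  assumes f: "smooth_on U f" and j: "(x, u x) \<in> U" and u: "(u has_real_derivative u') (at x)"
  shows "((\<lambda>x. fst (f (x, u x))) has_real_derivative run f (x, u x, u')) (at x)"
    "((\<lambda>x. snd (f (x, u x))) has_real_derivative rise f (x, u x, u')) (at x)"
proof -
  have "((\<lambda>x. f (x, u x)) has_vector_derivative frechet_derivative f (at (x, u x)) (1, u')) (at x)"
    using smooth_on_curve_vector[OF f j has_vector_derivative_graph[OF u]] .
  then show "((\<lambda>x. fst (f (x, u x))) has_real_derivative run f (x, u x, u')) (at x)"
    "((\<lambda>x. snd (f (x, u x))) has_real_derivative rise f (x, u x, u')) (at x)"
    by (auto simp: run_def rise_def jet_pt_def has_real_derivative_iff_has_vector_derivative
        intro: bounded_linear.has_vector_derivative[OF bounded_linear_fst]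
          bounded_linear.has_vector_derivative[OF bounded_linear_snd])
qed

lemma real_differentiable_deriv:
  "u differentiable (at x) \<Longrightarrow> (u has_real_derivative deriv u x) (at x)" for u :: "real \<Rightarrow> real"
  by (simp add: DERIV_deriv_iff_real_differentiable)

text \<open>If the image of a graph is again a graph, its second coordinate can be differentiated in
  two ways: \<open>deriv v\<close> times \<open>run\<close> equals \<open>rise\<close>. As
  \<open>run\<close> is nonzero, the jets correspond under \<open>prolong f\<close>.\<close>

lemma prolong_image_graph:
  assumes f: "smooth_on U f" and I: "open I" "x \<in> I"
    and u: "\<And>x. x \<in> I \<Longrightarrow> u differentiable (at x)" "\<And>x. x \<in> I \<Longrightarrow> (x, u x, deriv u x) \<in> jets_over U f"
    and v: "\<And>r. r \<in> J \<Longrightarrow> v differentiable (at r)" and eq: "f ` graph_on I u = graph_on J v"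
  shows "fst (f (x, u x)) \<in> J"
    "prolong f (x, u x, deriv u x) = (fst (f (x, u x)), v (fst (f (x, u x))), deriv v (fst (f (x, u x))))"
proof -
  have J: "fst (f (x, u x)) \<in> J \<and> v (fst (f (x, u x))) = snd (f (x, u x))" if "x \<in> I" for x
  proof -
    have "f (x, u x) \<in> graph_on J v" using that eq by (auto simp: graph_on_def)
    then show ?thesis by (auto simp: graph_on_def)
  qed
  show J1: "fst (f (x, u x)) \<in> J" using J I(2) by blast
  have xU: "(x, u x) \<in> U" and r: "run f (x, u x, deriv u x) \<noteq> 0"
    using u(2)[OF I(2)] by (auto simp: jets_over_def jet_pt_def prolongable_eq)
  note d = image_graph_derivative[OF f xU real_differentiable_deriv[OF u(1)[OF I(2)]]]
  have "((\<lambda>x. v (fst (f (x, u x)))) has_real_derivative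
      deriv v (fst (f (x, u x))) * run f (x, u x, deriv u x)) (at x)"
    using DERIV_chain2[OF real_differentiable_deriv[OF v[OF J1]] d(1)] .
  then have "((\<lambda>x. snd (f (x, u x))) has_real_derivative
      deriv v (fst (f (x, u x))) * run f (x, u x, deriv u x)) (at x)"
    by (rule has_field_derivative_transform_within_open[OF _ I]) (use J in auto)
  from DERIV_unique[OF this d(2)] show
    "prolong f (x, u x, deriv u x) = (fst (f (x, u x)), v (fst (f (x, u x))), deriv v (fst (f (x, u x))))"
    using J[OF I(2)] r by (simp add: prolong_eq jet_pt_def slope_def field_simps)
qed

lemma inj_on_derivative_nonzero:
  fixes X :: "real \<Rightarrow> real"
  assumes "is_interval I" "\<And>x. x \<in> I \<Longrightarrow> (X has_real_derivative X' x) (at x)" "\<And>x. x \<in> I \<Longrightarrow> X' x \<noteq> 0"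
  shows "inj_on X I"
proof (rule linorder_inj_onI')
  fix x y assume xy: "x \<in> I" "y \<in> I" "x < y"
  then have sub: "z \<in> I" if "x \<le> z" "z \<le> y" for z
    using assms(1) xy(1,2) that unfolding is_interval_1 by blast
  have "(X has_real_derivative X' z) (at z)" if "x \<le> z" "z \<le> y" for z
    using assms(2) sub that by blast
  from MVT2[OF xy(3) this] obtain z where "x < z" "z < y" "X y - X x = (y - x) * X' z"
    by auto
  then show "X x \<noteq> X y" using assms(3)[of z] sub[of z] xy(3) by auto
qed

lemma has_vector_derivative_jet:
  assumes "(u has_real_derivative deriv u x) (at x)" "(deriv u has_real_derivative k) (at x)"
  shows "((\<lambda>x. (x, u x, deriv u x)) has_vector_derivative (1, deriv u x, k)) (at x)"
  using assms by (auto intro!: derivative_eq_intros simp: has_real_derivative_iff_has_vector_derivative)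

text \<open>The first two components of \<open>prolong f\<close> depend on \<open>(x, y)\<close>
  only, so the second derivative \<open>k\<close> enters through the slope alone. This is why a
  single scalar identity per jet can express the equivalence of two equations.\<close>

lemma smooth_prolong_derivative:
  assumes f: "smooth_on U f" and j: "(x, y, p) \<in> jets_over U f"
  shows "frechet_derivative (prolong f) (at (x, y, p)) (1, p, k) =
    (run f (x, y, p), rise f (x, y, p), frechet_derivative (slope f) (at (x, y, p)) (1, p, k))"
proof -
  have xU: "(x, y) \<in> U" using j by (simp add: jets_over_def jet_pt_def)
  have "(prolong f has_derivative (\<lambda>v. (fst (frechet_derivative f (at (x, y)) (fst v, fst (snd v))),
     snd (frechet_derivative f (at (x, y)) (fst v, fst (snd v))), frechet_derivative (slope f) (at (x, y, p)) v)))
     (at (x, y, p))"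
  proof -
    have "(jet_pt has_derivative (\<lambda>v. (fst v, fst (snd v)))) (at (x, y, p))"
      by (auto simp: jet_pt_def split_beta intro!: derivative_eq_intros)
    then have "((\<lambda>j. f (jet_pt j)) has_derivative (\<lambda>v. frechet_derivative f (at (x, y)) (fst v, fst (snd v))))
       (at (x, y, p))"
      by (rule has_derivative_compose) (use smooth_on_has_derivative[OF f xU] in \<open>simp add: jet_pt_def\<close>)
    then show ?thesis
      unfolding prolong_eq[abs_def]
      by (intro has_derivative_Pair bounded_linear.has_derivative[OF bounded_linear_fst]
          bounded_linear.has_derivative[OF bounded_linear_snd] smooth_on_has_derivative[OF smooth_on_slope[OF f] j])
  qed
  from frechet_derivative_at[OF this, symmetric] show ?thesis
    by (simp add: run_def rise_def jet_pt_def)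
qed

text \<open>The infinitesimal form of point equivalence: differentiate the slope along
  \<open>\<partial>\<^sub>x + p \<partial>\<^sub>y + \<Phi> \<partial>\<^sub>p\<close>.\<close>

definition intertwines :: "(real \<times> real \<Rightarrow> real \<times> real) \<Rightarrow> ode \<Rightarrow> ode \<Rightarrow> jet \<Rightarrow> bool" where
  "intertwines f \<Phi> \<Psi> j \<longleftrightarrow>
     frechet_derivative (slope f) (at j) (1, snd (snd j), \<Phi> j) = \<Psi> (prolong f j) * run f j"

text \<open>The image curve is reparametrised by its first coordinate \<open>X\<close>. Its
  derivative \<open>run\<close> has no zero, so \<open>X\<close> is injective on the interval and
  its image is an open interval. Then \<open>v'\<close> is the slope, \<open>v''\<close> is the
  derivative of the slope along the jets divided by \<open>run\<close>, and
  \<open>intertwines\<close> says that this is \<open>\<Psi>\<close>.\<close>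

lemma solves_image:
  assumes f: "diffeo_on U V f" and W: "W \<subseteq> jets_over U f"
    and rel: "\<And>j. j \<in> W \<Longrightarrow> intertwines f \<Phi> \<Psi> j"
    and u: "jets_in W I u" "solves \<Phi> I u"
  obtains J v where "solves \<Psi> J v" "f ` graph_on I u = graph_on J v"
proof -
  note sf = diffeo_onD(1)[OF f]
  define j where "j x = (x, u x, deriv u x)" for x
  have I: "open I" "is_interval I" using u(2) by (auto simp: solves_def)
  have du: "(u has_real_derivative deriv u x) (at x)" if "x \<in> I" for x
    using u(2) that by (auto simp: solves_def intro: real_differentiable_deriv)
  have jW: "j x \<in> W" and jO: "j x \<in> jets_over U f" if "x \<in> I" for x
    using u(1) W that by (auto simp: jets_in_def j_def)
  have xU: "(x, u x) \<in> U" and r: "run f (j x) \<noteq> 0" if "x \<in> I" for x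
    using jO[OF that] by (auto simp: jets_over_def jet_pt_def prolongable_eq j_def)
  define X where "X x = fst (f (x, u x))" for x
  define Y where "Y x = snd (f (x, u x))" for x
  have dX: "(X has_real_derivative run f (j x)) (at x)" and dY: "(Y has_real_derivative rise f (j x)) (at x)"
    if "x \<in> I" for x
    using image_graph_derivative[OF sf xU[OF that] du[OF that]] by (simp_all add: X_def[abs_def] Y_def[abs_def] j_def)
  have inj: "inj_on X I" by (rule inj_on_derivative_nonzero[OF I(2) dX r])
  have contX: "continuous_on I X"
    using dX by (meson DERIV_isCont continuous_at_imp_continuous_on)
  define J where "J = X ` I"
  have J: "open J" "is_interval J"
    using invariance_of_domain[OF contX I(1) inj] I(2) connected_continuous_image[OF contX]
    by (auto simp: J_def is_interval_connected_1)
  define \<xi> where "\<xi> = inv_into I X"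
  have \<xi>: "\<xi> (X x) = x" if "x \<in> I" for x using inj that by (simp add: \<xi>_def)
  have d\<xi>: "(\<xi> has_real_derivative 1 / run f (j x)) (at (X x))" if "x \<in> I" for x
    unfolding has_field_derivative_def
    by (rule has_derivative_inverse_strong[OF I(1) that contX \<xi> dX[OF that, unfolded has_field_derivative_def]])
       (use r[OF that] in \<open>auto simp: fun_eq_iff\<close>)
  define v where "v = (\<lambda>r. Y (\<xi> r))"
  have dv: "(v has_real_derivative slope f (j x)) (at (X x))" if "x \<in> I" for x
    using DERIV_chain2[OF _ d\<xi>[OF that], of Y "rise f (j x)"] dY[OF that]
    by (simp add: v_def \<xi>[OF that] slope_def)
  have "(deriv v has_real_derivative \<Psi> (X x, v (X x), deriv v (X x))) (at (X x))" if x: "x \<in> I" for x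
  proof -
    have "(deriv u has_real_derivative \<Phi> (j x)) (at x)"
      using u(2) x by (auto simp: solves_def j_def)
    from smooth_on_curve[OF smooth_on_slope[OF sf] _ has_vector_derivative_jet[OF du[OF x] this]] jO[OF x]
    have "((\<lambda>x. slope f (j x)) has_real_derivative
        frechet_derivative (slope f) (at (j x)) (1, deriv u x, \<Phi> (j x))) (at x)"
      by (simp add: j_def[abs_def])
    then have "((\<lambda>x. slope f (j x)) has_real_derivative \<Psi> (prolong f (j x)) * run f (j x)) (at x)"
      using rel[OF jW[OF x]] by (simp add: intertwines_def j_def)
    from DERIV_chain2[OF _ d\<xi>[OF x], of "\<lambda>x. slope f (j x)"
        "\<Psi> (prolong f (j x)) * run f (j x)"] this
    have "((\<lambda>r. slope f (j (\<xi> r))) has_real_derivative \<Psi> (prolong f (j x))) (at (X x))"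
      using r[OF x] by (simp add: \<xi>[OF x])
    then have "(deriv v has_real_derivative \<Psi> (prolong f (j x))) (at (X x))"
    proof (rule has_field_derivative_transform_within_open[OF _ J(1)])
      show "X x \<in> J" using x by (simp add: J_def)
      show "slope f (j (\<xi> r)) = deriv v r" if "r \<in> J" for r
        using that DERIV_imp_deriv[OF dv] \<xi> by (auto simp: J_def)
    qed
    moreover have "prolong f (j x) = (X x, v (X x), deriv v (X x))"
      using DERIV_imp_deriv[OF dv[OF x]] \<xi>[OF x]
      by (simp add: prolong_eq X_def v_def Y_def j_def jet_pt_def)
    ultimately show ?thesis by simp
  qed
  moreover have "v differentiable (at (X x))" if "x \<in> I" for x
    using dv[OF that] by (auto simp: real_differentiable_def)
  ultimately have "solves \<Psi> J v"
    using J by (auto simp: solves_def J_def)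
  moreover have "f ` graph_on I u = graph_on J v"
    using \<xi> by (auto simp: graph_on_def J_def v_def X_def Y_def image_iff)
  ultimately show ?thesis by (rule that)
qed

text \<open>\<open>jets_in\<close> grants \<open>u\<close> only one derivative, so a second one must
  be produced before it can be compared with \<open>\<Phi>\<close>. The jets of the solution
  \<open>v\<close> are differentiable, and the inverse prolongation carries them to those of
  \<open>u\<close>; hence \<open>deriv u\<close> has some derivative \<open>c\<close>.\<close>

lemma solves_preimage:
  assumes f: "diffeo_on U V f" and W: "W \<subseteq> jets_over U f"
    and rel: "\<And>j. j \<in> W \<Longrightarrow> intertwines f \<Phi> \<Psi> j"
    and u: "jets_in W I u" and v: "solves \<Psi> J v" and eq: "f ` graph_on I u = graph_on J v"
  shows "solves \<Phi> I u"
proof -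
  note sf = diffeo_onD(1)[OF f]
  let ?g = "inv_into U f"
  define j where "j x = (x, u x, deriv u x)" for x
  have I: "open I" "is_interval I" using u by (auto simp: jets_in_def)
  have diff: "u differentiable (at x)" if "x \<in> I" for x using u that by (auto simp: jets_in_def)
  note du = real_differentiable_deriv[OF diff]
  have jW: "j x \<in> W" and jO: "j x \<in> jets_over U f" if "x \<in> I" for x
    using u W that by (auto simp: jets_in_def j_def)
  have xU: "(x, u x) \<in> U" if "x \<in> I" for x
    using jO[OF that] by (auto simp: jets_over_def jet_pt_def j_def)
  define X where "X x = fst (f (x, u x))" for x
  define k where "k r = (r, v r, deriv v r)" for r
  have dv: "v differentiable (at r)" "(deriv v has_real_derivative \<Psi> (k r)) (at r)" if "r \<in> J" for r
    using v that by (auto simp: solves_def k_def)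
  have XJ: "X x \<in> J" and pr: "prolong f (j x) = k (X x)" if "x \<in> I" for x
    using prolong_image_graph[OF sf I(1) that diff _ dv(1) eq] jO by (auto simp: X_def k_def j_def)
  have dX: "(X has_real_derivative run f (j x)) (at x)" if "x \<in> I" for x
    using image_graph_derivative[OF sf xU[OF that] du[OF that]] by (simp add: X_def[abs_def] j_def)
  have "(deriv u has_real_derivative \<Phi> (j x)) (at x)" if x: "x \<in> I" for x
  proof -
    have kO: "k (X x) \<in> jets_over V ?g" using prolong_inverse(1)[OF f jO[OF x]] pr[OF x] by simp
    have "(k has_vector_derivative (1, deriv v (X x), \<Psi> (k (X x)))) (at (X x))"
      unfolding k_def[abs_def]
      using has_vector_derivative_jet[OF real_differentiable_deriv[OF dv(1)] dv(2)] XJ[OF x] by (simp add: k_def)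
    from smooth_on_curve[OF smooth_on_slope[OF diffeo_onD(2)[OF f]] kO this]
    have "(\<lambda>r. slope ?g (k r)) differentiable (at (X x))" by (auto simp: real_differentiable_def)
    then have "((\<lambda>r. slope ?g (k r)) has_real_derivative deriv (\<lambda>r. slope ?g (k r)) (X x)) (at (X x))"
      by (rule real_differentiable_deriv)
    from DERIV_chain2[OF this dX[OF x]]
    obtain c where "((\<lambda>x. slope ?g (k (X x))) has_real_derivative c) (at x)" by blast
    then have c: "(deriv u has_real_derivative c) (at x)"
    proof (rule has_field_derivative_transform_within_open[OF _ I(1) x])
      fix z assume z: "z \<in> I"
      have "prolong ?g (k (X z)) = j z" using prolong_inverse(2)[OF f jO[OF z]] pr[OF z] by simp
      then show "slope ?g (k (X z)) = deriv u z" by (simp add: prolong_eq j_def)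
    qed
    have "(X x, v (X x), deriv v (X x)) = prolong f (j x)" using pr[OF x] by (simp add: k_def)
    from smooth_on_curve[OF smooth_on_slope[OF sf] _ has_vector_derivative_jet[OF du[OF x] c]] jO[OF x]
    have 1: "((\<lambda>x. slope f (j x)) has_real_derivative
        frechet_derivative (slope f) (at (j x)) (1, deriv u x, c)) (at x)"
      by (simp add: j_def[abs_def])
    have "((\<lambda>x. deriv v (X x)) has_real_derivative \<Psi> (k (X x)) * run f (j x)) (at x)"
      using DERIV_chain2[OF dv(2)[OF XJ[OF x]] dX[OF x]] .
    then have "((\<lambda>x. slope f (j x)) has_real_derivative \<Psi> (k (X x)) * run f (j x)) (at x)"
      by (rule has_field_derivative_transform_within_open[OF _ I(1) x])
         (use pr in \<open>simp add: prolong_eq k_def\<close>)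
    from DERIV_unique[OF 1 this]
    have "frechet_derivative (slope f) (at (j x)) (1, deriv u x, c)
        = frechet_derivative (slope f) (at (j x)) (1, deriv u x, \<Phi> (j x))"
      using rel[OF jW[OF x]] pr[OF x] by (simp add: intertwines_def) (simp add: j_def)
    note eq' = this
    have "frechet_derivative (prolong f) (at (j x)) (1, deriv u x, e)
        = (run f (j x), rise f (j x), frechet_derivative (slope f) (at (j x)) (1, deriv u x, e))" for e
      using smooth_prolong_derivative[OF sf] jO[OF x] by (simp add: j_def)
    note sp = this
    \<comment> \<open>The image slope has the same derivative for \<open>c\<close> as for
      \<open>\<Phi> (j x)\<close>, and an injective derivative of the prolongation does not allow
      two different second derivatives.\<close>
    have "(1 :: real, deriv u x, c) = (1, deriv u x, \<Phi> (j x))"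
      by (rule prolong_derivative_inj[OF f jO[OF x]]) (simp only: sp eq')
    then show ?thesis using c by simp
  qed
  then show ?thesis using I diff by (auto simp: solves_def j_def)
qed

lemma solves_iff_image:
  assumes "diffeo_on U V f" "W \<subseteq> jets_over U f" "\<And>j. j \<in> W \<Longrightarrow> intertwines f \<Phi> \<Psi> j" "jets_in W I u"
  shows "solves \<Phi> I u \<longleftrightarrow> (\<exists>J v. solves \<Psi> J v \<and> f ` graph_on I u = graph_on J v)"
proof
  assume "solves \<Phi> I u"
  obtain J v where "solves \<Psi> J v" "f ` graph_on I u = graph_on J v"
    by (rule solves_image[OF assms(1,2) _ assms(4) \<open>solves \<Phi> I u\<close>]) (rule assms(3))
  then show "\<exists>J v. solves \<Psi> J v \<and> f ` graph_on I u = graph_on J v" by blast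
next
  assume "\<exists>J v. solves \<Psi> J v \<and> f ` graph_on I u = graph_on J v"
  then obtain J v where "solves \<Psi> J v" "f ` graph_on I u = graph_on J v" by blast
  then show "solves \<Phi> I u" by (intro solves_preimage[OF assms(1,2) _ assms(4)]) (rule assms(3))
qed

text \<open>Replaces a statement about all solutions by one identity at each jet; the equivalences
  constructed below are established through it.\<close>

theorem point_equivalentI:
  assumes f: "diffeo_on U V f" and W: "open W" "a \<in> W" "W \<subseteq> jets_over U f"
    and b: "prolong f a = b"
    and rel: "\<And>j. j \<in> W \<Longrightarrow> intertwines f \<Phi> \<Psi> j"
  shows "point_equivalent \<Phi> a \<Psi> b"
proof -
  have "solves \<Phi> I u \<longleftrightarrow> (\<exists>J v. solves \<Psi> J v \<and> f ` graph_on I u = graph_on J v)" if "jets_in W I u" for I u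
    by (rule solves_iff_image[OF f W(3) _ that]) (rule rel)
  moreover have "jet_pt ` W \<subseteq> U" "prolongable f a" using W by (auto simp: jets_over_def)
  ultimately show ?thesis
    unfolding point_equivalent_def using f W b by blast
qed

section \<open>Partial derivatives\<close>

text \<open>The direction comes first so that derivatives can be iterated. The meaning of a slot
  depends on the function: \<open>pd (1, 0, 0)\<close> is the derivative in \<open>x\<close> for
  \<open>s\<close> and \<open>\<sigma>\<close>, whose arguments are \<open>(x, t, z)\<close>, but
  the derivative in \<open>t\<close> for \<open>w\<close> and the slope \<open>p\<close>, whose
  arguments are \<open>(t, x, y)\<close>.\<close>

definition pd :: "'a::euclidean_space \<Rightarrow> ('a \<Rightarrow> 'b::euclidean_space) \<Rightarrow> 'a \<Rightarrow> 'b" where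
  "pd v f x = frechet_derivative f (at x) v"

lemma smooth_on_pd: "smooth_on U f \<Longrightarrow> smooth_on U (pd v f)"
  unfolding pd_def[abs_def] by (rule smooth_on_frechet_const)

lemma pd_commute:
  fixes f :: "'a::euclidean_space \<Rightarrow> real"
  shows "smooth_on U f \<Longrightarrow> x \<in> U \<Longrightarrow> pd u (pd v f) x = pd v (pd u f) x"
  using smooth_on_frechet_commute[of U f x v u] by (simp add: pd_def[abs_def])

lemma pd_cong:
  "open U \<Longrightarrow> x \<in> U \<Longrightarrow> (\<And>x. x \<in> U \<Longrightarrow> f x = g x) \<Longrightarrow> pd v f x = pd v g x"
  unfolding pd_def using frechet_derivative_cong_open by metis

lemma pd_eqI:
  assumes "smooth_on U f" "x \<in> U" "(\<gamma> has_vector_derivative v) (at r)" "\<gamma> r = x"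
    and "((\<lambda>r. f (\<gamma> r)) has_real_derivative d) (at r)"
  shows "pd v f x = d"
  using DERIV_unique[OF smooth_on_curve[of U f \<gamma> r v] assms(5)] assms(1-4) by (simp add: pd_def)

lemma pd_triple:
  fixes f :: "real \<times> real \<times> real \<Rightarrow> real"
  assumes "smooth_on U f" "j \<in> U"
  shows "pd (a, b, c) f j = a * pd (1, 0, 0) f j + b * pd (0, 1, 0) f j + c * pd (0, 0, 1) f j"
proof -
  note lin = smooth_on_linear_derivative[OF assms]
  have "(a, b, c) = a *\<^sub>R (1, 0, 0) + b *\<^sub>R (0, 1, 0) + c *\<^sub>R (0, 0, 1 :: real)" by simp
  then have "pd (a, b, c) f j = pd (a *\<^sub>R (1, 0, 0) + b *\<^sub>R (0, 1, 0) + c *\<^sub>R (0, 0, 1)) f j"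
    by (rule arg_cong)
  then show ?thesis unfolding pd_def by (simp only: linear_add[OF lin] linear_cmul[OF lin] real_scaleR_def)
qed

lemma smooth_on_triple_curve:
  fixes f :: "real \<times> real \<times> real \<Rightarrow> real"
  assumes f: "smooth_on U f" "(a r, b r, c r) \<in> U"
    and d: "(a has_real_derivative a') (at r)" "(b has_real_derivative b') (at r)" "(c has_real_derivative c') (at r)"
  shows "((\<lambda>r. f (a r, b r, c r)) has_real_derivative
      a' * pd (1, 0, 0) f (a r, b r, c r) + b' * pd (0, 1, 0) f (a r, b r, c r)
        + c' * pd (0, 0, 1) f (a r, b r, c r)) (at r)"
proof -
  have "((\<lambda>r. (a r, b r, c r)) has_vector_derivative (a', b', c')) (at r)"
    using d by (auto intro!: derivative_eq_intros simp: has_real_derivative_iff_has_vector_derivative)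
  from smooth_on_curve[of U f "\<lambda>r. (a r, b r, c r)" r, OF f this] show ?thesis
    using pd_triple[OF f, of a' b' c'] by (simp add: pd_def)
qed

lemma
  fixes f :: "real \<times> real \<times> real \<Rightarrow> real"
  assumes f: "smooth_on U f" "(r, s, t) \<in> U"
  shows pd_line1: "((\<lambda>r. f (r, s, t)) has_real_derivative pd (1, 0, 0) f (r, s, t)) (at r)"
    and pd_line2: "((\<lambda>s. f (r, s, t)) has_real_derivative pd (0, 1, 0) f (r, s, t)) (at s)"
    and pd_line3: "((\<lambda>t. f (r, s, t)) has_real_derivative pd (0, 0, 1) f (r, s, t)) (at t)"
proof -
  show "((\<lambda>r. f (r, s, t)) has_real_derivative pd (1, 0, 0) f (r, s, t)) (at r)"
    by (rule DERIV_cong[OF smooth_on_triple_curve[where a = "\<lambda>r. r" and b = "\<lambda>_. s" and c = "\<lambda>_. t"]])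
       (use f in \<open>auto intro!: derivative_eq_intros\<close>)
  show "((\<lambda>s. f (r, s, t)) has_real_derivative pd (0, 1, 0) f (r, s, t)) (at s)"
    by (rule DERIV_cong[OF smooth_on_triple_curve[where b = "\<lambda>r. r" and a = "\<lambda>_. r" and c = "\<lambda>_. t"]])
       (use f in \<open>auto intro!: derivative_eq_intros\<close>)
  show "((\<lambda>t. f (r, s, t)) has_real_derivative pd (0, 0, 1) f (r, s, t)) (at t)"
    by (rule DERIV_cong[OF smooth_on_triple_curve[where c = "\<lambda>r. r" and b = "\<lambda>_. s" and a = "\<lambda>_. r"]])
       (use f in \<open>auto intro!: derivative_eq_intros\<close>)
qed

lemma open_slice: "open A \<Longrightarrow> open {t. (t, m) \<in> A}"
  for A :: "('a::t2_space \<times> 'b::t2_space) set"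
  using continuous_open_vimage[of A "\<lambda>t. (t, m)"] by (simp add: vimage_def continuous_intros)

lemma
  assumes F: "smooth_on K F" "j \<in> K"
  shows dt_eq_pd: "dt F j = pd (1, 0, 0) F j"
    and dz_eq_pd: "dz F j = pd (0, 1, 0) F j"
    and dp_eq_pd: "dp F j = pd (0, 0, 1) F j"
proof -
  obtain t z p where j: "j = (t, z, p)" by (cases j)
  note K = F[unfolded j]
  show "dt F j = pd (1, 0, 0) F j" "dz F j = pd (0, 1, 0) F j" "dp F j = pd (0, 0, 1) F j"
    using DERIV_imp_deriv[OF pd_line1[OF K]] DERIV_imp_deriv[OF pd_line2[OF K]] DERIV_imp_deriv[OF pd_line3[OF K]]
    by (simp_all add: dt_def dz_def dp_def j)
qed

lemma smooth_on_dp: "smooth_on K F \<Longrightarrow> smooth_on K (dp F)"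
  by (rule smooth_on_cong[OF smooth_on_pd]) (auto simp: dp_eq_pd)

lemma X_field_eq_pd:
  assumes F: "smooth_on K h" "(t, z, p) \<in> K"
  shows "X_field F h (t, z, p) = pd (1, p, F (t, z, p)) h (t, z, p)"
  using F by (simp add: X_field_def pd_triple[OF F, of 1 p] dt_eq_pd dz_eq_pd dp_eq_pd)

section \<open>The curves dual to points\<close>

text \<open>The inverse function theorem applies to
  \<open>\<kappa> (x, t, z) = (t, x, \<sigma> (x, t, z))\<close>, since the first two coordinates
  are merely exchanged and \<open>\<sigma>\<close> has a nonzero derivative in \<open>z\<close>. The
  correspondence of \<open>B\<close> and \<open>A\<close> is stated in both directions because later
  arguments pass from points to solutions and back.\<close>

lemma implicit_family:
  fixes \<sigma> :: "real \<times> real \<times> real \<Rightarrow> real"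
  assumes s: "smooth_on N \<sigma>" "(x0, t0, z0) \<in> N" and nz: "pd (0, 0, 1) \<sigma> (x0, t0, z0) \<noteq> 0"
  obtains B A w where "open B" "B \<subseteq> N" "(x0, t0, z0) \<in> B" "smooth_on A w"
    "\<And>t x y. (t, x, y) \<in> A \<Longrightarrow> (x, t, w (t, x, y)) \<in> B \<and> \<sigma> (x, t, w (t, x, y)) = y"
    "\<And>t x z. (x, t, z) \<in> B \<Longrightarrow> (t, x, \<sigma> (x, t, z)) \<in> A \<and> w (t, x, \<sigma> (x, t, z)) = z"
proof -
  define \<kappa> where "\<kappa> = (\<lambda>n. (fst (snd n), fst n, \<sigma> n))"
  have sk: "smooth_on N \<kappa>"
    unfolding \<kappa>_def using smooth_onD(2)[OF s(1)] by (intro smooth_intros s(1))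
  have "v = 0" if "frechet_derivative \<kappa> (at (x0, t0, z0)) v = 0" for v
  proof -
    let ?n = "(x0, t0, z0)"
    have "(\<kappa> has_derivative (\<lambda>v. (fst (snd v), fst v, frechet_derivative \<sigma> (at ?n) v))) (at ?n)"
      unfolding \<kappa>_def
      by (intro has_derivative_Pair smooth_on_has_derivative[OF s]
          bounded_linear_imp_has_derivative bounded_linear_fst bounded_linear_compose[OF bounded_linear_fst bounded_linear_snd])
    from frechet_derivative_at[OF this, symmetric] that
    have "fst (snd v) = 0 \<and> fst v = 0 \<and> pd v \<sigma> ?n = 0" by (simp add: pd_def zero_prod_def)
    moreover have "v = (fst v, fst (snd v), snd (snd v))" by simp
    ultimately have "v = (0, 0, snd (snd v))" "pd v \<sigma> ?n = 0" by metis+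
    then have "pd (0, 0, snd (snd v)) \<sigma> ?n = 0" by metis
    then have "snd (snd v) = 0" using nz by (simp add: pd_triple[OF s, of 0 0 "snd (snd v)"])
    then show ?thesis using \<open>v = (0, 0, snd (snd v))\<close> by (metis zero_prod_def)
  qed
  from smooth_inverse_function[OF sk s(2) this] obtain B A
    where BA: "open B" "B \<subseteq> N" "(x0, t0, z0) \<in> B" "diffeo_on B A \<kappa>" by metis
  note d = diffeo_onD[OF BA(4)]
  define w where "w m = snd (snd (inv_into B \<kappa> m))" for m
  have "smooth_on A w" unfolding w_def[abs_def] by (intro smooth_intros d(2))
  moreover have "(x, t, w (t, x, y)) \<in> B \<and> \<sigma> (x, t, w (t, x, y)) = y" if m: "(t, x, y) \<in> A" for t x y
  proof -
    obtain n1 n2 n3 where n: "inv_into B \<kappa> (t, x, y) = (n1, n2, n3)" by (metis prod_cases3)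
    have "(n1, n2, n3) \<in> B" "\<kappa> (n1, n2, n3) = (t, x, y)" using d(8,9)[OF m] n by auto
    moreover have "w (t, x, y) = n3" by (simp add: w_def n)
    ultimately show ?thesis by (auto simp: \<kappa>_def)
  qed
  moreover have "(t, x, \<sigma> (x, t, z)) \<in> A \<and> w (t, x, \<sigma> (x, t, z)) = z" if n: "(x, t, z) \<in> B" for t x z
  proof -
    have \<kappa>: "\<kappa> (x, t, z) = (t, x, \<sigma> (x, t, z))" by (simp add: \<kappa>_def)
    then show ?thesis using d(6,7)[OF n] by (simp add: w_def)
  qed
  ultimately show ?thesis using that BA(1-3) by metis
qed

text \<open>Implicit differentiation of \<open>\<sigma> (x, t, w (t, x, y)) = y\<close> in
  \<open>y\<close>, \<open>x\<close> and \<open>t\<close>. The second equation is the incidence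
  relation between \<open>w_x\<close>, \<open>w_y\<close> and the slope of a solution; the third
  determines the slope of the curve of a point and later identifies the base slopes.\<close>

lemma implicit_family_derivatives:
  fixes \<sigma> w :: "real \<times> real \<times> real \<Rightarrow> real"
  assumes s: "smooth_on N \<sigma>" and w: "smooth_on A w"
    and eq: "\<And>t x y. (t, x, y) \<in> A \<Longrightarrow> (x, t, w (t, x, y)) \<in> N \<and> \<sigma> (x, t, w (t, x, y)) = y"
    and m: "(t, x, y) \<in> A"
  shows "pd (0, 0, 1) w (t, x, y) \<noteq> 0"
    and "pd (0, 1, 0) w (t, x, y) = - (pd (1, 0, 0) \<sigma> (x, t, w (t, x, y)) * pd (0, 0, 1) w (t, x, y))"
    and "pd (0, 1, 0) \<sigma> (x, t, w (t, x, y)) + pd (1, 0, 0) w (t, x, y) * pd (0, 0, 1) \<sigma> (x, t, w (t, x, y)) = 0"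
proof -
  let ?n = "(x, t, w (t, x, y))"
  have op: "open A" using smooth_onD(2)[OF w] .
  have n: "?n \<in> N" using eq[OF m] by simp
  have o1: "open {r. (r, x, y) \<in> A}" by (rule open_slice[OF op])
  have o2: "open {r. (t, r, y) \<in> A}"
    using continuous_open_vimage[OF op, of "\<lambda>r. (t, r, y)"] by (simp add: vimage_def continuous_intros)
  have o3: "open {r. (t, x, r) \<in> A}"
    using continuous_open_vimage[OF op, of "\<lambda>r. (t, x, r)"] by (simp add: vimage_def continuous_intros)
  have "((\<lambda>r. \<sigma> (x, t, w (t, x, r))) has_real_derivative
      0 * pd (1, 0, 0) \<sigma> ?n + 0 * pd (0, 1, 0) \<sigma> ?n + pd (0, 0, 1) w (t, x, y) * pd (0, 0, 1) \<sigma> ?n) (at y)"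
    by (rule smooth_on_triple_curve[OF s n DERIV_const DERIV_const pd_line3[OF w m]])
  moreover have "((\<lambda>r. \<sigma> (x, t, w (t, x, r))) has_real_derivative 1) (at y)"
    by (rule has_field_derivative_transform_within_open[OF DERIV_ident o3]) (use m eq in auto)
  ultimately have e3: "pd (0, 0, 1) w (t, x, y) * pd (0, 0, 1) \<sigma> ?n = 1"
    using DERIV_unique by fastforce
  have "((\<lambda>r. \<sigma> (r, t, w (t, r, y))) has_real_derivative
      1 * pd (1, 0, 0) \<sigma> ?n + 0 * pd (0, 1, 0) \<sigma> ?n + pd (0, 1, 0) w (t, x, y) * pd (0, 0, 1) \<sigma> ?n) (at x)"
    by (rule smooth_on_triple_curve[OF s n DERIV_ident DERIV_const pd_line2[OF w m]])
  moreover have "((\<lambda>r. \<sigma> (r, t, w (t, r, y))) has_real_derivative 0) (at x)"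
    by (rule has_field_derivative_transform_within_open[OF DERIV_const[of y] o2]) (use m eq in auto)
  ultimately have e2: "pd (1, 0, 0) \<sigma> ?n + pd (0, 1, 0) w (t, x, y) * pd (0, 0, 1) \<sigma> ?n = 0"
    using DERIV_unique by fastforce
  have "((\<lambda>r. \<sigma> (x, r, w (r, x, y))) has_real_derivative
      0 * pd (1, 0, 0) \<sigma> ?n + 1 * pd (0, 1, 0) \<sigma> ?n + pd (1, 0, 0) w (t, x, y) * pd (0, 0, 1) \<sigma> ?n) (at t)"
    by (rule smooth_on_triple_curve[OF s n DERIV_const DERIV_ident pd_line1[OF w m]])
  moreover have "((\<lambda>r. \<sigma> (x, r, w (r, x, y))) has_real_derivative 0) (at t)"
    by (rule has_field_derivative_transform_within_open[OF DERIV_const[of y] o1]) (use m eq in auto)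
  ultimately show "pd (0, 1, 0) \<sigma> ?n + pd (1, 0, 0) w (t, x, y) * pd (0, 0, 1) \<sigma> ?n = 0"
    using DERIV_unique by fastforce
  show "pd (0, 0, 1) w (t, x, y) \<noteq> 0" using e3 by auto
  have "pd (0, 1, 0) w (t, x, y) = pd (0, 1, 0) w (t, x, y) * (pd (0, 0, 1) w (t, x, y) * pd (0, 0, 1) \<sigma> ?n)"
    using e3 by simp
  also have "\<dots> = - (pd (1, 0, 0) \<sigma> ?n * pd (0, 0, 1) w (t, x, y))"
    using e2 by algebra
  finally show "pd (0, 1, 0) w (t, x, y) = - (pd (1, 0, 0) \<sigma> ?n * pd (0, 0, 1) w (t, x, y))" .
qed

section \<open>The invariant along a family of solutions\<close>

text \<open>The equation for \<open>w\<close> is differentiated in the parameter direction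
  \<open>(a, b)\<close> at fixed \<open>t\<close>; symmetry of second derivatives moves that
  derivative inside both derivatives in \<open>t\<close>.\<close>

lemma family_linearised:
  fixes w :: "real \<times> real \<times> real \<Rightarrow> real"
  assumes w: "smooth_on A w" and H: "smooth_on K H"
    and K: "\<And>t x y. (t, x, y) \<in> A \<Longrightarrow> (t, w (t, x, y), pd (1, 0, 0) w (t, x, y)) \<in> K"
    and ode: "\<And>t x y. (t, x, y) \<in> A \<Longrightarrow>
      pd (1, 0, 0) (pd (1, 0, 0) w) (t, x, y) = H (t, w (t, x, y), pd (1, 0, 0) w (t, x, y))"
    and m: "(t, x, y) \<in> A" and j: "j = (t, w (t, x, y), pd (1, 0, 0) w (t, x, y))"
  shows "pd (1, 0, 0) (pd (1, 0, 0) (pd (0, a, b) w)) (t, x, y)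
    = dz H j * pd (0, a, b) w (t, x, y) + dp H j * pd (1, 0, 0) (pd (0, a, b) w) (t, x, y)"
proof -
  let ?T = "(1, 0, 0) :: real \<times> real \<times> real" and ?v = "(0, a, b) :: real \<times> real \<times> real"
  let ?m = "(t, x, y)"
  have op: "open A" using smooth_onD(2)[OF w] .
  note wt = smooth_on_pd[OF w, of ?T] and wv = smooth_on_pd[OF w, of ?v]
  have jK: "j \<in> K" using K[OF m] j by simp
  have "pd ?T (pd ?T (pd ?v w)) ?m = pd ?T (pd ?v (pd ?T w)) ?m"
    by (rule pd_cong[OF op m]) (rule pd_commute[OF w])
  also have "\<dots> = pd ?v (pd ?T (pd ?T w)) ?m" by (rule pd_commute[OF wt m])
  also have "\<dots> = dz H j * pd ?v w ?m + dp H j * pd ?v (pd ?T w) ?m"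
  proof (rule pd_eqI[OF smooth_on_pd[OF wt] m])
    define \<gamma> where "\<gamma> r = (t, x + r * a, y + r * b)" for r
    have d\<gamma>: "(\<gamma> has_vector_derivative ?v) (at 0)"
      unfolding \<gamma>_def by (auto intro!: derivative_eq_intros simp: has_real_derivative_iff_has_vector_derivative[symmetric])
    show "((\<lambda>r. (t, x + r * a, y + r * b)) has_vector_derivative ?v) (at 0)"
      using d\<gamma> by (simp add: \<gamma>_def[abs_def])
    show "(t, x + 0 * a, y + 0 * b) = ?m" by simp
    have \<gamma>0: "\<gamma> 0 = ?m" by (simp add: \<gamma>_def)
    have "isCont \<gamma> 0" unfolding \<gamma>_def by (intro continuous_intros)
    then have ev: "\<forall>\<^sub>F r in nhds 0. \<gamma> r \<in> A"
      using op m \<gamma>0 unfolding continuous_at_open eventually_nhds by metis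
    have "((\<lambda>r. H (t, w (\<gamma> r), pd ?T w (\<gamma> r))) has_real_derivative
      0 * pd (1, 0, 0) H (t, w (\<gamma> 0), pd ?T w (\<gamma> 0)) + pd ?v w (\<gamma> 0) * pd (0, 1, 0) H (t, w (\<gamma> 0), pd ?T w (\<gamma> 0))
        + pd ?v (pd ?T w) (\<gamma> 0) * pd (0, 0, 1) H (t, w (\<gamma> 0), pd ?T w (\<gamma> 0))) (at 0)"
    proof (rule smooth_on_triple_curve[OF H _ DERIV_const])
      show "(t, w (\<gamma> 0), pd ?T w (\<gamma> 0)) \<in> K" using jK \<gamma>0 j by simp
      show "((\<lambda>r. w (\<gamma> r)) has_real_derivative pd ?v w (\<gamma> 0)) (at 0)"
        "((\<lambda>r. pd ?T w (\<gamma> r)) has_real_derivative pd ?v (pd ?T w) (\<gamma> 0)) (at 0)"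
        using smooth_on_curve[OF w _ d\<gamma>] smooth_on_curve[OF wt _ d\<gamma>] m \<gamma>0 by (simp_all add: pd_def[of ?v])
    qed
    then have "((\<lambda>r. H (t, w (\<gamma> r), pd ?T w (\<gamma> r))) has_real_derivative
        dz H j * pd ?v w ?m + dp H j * pd ?v (pd ?T w) ?m) (at 0)"
      by (simp add: \<gamma>0 j[symmetric] dz_eq_pd[OF H jK] dp_eq_pd[OF H jK] mult.commute)
    moreover have "\<forall>\<^sub>F r in nhds 0. H (t, w (\<gamma> r), pd ?T w (\<gamma> r)) = pd ?T (pd ?T w) (\<gamma> r)"
      using ev by eventually_elim (use ode in \<open>simp add: \<gamma>_def\<close>)
    ultimately have "((\<lambda>r. pd ?T (pd ?T w) (\<gamma> r)) has_real_derivative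
        dz H j * pd ?v w ?m + dp H j * pd ?v (pd ?T w) ?m) (at 0)"
      by (subst (asm) DERIV_cong_ev[OF refl _ refl])
    then show "((\<lambda>r. pd ?T (pd ?T w) (t, x + r * a, y + r * b)) has_real_derivative
        dz H j * pd ?v w ?m + dp H j * pd ?v (pd ?T w) ?m) (at 0)"
      by (simp add: \<gamma>_def[abs_def])
  qed
  also have "pd ?v (pd ?T w) ?m = pd ?T (pd ?v w) ?m" by (rule pd_commute[OF w m])
  finally show ?thesis .
qed

lemma family_ratio_derivative:
  fixes w p :: "real \<times> real \<times> real \<Rightarrow> real"
  assumes w: "smooth_on A w" and p: "smooth_on A p"
    and wx: "\<And>t x y. (t, x, y) \<in> A \<Longrightarrow> pd (0, 1, 0) w (t, x, y) = - (p (t, x, y) * pd (0, 0, 1) w (t, x, y))"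
    and m: "(t, x, y) \<in> A"
  shows "pd (1, 0, 0) (pd (0, 1, 0) w) (t, x, y) = - (pd (1, 0, 0) p (t, x, y) * pd (0, 0, 1) w (t, x, y)
      + p (t, x, y) * pd (1, 0, 0) (pd (0, 0, 1) w) (t, x, y))"
proof -
  have T: "open {t. (t, x, y) \<in> A}" by (rule open_slice[OF smooth_onD(2)[OF w]])
  have "((\<lambda>r. - (p (r, x, y) * pd (0, 0, 1) w (r, x, y))) has_real_derivative
      - (pd (1, 0, 0) p (t, x, y) * pd (0, 0, 1) w (t, x, y)
        + p (t, x, y) * pd (1, 0, 0) (pd (0, 0, 1) w) (t, x, y))) (at t)"
    by (rule DERIV_cong[OF DERIV_minus[OF DERIV_mult[OF pd_line1[OF p m] pd_line1[OF smooth_on_pd[OF w] m]]]])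
      (simp add: mult.commute)
  then have "((\<lambda>r. pd (0, 1, 0) w (r, x, y)) has_real_derivative
      - (pd (1, 0, 0) p (t, x, y) * pd (0, 0, 1) w (t, x, y)
        + p (t, x, y) * pd (1, 0, 0) (pd (0, 0, 1) w) (t, x, y))) (at t)"
    by (rule has_field_derivative_transform_within_open[OF _ T]) (use m wx in auto)
  then show ?thesis using DERIV_unique[OF pd_line1[OF smooth_on_pd[OF w] m]] by blast
qed

text \<open>Reduction of order. When \<open>w_x = - p w_y\<close> is inserted into the linearised
  equation, the terms with undifferentiated \<open>p\<close> cancel, because \<open>w_y\<close>
  solves the same equation. What remains ties \<open>w_yt / w_y\<close> to
  \<open>p_tt / p_t\<close>.\<close>

lemma family_linearised_ratio:
  fixes w p :: "real \<times> real \<times> real \<Rightarrow> real"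
  assumes w: "smooth_on A w" and H: "smooth_on K H"
    and K: "\<And>t x y. (t, x, y) \<in> A \<Longrightarrow> (t, w (t, x, y), pd (1, 0, 0) w (t, x, y)) \<in> K"
    and ode: "\<And>t x y. (t, x, y) \<in> A \<Longrightarrow>
      pd (1, 0, 0) (pd (1, 0, 0) w) (t, x, y) = H (t, w (t, x, y), pd (1, 0, 0) w (t, x, y))"
    and p: "smooth_on A p"
    and wx: "\<And>t x y. (t, x, y) \<in> A \<Longrightarrow> pd (0, 1, 0) w (t, x, y) = - (p (t, x, y) * pd (0, 0, 1) w (t, x, y))"
    and m: "(t, x, y) \<in> A" and j: "j = (t, w (t, x, y), pd (1, 0, 0) w (t, x, y))"
  shows "pd (1, 0, 0) (pd (1, 0, 0) p) (t, x, y) * pd (0, 0, 1) w (t, x, y)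
      + 2 * pd (1, 0, 0) p (t, x, y) * pd (1, 0, 0) (pd (0, 0, 1) w) (t, x, y)
      = dp H j * pd (1, 0, 0) p (t, x, y) * pd (0, 0, 1) w (t, x, y)"
proof -
  let ?T = "(1, 0, 0) :: real \<times> real \<times> real"
  let ?wx = "pd (0, 1, 0) w" and ?wy = "pd (0, 0, 1) w"
  note sx = smooth_on_pd[OF w, of "(0, 1, 0)"] and sy = smooth_on_pd[OF w, of "(0, 0, 1)"]
  have T: "open {t. (t, x, y) \<in> A}" by (rule open_slice[OF smooth_onD(2)[OF w]])
  have d1: "pd ?T ?wx (r, x, y) = - (pd ?T p (r, x, y) * ?wy (r, x, y) + p (r, x, y) * pd ?T ?wy (r, x, y))"
    if "(r, x, y) \<in> A" for r by (rule family_ratio_derivative[OF w p wx that])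
  note p1 = pd_line1[OF p m] and p2 = pd_line1[OF smooth_on_pd[OF p, of ?T] m]
    and y1 = pd_line1[OF sy m] and y2 = pd_line1[OF smooth_on_pd[OF sy, of ?T] m]
  have "((\<lambda>r. - (pd ?T p (r, x, y) * ?wy (r, x, y) + p (r, x, y) * pd ?T ?wy (r, x, y))) has_real_derivative
      - (pd ?T (pd ?T p) (t, x, y) * ?wy (t, x, y) + 2 * pd ?T p (t, x, y) * pd ?T ?wy (t, x, y)
         + p (t, x, y) * pd ?T (pd ?T ?wy) (t, x, y))) (at t)"
    by (rule DERIV_cong[OF DERIV_minus[OF DERIV_add[OF DERIV_mult[OF p2 y1] DERIV_mult[OF p1 y2]]]]) (simp add: algebra_simps)
  then have "((\<lambda>r. pd ?T ?wx (r, x, y)) has_real_derivative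
      - (pd ?T (pd ?T p) (t, x, y) * ?wy (t, x, y) + 2 * pd ?T p (t, x, y) * pd ?T ?wy (t, x, y)
         + p (t, x, y) * pd ?T (pd ?T ?wy) (t, x, y))) (at t)"
    by (rule has_field_derivative_transform_within_open[OF _ T]) (use m d1 in auto)
  from DERIV_unique[OF pd_line1[OF smooth_on_pd[OF sx, of ?T] m] this]
  have "pd ?T (pd ?T ?wx) (t, x, y) = - (pd ?T (pd ?T p) (t, x, y) * ?wy (t, x, y)
       + 2 * pd ?T p (t, x, y) * pd ?T ?wy (t, x, y) + p (t, x, y) * pd ?T (pd ?T ?wy) (t, x, y))" .
  moreover note family_linearised[OF w H K ode m j, of 1 0] family_linearised[OF w H K ode m j, of 0 1]
    wx[OF m] d1[OF m]
  ultimately show "pd ?T (pd ?T p) (t, x, y) * ?wy (t, x, y)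
      + 2 * pd ?T p (t, x, y) * pd ?T ?wy (t, x, y) = dp H j * pd ?T p (t, x, y) * ?wy (t, x, y)"
    by (simp add: algebra_simps)
qed

text \<open>With \<open>L = p_tt / p_t\<close> the reduced equation reads
  \<open>w_yt = h w_y\<close> for \<open>h = (H_p - L) / 2\<close>. Differentiating again and
  comparing with the linearised equation gives the Riccati identity
  \<open>h' + h^2 = H_z + H_p h\<close>; as \<open>h - H_p / 2 = - L / 2\<close>, completing the
  square leaves \<open>L' / 2 - L^2 / 4\<close>. The derivative \<open>l'\<close> is a parameter
  because the two directions of the theorem obtain it differently.\<close>

lemma K0_eq_Schwarzian:
  fixes w p :: "real \<times> real \<times> real \<Rightarrow> real"
  assumes w: "smooth_on A w" and H: "smooth_on K H"
    and K: "\<And>t x y. (t, x, y) \<in> A \<Longrightarrow> (t, w (t, x, y), pd (1, 0, 0) w (t, x, y)) \<in> K"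
    and ode: "\<And>t x y. (t, x, y) \<in> A \<Longrightarrow>
      pd (1, 0, 0) (pd (1, 0, 0) w) (t, x, y) = H (t, w (t, x, y), pd (1, 0, 0) w (t, x, y))"
    and p: "smooth_on A p"
    and wx: "\<And>t x y. (t, x, y) \<in> A \<Longrightarrow> pd (0, 1, 0) w (t, x, y) = - (p (t, x, y) * pd (0, 0, 1) w (t, x, y))"
    and wy: "\<And>t x y. (t, x, y) \<in> A \<Longrightarrow> pd (0, 0, 1) w (t, x, y) \<noteq> 0"
    and p1: "\<And>t x y. (t, x, y) \<in> A \<Longrightarrow> pd (1, 0, 0) p (t, x, y) \<noteq> 0"
    and m: "(t, x, y) \<in> A"
    and l: "((\<lambda>t. pd (1, 0, 0) (pd (1, 0, 0) p) (t, x, y) / pd (1, 0, 0) p (t, x, y)) has_real_derivative l') (at t)"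
      "l = pd (1, 0, 0) (pd (1, 0, 0) p) (t, x, y) / pd (1, 0, 0) p (t, x, y)"
  shows "K0 H (t, w (t, x, y), pd (1, 0, 0) w (t, x, y)) = l' / 2 - l\<^sup>2 / 4"
proof -
  let ?T = "(1, 0, 0) :: real \<times> real \<times> real" and ?wy = "pd (0, 0, 1) w"
  define j where "j r = (r, w (r, x, y), pd ?T w (r, x, y))" for r
  define L where "L r = pd ?T (pd ?T p) (r, x, y) / pd ?T p (r, x, y)" for r
  note sy = smooth_on_pd[OF w, of "(0, 0, 1)"]
  have T: "open {t. (t, x, y) \<in> A}" by (rule open_slice[OF smooth_onD(2)[OF w]])
  have jK: "j r \<in> K" if "(r, x, y) \<in> A" for r using K[OF that] by (simp add: j_def)
  have e: "pd ?T ?wy (r, x, y) = (dp H (j r) - L r) / 2 * ?wy (r, x, y)" if r: "(r, x, y) \<in> A" for r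
    using family_linearised_ratio[OF w H K ode p wx r refl] p1[OF r]
    by (simp add: L_def j_def field_simps)
  have dw: "((\<lambda>r. w (r, x, y)) has_real_derivative pd ?T w (t, x, y)) (at t)"
    by (rule pd_line1[OF w m])
  have dwt: "((\<lambda>r. pd ?T w (r, x, y)) has_real_derivative H (j t)) (at t)"
    using pd_line1[OF smooth_on_pd[OF w, of ?T] m] ode[OF m] by (simp add: j_def)
  have jtK: "(t, w (t, x, y), pd ?T w (t, x, y)) \<in> K" using jK[OF m] by (simp add: j_def)
  have "((\<lambda>r. dp H (j r)) has_real_derivative X_field H (dp H) (j t)) (at t)"
    unfolding j_def[abs_def]
    by (rule DERIV_cong[OF smooth_on_triple_curve[OF smooth_on_dp[OF H] jtK DERIV_ident dw dwt[unfolded j_def]]])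
       (use jtK in \<open>simp add: X_field_eq_pd[OF smooth_on_dp[OF H]] pd_triple[OF smooth_on_dp[OF H] jtK, of 1 "pd ?T w (t, x, y)"]\<close>)
  moreover have "(L has_real_derivative l') (at t)" using l(1) by (simp add: L_def[abs_def])
  ultimately have "((\<lambda>r. (dp H (j r) - L r) / 2 * ?wy (r, x, y)) has_real_derivative
      (X_field H (dp H) (j t) - l') / 2 * ?wy (t, x, y) + (dp H (j t) - L t) / 2 * pd ?T ?wy (t, x, y)) (at t)"
    using pd_line1[OF sy m] by (auto intro!: derivative_eq_intros)
  then have "((\<lambda>r. pd ?T ?wy (r, x, y)) has_real_derivative
      (X_field H (dp H) (j t) - l') / 2 * ?wy (t, x, y) + (dp H (j t) - L t) / 2 * pd ?T ?wy (t, x, y)) (at t)"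
    by (rule has_field_derivative_transform_within_open[OF _ T]) (use m e in auto)
  from DERIV_unique[OF pd_line1[OF smooth_on_pd[OF sy, of ?T] m] this]
  have "dz H (j t) * ?wy (t, x, y) + dp H (j t) * pd ?T ?wy (t, x, y) =
      (X_field H (dp H) (j t) - l') / 2 * ?wy (t, x, y) + (dp H (j t) - L t) / 2 * pd ?T ?wy (t, x, y)"
    using family_linearised[OF w H K ode m refl, of 0 1] by (simp add: j_def)
  moreover define h where "h = (dp H (j t) - L t) / 2"
  ultimately have "?wy (t, x, y) * (dz H (j t) + dp H (j t) * h) =
      ?wy (t, x, y) * ((X_field H (dp H) (j t) - l') / 2 + h * h)"
    unfolding e[OF m] h_def[symmetric] by (simp only: algebra_simps)
  then have "dz H (j t) + dp H (j t) * h = (X_field H (dp H) (j t) - l') / 2 + h * h"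
    using wy[OF m] by simp
  moreover have "L t = l" by (simp add: L_def l(2))
  ultimately have "K0 H (j t) = l' / 2 - l\<^sup>2 / 4"
    by (simp add: K0_def h_def power2_eq_square field_simps)
  then show ?thesis by (simp add: j_def)
qed

text \<open>\<open>u\<close> is \<open>p'' / (2 p')\<close>, so \<open>u' = u\<^sup>2\<close> says that the Schwarzian derivative of \<open>p\<close> vanishes.\<close>

lemma vanishing_Schwarzian:
  fixes p p1 u :: "real \<Rightarrow> real"
  assumes T: "is_interval T" "open T" "c \<in> T" "t \<in> T"
    and p: "\<And>t. t \<in> T \<Longrightarrow> (p has_real_derivative p1 t) (at t)" "\<And>t. t \<in> T \<Longrightarrow> p1 t \<noteq> 0"
    and p1: "\<And>t. t \<in> T \<Longrightarrow> (p1 has_real_derivative 2 * u t * p1 t) (at t)"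
    and u: "\<And>t. t \<in> T \<Longrightarrow> (u has_real_derivative (u t)\<^sup>2) (at t)"
  shows "(p t - p c) * (1 - (t - c) * u c) = (t - c) * p1 c"
proof -
  have const: "f t = f c" if "\<And>t. t \<in> T \<Longrightarrow> (f has_real_derivative 0) (at t)" "t \<in> T" for f :: "real \<Rightarrow> real" and t
  proof -
    have "\<exists>k. \<forall>x\<in>T. f x = k"
      using T(1,2) that(1)
      by (intro has_field_derivative_zero_constant) (auto simp: is_interval_convex_1 intro: has_field_derivative_at_within)
    then show ?thesis using T(3) that(2) by metis
  qed
  define k where "k t = 1 - (t - c) * u c" for t
  have dk: "(k has_real_derivative - u c) (at t)" for t
    unfolding k_def by (auto intro!: derivative_eq_intros)
  have uk: "u t * k t = u c" if t: "t \<in> T" for t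
  proof -
    \<comment> \<open>The Riccati equation is solved without dividing by \<open>u\<close> or
      \<open>k\<close>: the derivative of \<open>D = u k - u c\<close> is \<open>u D\<close> and
      that of \<open>p1\<close> is \<open>2 u p1\<close>, so \<open>D^2 / p1\<close> is constant. It
      vanishes at \<open>c\<close> because \<open>k c = 1\<close>.\<close>
    have "((\<lambda>t. (u t * k t - u c)\<^sup>2 / p1 t) has_real_derivative 0) (at t)" if "t \<in> T" for t
      by (rule derivative_eq_intros p1[OF that] u[OF that] dk refl p(2)[OF that])+
         (use p(2)[OF that] in \<open>simp add: field_simps power2_eq_square\<close>)
    from const[OF this t] show ?thesis using p(2)[OF t] p(2)[OF T(3)] by (simp add: k_def)
  qed
  have pk: "p1 t * (k t)\<^sup>2 = p1 c" if t: "t \<in> T" for t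
  proof -
    have "((\<lambda>t. p1 t * (k t)\<^sup>2) has_real_derivative 0) (at t)" if "t \<in> T" for t
      by (rule derivative_eq_intros p1[OF that] dk refl)+
         (use uk[OF that] in \<open>simp add: power2_eq_square algebra_simps flip: uk[OF that]\<close>)
    from const[OF this t] show ?thesis by (simp add: k_def)
  qed
  have k0: "k t \<noteq> 0" if "t \<in> T" for t using pk[OF that] p(2)[OF T(3)] by auto
  \<comment> \<open>This integrates \<open>p1 = p1 c / k^2\<close>: since
    \<open>k + (t - c) u c = 1\<close>, the quotient \<open>(t - c) / k\<close> has derivative
    \<open>1 / k^2\<close>.\<close>
  have "((\<lambda>t. p t - p1 c * (t - c) / k t) has_real_derivative 0) (at t)" if "t \<in> T" for t
  proof (rule derivative_eq_intros p(1)[OF that] dk refl k0[OF that])+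
    have "k t + (t - c) * u c = 1" by (simp add: k_def)
    then show "p1 t - ((0 * (t - c) + (1 - 0) * p1 c) * k t - p1 c * (t - c) * - u c) / (k t * k t) = 0"
      using pk[OF that] k0[OF that]
      by (simp add: field_simps power2_eq_square) (metis distrib_left mult.assoc mult.commute mult.right_neutral)
  qed
  from const[OF this T(4)] have "p t - p1 c * (t - c) / k t = p c" by simp
  then show ?thesis using k0[OF T(4)] by (simp add: field_simps k_def)
qed

text \<open>The slope at \<open>x\<close> of the solution met at parameter \<open>t\<close> by the
  curve of \<open>(x, y)\<close>; up to sign it is the ratio \<open>w_x / w_y\<close>.\<close>

definition curve_slope ::
  "(real \<times> real \<times> real \<Rightarrow> real) \<Rightarrow> (real \<times> real \<times> real \<Rightarrow> real) \<Rightarrow> real \<times> real \<times> real \<Rightarrow> real" where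
  "curve_slope \<sigma> w = (\<lambda>m. pd (1, 0, 0) \<sigma> (fst (snd m), fst m, w m))"

text \<open>\<open>x \<mapsto> \<sigma>(x, t, z)\<close> is the solution with coordinates \<open>(t, z)\<close> and \<open>t \<mapsto> w(t, x, y)\<close> the
  curve of the point \<open>(x, y)\<close>; both describe the incidence relation between points and solutions.\<close>

definition dual_family ::
  "ode \<Rightarrow> jet \<Rightarrow> (real \<times> real \<times> real \<Rightarrow> real) \<Rightarrow> (real \<times> real \<times> real) set \<Rightarrow>
    (real \<times> real \<times> real \<Rightarrow> real) \<Rightarrow> (real \<times> real \<times> real) set \<Rightarrow> ode \<Rightarrow> jet \<Rightarrow> bool" where
  "dual_family \<Phi> a \<sigma> N w A H b \<longleftrightarrow> (case a of (x0, y0, p0) \<Rightarrow> case b of (t0, z0, q0) \<Rightarrow>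
     smooth_on N \<sigma> \<and> smooth_on A w \<and> (x0, t0, z0) \<in> N \<and>
     \<sigma> (x0, t0, z0) = y0 \<and> pd (1, 0, 0) \<sigma> (x0, t0, z0) = p0 \<and>
     pd (1, 0, 0) w (t0, x0, y0) = q0 \<and> pd (1, 0, 0) (curve_slope \<sigma> w) (t0, x0, y0) \<noteq> 0 \<and>
     (\<forall>x t z. (x, t, z) \<in> N \<longrightarrow> (t, x, \<sigma> (x, t, z)) \<in> A \<and> w (t, x, \<sigma> (x, t, z)) = z \<and>
        pd (1, 0, 0) (pd (1, 0, 0) \<sigma>) (x, t, z) = \<Phi> (x, \<sigma> (x, t, z), pd (1, 0, 0) \<sigma> (x, t, z))) \<and>
     (\<forall>t x y. (t, x, y) \<in> A \<longrightarrow> (x, t, w (t, x, y)) \<in> N \<and> \<sigma> (x, t, w (t, x, y)) = y \<and>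
        pd (1, 0, 0) (pd (1, 0, 0) w) (t, x, y) = H (t, w (t, x, y), pd (1, 0, 0) w (t, x, y))))"

lemma smooth_on_curve_slope:
  assumes "smooth_on N \<sigma>" "smooth_on A w" "\<And>t x y. (t, x, y) \<in> A \<Longrightarrow> (x, t, w (t, x, y)) \<in> N"
  shows "smooth_on A (curve_slope \<sigma> w)"
proof -
  have "smooth_on A (\<lambda>m. (fst (snd m), fst m, w m))"
    using smooth_onD(2)[OF assms(2)] by (intro smooth_intros assms)
  then show ?thesis
    unfolding curve_slope_def by (rule smooth_on_compose[OF _ smooth_on_pd[OF assms(1)]]) (use assms(3) in auto)
qed

section \<open>The dual equation in the given coordinates of the solution space\<close>

locale dual_chart =
  fixes \<Phi> F :: ode and x0 y0 p0 t0 z0 q0 :: real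
    and s :: "real \<times> real \<times> real \<Rightarrow> real" and I :: "real set" and \<Omega> P :: "(real \<times> real) set" and W :: "jet set"
  assumes chart: "solution_chart \<Phi> (x0, y0, p0) s I \<Omega> (t0, z0)"
    and transverse: "deriv (\<lambda>z. s (x0, (t0, z))) z0 \<noteq> 0"
    and tangent: "deriv (\<lambda>t. s (x0, (t, z0))) t0 + q0 * deriv (\<lambda>z. s (x0, (t0, z))) z0 = 0"
    and P: "open P" "(x0, y0) \<in> P" "fst ` P \<subseteq> I"
    and W: "open W" "(t0, z0, q0) \<in> W" "jet_pt ` W \<subseteq> \<Omega>"
    and dual: "\<And>J w. jets_in W J w \<Longrightarrow> solves F J w \<longleftrightarrow> (\<exists>m\<in>P. graph_on J w \<subseteq> point_curve s \<Omega> m)"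
begin

lemma I: "open I" "is_interval I" "x0 \<in> I"
  and \<Omega>: "open \<Omega>" "(t0, z0) \<in> \<Omega>"
  and smooth_s: "smooth_on (I \<times> \<Omega>) s"
  and solves_s: "\<zeta> \<in> \<Omega> \<Longrightarrow> solves \<Phi> I (\<lambda>x. s (x, \<zeta>))"
  and s0: "s (x0, t0, z0) = y0" "deriv (\<lambda>x. s (x, t0, z0)) x0 = p0"
  using chart by (auto simp: solution_chart_def)

lemma s_line: "x \<in> I \<Longrightarrow> \<zeta> \<in> \<Omega> \<Longrightarrow> ((\<lambda>x. s (x, \<zeta>)) has_real_derivative pd (1, 0, 0) s (x, \<zeta>)) (at x)"
  using pd_line1[OF smooth_s, of x "fst \<zeta>" "snd \<zeta>"] by simp

lemma s_line2: "x \<in> I \<Longrightarrow> \<zeta> \<in> \<Omega> \<Longrightarrow>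
    ((\<lambda>x. pd (1, 0, 0) s (x, \<zeta>)) has_real_derivative pd (1, 0, 0) (pd (1, 0, 0) s) (x, \<zeta>)) (at x)"
  using pd_line1[OF smooth_on_pd[OF smooth_s], of x "fst \<zeta>" "snd \<zeta>"] by simp

lemma deriv_s: "x \<in> I \<Longrightarrow> \<zeta> \<in> \<Omega> \<Longrightarrow> deriv (\<lambda>x. s (x, \<zeta>)) x = pd (1, 0, 0) s (x, \<zeta>)"
  by (rule DERIV_imp_deriv[OF s_line])

lemma s_ode:
  assumes "x \<in> I" "\<zeta> \<in> \<Omega>"
  shows "pd (1, 0, 0) (pd (1, 0, 0) s) (x, \<zeta>) = \<Phi> (x, s (x, \<zeta>), pd (1, 0, 0) s (x, \<zeta>))"
proof -
  have "(deriv (\<lambda>x. s (x, \<zeta>)) has_real_derivative \<Phi> (x, s (x, \<zeta>), deriv (\<lambda>x. s (x, \<zeta>)) x)) (at x)"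
    using solves_s[OF assms(2)] assms(1) by (simp add: solves_def)
  then have "((\<lambda>x. pd (1, 0, 0) s (x, \<zeta>)) has_real_derivative
      \<Phi> (x, s (x, \<zeta>), pd (1, 0, 0) s (x, \<zeta>))) (at x)"
    unfolding deriv_s[OF assms]
    by (rule has_field_derivative_transform_within_open[OF _ I(1) assms(1)]) (simp add: deriv_s assms(2))
  then show ?thesis using DERIV_unique[OF s_line2[OF assms]] by simp
qed

lemma pd_s0: "pd (0, 0, 1) s (x0, t0, z0) \<noteq> 0" "pd (0, 1, 0) s (x0, t0, z0) + q0 * pd (0, 0, 1) s (x0, t0, z0) = 0"
proof -
  have "(x0, t0, z0) \<in> I \<times> \<Omega>" using I \<Omega> by simp
  note d = DERIV_imp_deriv[OF pd_line2[OF smooth_s this]] DERIV_imp_deriv[OF pd_line3[OF smooth_s this]]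
  show "pd (0, 0, 1) s (x0, t0, z0) \<noteq> 0" "pd (0, 1, 0) s (x0, t0, z0) + q0 * pd (0, 0, 1) s (x0, t0, z0) = 0"
    using transverse tangent unfolding d by auto
qed

text \<open>On \<open>\<Omega>\<close> this is the diffeomorphism demanded by
  \<open>solution_chart\<close>, with \<open>pd\<close> in place of \<open>deriv\<close> so that its
  smoothness is at hand.\<close>

definition initial :: "real \<times> real \<Rightarrow> real \<times> real" where
  "initial \<zeta> = (s (x0, \<zeta>), pd (1, 0, 0) s (x0, \<zeta>))"

lemma smooth_initial: "smooth_on \<Omega> initial"
proof -
  have sub: "smooth_on \<Omega> (\<lambda>\<zeta>. (x0, \<zeta>))" "(\<lambda>\<zeta>. (x0, \<zeta>)) ` \<Omega> \<subseteq> I \<times> \<Omega>"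
    using \<Omega> I by (auto intro: smooth_intros)
  show ?thesis
    unfolding initial_def[abs_def]
    by (rule smooth_on_Pair[OF smooth_on_compose[OF sub(1) smooth_s sub(2)]
          smooth_on_compose[OF sub(1) smooth_on_pd[OF smooth_s] sub(2)]])
qed

lemma initial_derivative_eq_0:
  assumes "frechet_derivative initial (at (t0, z0)) v = 0"
  shows "v = 0"
proof -
  obtain V where V: "diffeo_on \<Omega> V (\<lambda>\<zeta>. (s (x0, \<zeta>), deriv (\<lambda>x. s (x, \<zeta>)) x0))"
    using chart by (auto simp: solution_chart_def)
  have "frechet_derivative initial (at (t0, z0))
      = frechet_derivative (\<lambda>\<zeta>. (s (x0, \<zeta>), deriv (\<lambda>x. s (x, \<zeta>)) x0)) (at (t0, z0))"
    by (rule frechet_derivative_cong_open[OF \<Omega>]) (simp add: initial_def deriv_s I)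
  then show ?thesis using diffeo_on_derivative_eq_0[OF V \<Omega>(2)] assms by simp
qed

text \<open>The duality clause speaks only of graphs with jets in \<open>W\<close> and of points in
  \<open>P\<close>. One interval \<open>T\<close> and a neighbourhood \<open>M\<close> of the base
  point are chosen so that the curves of all points of \<open>M\<close> stay in this range over
  \<open>T\<close>, and also in the prescribed \<open>W1\<close>.\<close>

lemma dual_curves:
  assumes "open W1" "(t0, z0, q0) \<in> W1"
  obtains B w T M where "open B" "(x0, t0, z0) \<in> B" "B \<subseteq> I \<times> \<Omega>"
    "\<And>x t z. (x, t, z) \<in> B \<Longrightarrow> w (t, x, s (x, t, z)) = z"
    "open T" "t0 \<in> T" "open M" "(x0, y0) \<in> M"
    "\<And>m. m \<in> M \<Longrightarrow> jets_in W1 T (\<lambda>t. w (t, m)) \<and> solves F T (\<lambda>t. w (t, m))"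
proof -
  have n0: "(x0, t0, z0) \<in> I \<times> \<Omega>" using I \<Omega> by simp
  obtain B A w where BA: "open B" "B \<subseteq> I \<times> \<Omega>" "(x0, t0, z0) \<in> B" "smooth_on A w"
    and A: "\<And>t x y. (t, x, y) \<in> A \<Longrightarrow> (x, t, w (t, x, y)) \<in> B \<and> s (x, t, w (t, x, y)) = y"
    and B: "\<And>t x z. (x, t, z) \<in> B \<Longrightarrow> (t, x, s (x, t, z)) \<in> A \<and> w (t, x, s (x, t, z)) = z"
    using implicit_family[OF smooth_s n0 pd_s0(1)] by metis
  have m0: "(t0, x0, y0) \<in> A" "w (t0, x0, y0) = z0" using B[OF BA(3)] s0 by simp_all
  have A': "(x, t, w (t, x, y)) \<in> I \<times> \<Omega> \<and> s (x, t, w (t, x, y)) = y" if "(t, x, y) \<in> A" for t x y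
    using A[OF that] BA(2) by auto
  \<comment> \<open>The tangency condition on \<open>q0\<close> and implicit differentiation in
    \<open>t\<close> determine the same slope, so the curve of the base point passes through the
    base jet of the dual equation.\<close>
  have "pd (0, 1, 0) s (x0, t0, z0) + pd (1, 0, 0) w (t0, x0, y0) * pd (0, 0, 1) s (x0, t0, z0) = 0"
    using implicit_family_derivatives(3)[OF smooth_s BA(4) A' m0(1)] m0(2) by simp
  with pd_s0(2) have "(pd (1, 0, 0) w (t0, x0, y0) - q0) * pd (0, 0, 1) s (x0, t0, z0) = 0"
    by algebra
  then have q0: "pd (1, 0, 0) w (t0, x0, y0) = q0" using pd_s0(1) by simp
  define E where "E m = ((fst m, w m, pd (1, 0, 0) w m), snd m)" for m
  have sE: "smooth_on A E"
    unfolding E_def[abs_def] using smooth_onD(2)[OF BA(4)] by (intro smooth_intros smooth_on_pd BA(4))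
  have "open (A \<inter> E -` ((W \<inter> W1) \<times> P))"
    using W(1) P(1) assms(1)
    by (intro continuous_open_preimage smooth_on_continuous_on[OF sE] smooth_onD(2)[OF sE] open_Times open_Int)
  moreover have "(t0, x0, y0) \<in> A \<inter> E -` ((W \<inter> W1) \<times> P)"
    using m0 q0 W(2) P(2) assms(2) by (simp add: E_def)
  ultimately obtain T' M where TM: "open T'" "open M" "t0 \<in> T'" "(x0, y0) \<in> M"
    "T' \<times> M \<subseteq> A \<inter> E -` ((W \<inter> W1) \<times> P)"
    using open_prod_elim[of "A \<inter> E -` ((W \<inter> W1) \<times> P)" "(t0, x0, y0)"] by (metis mem_Sigma_iff)
  obtain e where e: "e > 0" "ball t0 e \<subseteq> T'" using TM(1,3) open_contains_ball by blast
  define T where "T = ball t0 e"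
  have T: "open T" "is_interval T" "t0 \<in> T" using e by (auto simp: T_def is_interval_ball_real)
  have TA: "(t, m) \<in> A" "E (t, m) \<in> (W \<inter> W1) \<times> P" if "t \<in> T" "m \<in> M" for t m
  proof -
    have "(t, m) \<in> T' \<times> M" using that e(2) by (auto simp: T_def)
    then show "(t, m) \<in> A" "E (t, m) \<in> (W \<inter> W1) \<times> P" using TM(5) by auto
  qed
  have d: "((\<lambda>t. w (t, m)) has_real_derivative pd (1, 0, 0) w (t, m)) (at t)" if "t \<in> T" "m \<in> M" for t m
    using pd_line1[OF BA(4), of t "fst m" "snd m"] TA(1)[OF that] by simp
  have "jets_in W1 T (\<lambda>t. w (t, m)) \<and> solves F T (\<lambda>t. w (t, m))" if m: "m \<in> M" for m
  proof -
    have j: "(t, w (t, m), deriv (\<lambda>t. w (t, m)) t) \<in> W \<inter> W1" if "t \<in> T" for t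
      using TA(2)[OF that m] DERIV_imp_deriv[OF d[OF that m]] by (simp add: E_def)
    then have jets: "jets_in (W \<inter> W1) T (\<lambda>t. w (t, m))"
      using T d[OF _ m] by (auto simp: jets_in_def real_differentiable_def)
    have "graph_on T (\<lambda>t. w (t, m)) \<subseteq> point_curve s \<Omega> m"
    proof -
      have "(t, w (t, m)) \<in> \<Omega> \<and> s (fst m, t, w (t, m)) = snd m" if "t \<in> T" for t
        using A'[of t "fst m" "snd m"] TA(1)[OF that m] by simp
      then show ?thesis by (auto simp: graph_on_def point_curve_def split_beta)
    qed
    moreover have "m \<in> P" using TA(2)[OF T(3) m] by (simp add: E_def)
    ultimately have "solves F T (\<lambda>t. w (t, m))"
      using dual[of T "\<lambda>t. w (t, m)"] jets by (auto simp: jets_in_def)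
    then show ?thesis using jets by (auto simp: jets_in_def)
  qed
  then show ?thesis using that BA(1-3) B T(1,3) TM(2,4) by metis
qed

end

section \<open>Change of coordinates on the solution space\<close>

locale dual_equivalent = dual_chart +
  fixes H :: ode and t1 z1 q1 :: real and f :: "real \<times> real \<Rightarrow> real \<times> real" and U V :: "(real \<times> real) set"
    and W1 :: "jet set"
  assumes f: "diffeo_on U V f" and W1: "open W1" "(t0, z0, q0) \<in> W1" "jet_pt ` W1 \<subseteq> U"
    and prolongable: "prolongable f (t0, z0, q0)" and prolong: "prolong f (t0, z0, q0) = (t1, z1, q1)"
    and equiv: "\<And>J u. jets_in W1 J u \<Longrightarrow> solves F J u \<longleftrightarrow> (\<exists>J' v. solves H J' v \<and> f ` graph_on J u = graph_on J' v)"
begin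

abbreviation g :: "real \<times> real \<Rightarrow> real \<times> real" where "g \<equiv> inv_into U f"

abbreviation r1 :: real where "r1 \<equiv> run f (t0, z0, q0)"

text \<open>The equivalence \<open>f\<close> from \<open>F\<close> to \<open>H\<close> is read as a
  change of coordinates on the solution space. This is the same family of solutions in the new
  coordinates, in which the curves of points will solve \<open>H\<close>.\<close>

definition \<sigma> :: "real \<times> real \<times> real \<Rightarrow> real" where "\<sigma> n = s (fst n, g (snd n))"

lemma fU: "(t0, z0) \<in> U" "f (t0, z0) = (t1, z1)" "(t1, z1) \<in> V" "g (t1, z1) = (t0, z0)"
proof -
  show U: "(t0, z0) \<in> U" using W1(2,3) by (force simp: jet_pt_def)
  show fc: "f (t0, z0) = (t1, z1)" using prolong by (simp add: prolong_eq jet_pt_def prod_eq_iff)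
  show "(t1, z1) \<in> V" "g (t1, z1) = (t0, z0)" using diffeo_onD(6,7)[OF f U] fc by simp_all
qed

lemma r1: "r1 \<noteq> 0" "frechet_derivative f (at (t0, z0)) (1, q0) = (r1, r1 * q1)"
proof -
  show r1: "r1 \<noteq> 0" using prolongable by (simp add: prolongable_eq)
  have "slope f (t0, z0, q0) = q1" using prolong by (simp add: prolong_eq)
  then show "frechet_derivative f (at (t0, z0)) (1, q0) = (r1, r1 * q1)"
    using run_prolong_image[of f "(t0, z0, q0)"] r1 by (simp add: slope_def jet_pt_def field_simps)
qed

lemma derivative_g: "frechet_derivative g (at (t1, z1)) (frechet_derivative f (at (t0, z0)) v) = v"
  using diffeo_on_inverse_derivative[OF f fU(1), of v] fU(2) by simp

lemma derivative_g_direction: "frechet_derivative g (at (t1, z1)) (1, q1) = (1 / r1, q0 / r1)"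
proof -
  have "(1, q1) = (1 / r1) *\<^sub>R frechet_derivative f (at (t0, z0)) (1, q0)"
    using r1 by simp
  then have "frechet_derivative g (at (t1, z1)) (1, q1) = (1 / r1) *\<^sub>R (1, q0)"
    using linear_cmul[OF smooth_on_linear_derivative[OF diffeo_onD(2)[OF f] fU(3)]] derivative_g by metis
  then show ?thesis by simp
qed

lemma
  assumes B: "open B" "B \<subseteq> I \<times> \<Omega>"
  defines "N \<equiv> {n \<in> UNIV \<times> V. (fst n, g (snd n)) \<in> B}"
  shows smooth_on_\<sigma>: "smooth_on N \<sigma>" and smooth_on_g: "smooth_on N (\<lambda>n. g (snd n))"
    and \<sigma>_line: "n \<in> N \<Longrightarrow> pd (1, 0, 0) \<sigma> n = pd (1, 0, 0) s (fst n, g (snd n))"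
    and \<sigma>_ode: "n \<in> N \<Longrightarrow> pd (1, 0, 0) (pd (1, 0, 0) \<sigma>) n = \<Phi> (fst n, \<sigma> n, pd (1, 0, 0) \<sigma> n)"
proof -
  define G where "G n = (fst n, g (snd n))" for n :: "real \<times> real \<times> real"
  have oV: "open (UNIV \<times> V :: (real \<times> real \<times> real) set)" using diffeo_onD(4)[OF f] by (auto intro: open_Times)
  have sg: "smooth_on (UNIV \<times> V :: (real \<times> real \<times> real) set) (\<lambda>n. g (snd n))"
    by (rule smooth_on_compose[OF _ diffeo_onD(2)[OF f]]) (use oV in \<open>auto intro: smooth_intros\<close>)
  have sG: "smooth_on (UNIV \<times> V) G"
    unfolding G_def[abs_def] using oV by (intro smooth_on_Pair sg smooth_intros)
  have "N = (UNIV \<times> V) \<inter> G -` B" by (auto simp: N_def G_def)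
  then have op: "open N"
    using continuous_open_preimage[OF smooth_on_continuous_on[OF sG] oV B(1)] by simp
  have sub: "N \<subseteq> UNIV \<times> V" by (auto simp: N_def)
  show "smooth_on N (\<lambda>n. g (snd n))" by (rule smooth_on_subset[OF sg op sub])
  have GN: "G ` N \<subseteq> I \<times> \<Omega>" using B(2) by (auto simp: N_def G_def)
  have "smooth_on N (\<lambda>n. s (G n))"
    by (rule smooth_on_compose[OF smooth_on_subset[OF sG op sub] smooth_s GN])
  then show s\<sigma>: "smooth_on N \<sigma>" by (simp add: G_def \<sigma>_def[abs_def])
  have mem: "fst n \<in> I" "g (snd n) \<in> \<Omega>" if "n \<in> N" for n using GN that by (auto simp: G_def)
  have line: "pd (1, 0, 0) \<sigma> n = pd (1, 0, 0) s (fst n, g (snd n))" if n: "n \<in> N" for n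
  proof -
    have "((\<lambda>x. \<sigma> (x, snd n)) has_real_derivative pd (1, 0, 0) \<sigma> n) (at (fst n))"
      using pd_line1[OF s\<sigma>, of "fst n" "fst (snd n)" "snd (snd n)"] n by simp
    from DERIV_unique[OF this] show ?thesis
      using s_line[OF mem[OF n]] by (simp add: \<sigma>_def)
  qed
  then show "n \<in> N \<Longrightarrow> pd (1, 0, 0) \<sigma> n = pd (1, 0, 0) s (fst n, g (snd n))" .
  show "pd (1, 0, 0) (pd (1, 0, 0) \<sigma>) n = \<Phi> (fst n, \<sigma> n, pd (1, 0, 0) \<sigma> n)" if n: "n \<in> N"
  proof -
    have "((\<lambda>x. pd (1, 0, 0) s (x, g (snd n))) has_real_derivative \<Phi> (fst n, \<sigma> n, pd (1, 0, 0) \<sigma> n)) (at (fst n))"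
      using s_line2[OF mem[OF n]] s_ode[OF mem[OF n]] by (simp add: \<sigma>_def line[OF n])
    then have "((\<lambda>x. pd (1, 0, 0) \<sigma> (x, snd n)) has_real_derivative \<Phi> (fst n, \<sigma> n, pd (1, 0, 0) \<sigma> n)) (at (fst n))"
    proof (rule has_field_derivative_transform_within_open[OF _ open_slice[OF op]])
      show "fst n \<in> {x. (x, snd n) \<in> N}" using n by simp
    qed (simp add: line)
    moreover have "((\<lambda>x. pd (1, 0, 0) \<sigma> (x, snd n)) has_real_derivative pd (1, 0, 0) (pd (1, 0, 0) \<sigma>) n) (at (fst n))"
      using pd_line1[OF smooth_on_pd[OF s\<sigma>], of "fst n" "fst (snd n)" "snd (snd n)"] n by simp
    ultimately show ?thesis using DERIV_unique by blast
  qed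
qed

text \<open>\<open>f\<close> takes \<open>(1, q0)\<close> to a multiple of \<open>(1, q1)\<close>,
  so the latter is tangent to the curve of the base point. If the derivative in \<open>z\<close>
  vanished as well, all parameter derivatives of \<open>\<sigma>\<close> would vanish, and pulling
  back to \<open>s\<close> would contradict transversality in the old coordinates.\<close>

lemma pd_\<sigma>0: "pd (0, 0, 1) \<sigma> (x0, t1, z1) \<noteq> 0"
  "pd (0, 1, 0) \<sigma> (x0, t1, z1) + q1 * pd (0, 0, 1) \<sigma> (x0, t1, z1) = 0"
proof -
  let ?n = "(x0, t1, z1)"
  define N where "N = {n \<in> UNIV \<times> V. (fst n, g (snd n)) \<in> I \<times> \<Omega>}"
  have s\<sigma>: "smooth_on N \<sigma>"
    unfolding N_def using I(1) \<Omega>(1) by (intro smooth_on_\<sigma>) (auto intro: open_Times)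
  have n: "?n \<in> N" using fU I \<Omega> by (simp add: N_def)
  have n0: "(x0, t0, z0) \<in> I \<times> \<Omega>" using I \<Omega> by simp
  have pull: "pd (0, frechet_derivative f (at (t0, z0)) v) \<sigma> ?n = pd (0, v) s (x0, t0, z0)" for v
  proof -
    have "(g has_derivative frechet_derivative g (at (t1, z1))) (at (t1, z1))"
      by (rule smooth_on_has_derivative[OF diffeo_onD(2)[OF f] fU(3)])
    then have "((\<lambda>n. (fst n, g (snd n))) has_derivative (\<lambda>v. (fst v, frechet_derivative g (at (t1, z1)) (snd v)))) (at ?n)"
      by (intro has_derivative_Pair bounded_linear_imp_has_derivative bounded_linear_fst
          has_derivative_compose[where f = snd and f' = snd] bounded_linear_snd) simp
    from has_derivative_compose[OF this, of s "frechet_derivative s (at (x0, t0, z0))"]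
    have "(\<sigma> has_derivative (\<lambda>v. frechet_derivative s (at (x0, t0, z0)) (fst v, frechet_derivative g (at (t1, z1)) (snd v)))) (at ?n)"
      using smooth_on_has_derivative[OF smooth_s n0] fU(4) by (simp add: \<sigma>_def[abs_def])
    from frechet_derivative_at[OF this, symmetric] show ?thesis
      by (simp add: pd_def derivative_g)
  qed
  have "r1 * pd (0, 1, 0) \<sigma> ?n + r1 * q1 * pd (0, 0, 1) \<sigma> ?n = pd (0, r1, r1 * q1) \<sigma> ?n"
    by (simp add: pd_triple[OF s\<sigma> n, of 0 r1])
  also have "\<dots> = pd (0, 1, q0) s (x0, t0, z0)" using pull[of "(1, q0)"] r1 by simp
  also have "\<dots> = 0" using pd_s0(2) by (simp add: pd_triple[OF smooth_s n0, of 0 1 q0])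
  finally have "r1 * (pd (0, 1, 0) \<sigma> ?n + q1 * pd (0, 0, 1) \<sigma> ?n) = 0" by (simp add: algebra_simps)
  then show eq: "pd (0, 1, 0) \<sigma> ?n + q1 * pd (0, 0, 1) \<sigma> ?n = 0" using r1(1) by simp
  show "pd (0, 0, 1) \<sigma> ?n \<noteq> 0"
  proof
    assume z: "pd (0, 0, 1) \<sigma> ?n = 0"
    then have "pd (0, v) \<sigma> ?n = 0" for v
      using eq pd_triple[OF s\<sigma> n, of 0 "fst v" "snd v"] by simp
    then show False using pull[of "(0, 1)"] pd_s0(1) by simp
  qed
qed

text \<open>The equivalence of \<open>F\<close> and \<open>H\<close> matches whole solution graphs,
  while the equation for \<open>w\<close> is wanted pointwise. The link is that \<open>g\<close>
  takes each \<open>(r, w (r, x, y))\<close> to the graph of the \<open>F\<close>-solution belonging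
  to the same point \<open>(x, y)\<close>. The image of that graph is the graph of one
  \<open>H\<close>-solution \<open>v\<close>, hence \<open>w\<close> coincides with
  \<open>v\<close>. The bound on \<open>N\<close> allows later arguments to return from
  \<open>\<sigma>\<close> to \<open>s\<close>.\<close>

theorem dual_family: "\<exists>N w A. dual_family \<Phi> (x0, y0, p0) \<sigma> N w A H (t1, z1, q1) \<and> N \<subseteq> {n. snd n \<in> V \<and> fst n \<in> I \<and> g (snd n) \<in> \<Omega>}"
proof -
  obtain B0 w0 T M where B0: "open B0" "(x0, t0, z0) \<in> B0" "B0 \<subseteq> I \<times> \<Omega>"
    and w0: "\<And>x t z. (x, t, z) \<in> B0 \<Longrightarrow> w0 (t, x, s (x, t, z)) = z"
    and TM: "open T" "t0 \<in> T" "open M" "(x0, y0) \<in> M"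
    and solF: "\<And>m. m \<in> M \<Longrightarrow> jets_in W1 T (\<lambda>t. w0 (t, m)) \<and> solves F T (\<lambda>t. w0 (t, m))"
    using dual_curves[OF W1(1,2)] by metis
  define N0 where "N0 = {n \<in> UNIV \<times> V. (fst n, g (snd n)) \<in> B0}"
  note s\<sigma>0 = smooth_on_\<sigma>[OF B0(1,3), folded N0_def] and sg0 = smooth_on_g[OF B0(1,3), folded N0_def]
  define E where "E n = (fst (g (snd n)), fst n, \<sigma> n)" for n
  have sE: "smooth_on N0 E"
    unfolding E_def[abs_def] using smooth_onD(2)[OF s\<sigma>0] by (intro smooth_intros s\<sigma>0 sg0)
  \<comment> \<open>Over \<open>N1\<close> the first coordinate of \<open>g (t, z)\<close> stays in
    the interval of the old curves and the point \<open>(x, \<sigma>)\<close> stays in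
    \<open>M\<close>, where these curves are known to solve \<open>F\<close>.\<close>
  define N1 where "N1 = N0 \<inter> E -` (T \<times> M)"
  have N1: "open N1" "N1 \<subseteq> N0"
    unfolding N1_def using TM(1,3)
    by (auto intro!: continuous_open_preimage smooth_on_continuous_on[OF sE] smooth_onD(2)[OF sE] open_Times)
  note s\<sigma>1 = smooth_on_subset[OF s\<sigma>0 N1]
  have \<sigma>0: "\<sigma> (x0, t1, z1) = y0" using fU s0 by (simp add: \<sigma>_def)
  have "(x0, t1, z1) \<in> N1" using fU B0 TM \<sigma>0 by (simp add: N1_def N0_def E_def)
  from implicit_family[OF s\<sigma>1 this pd_\<sigma>0(1)] obtain N A w
    where N: "open N" "N \<subseteq> N1" "(x0, t1, z1) \<in> N" and sw: "smooth_on A w"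
    and A: "\<And>t x y. (t, x, y) \<in> A \<Longrightarrow> (x, t, w (t, x, y)) \<in> N \<and> \<sigma> (x, t, w (t, x, y)) = y"
    and NA: "\<And>t x z. (x, t, z) \<in> N \<Longrightarrow> (t, x, \<sigma> (x, t, z)) \<in> A \<and> w (t, x, \<sigma> (x, t, z)) = z"
    by metis
  note s\<sigma> = smooth_on_subset[OF s\<sigma>1 N(1,2)]
  have NN0: "n \<in> N0" if "n \<in> N" for n using that N(2) N1(2) by auto
  have m0: "(t1, x0, y0) \<in> A" "w (t1, x0, y0) = z1" using NA[OF N(3)] \<sigma>0 by simp_all
  have "pd (0, 1, 0) \<sigma> (x0, t1, z1) + pd (1, 0, 0) w (t1, x0, y0) * pd (0, 0, 1) \<sigma> (x0, t1, z1) = 0"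
    using implicit_family_derivatives(3)[OF s\<sigma> sw A m0(1)] m0(2) by simp
  with pd_\<sigma>0(2) have "(pd (1, 0, 0) w (t1, x0, y0) - q1) * pd (0, 0, 1) \<sigma> (x0, t1, z1) = 0"
    by algebra
  then have q1: "pd (1, 0, 0) w (t1, x0, y0) = q1" using pd_\<sigma>0(1) by simp
  have ode: "pd (1, 0, 0) (pd (1, 0, 0) w) (t, x, y) = H (t, w (t, x, y), pd (1, 0, 0) w (t, x, y))"
    if m: "(t, x, y) \<in> A" for t x y
  proof -
    have on: "f (g (r, w (r, x, y))) = (r, w (r, x, y)) \<and> g (r, w (r, x, y)) \<in> graph_on T (\<lambda>t. w0 (t, x, y))
        \<and> (x, y) \<in> M" if "(r, x, y) \<in> A" for r
    proof -
      have n: "(x, r, w (r, x, y)) \<in> N" "\<sigma> (x, r, w (r, x, y)) = y" using A[OF that] by auto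
      then have n1: "(x, r, w (r, x, y)) \<in> N1" "(x, r, w (r, x, y)) \<in> N0" using N N1 by auto
      obtain \<tau> \<omega> where \<tau>: "g (r, w (r, x, y)) = (\<tau>, \<omega>)" by (metis surj_pair)
      have "\<tau> \<in> T" "(x, y) \<in> M" using n1(1) n(2) \<tau> by (auto simp: N1_def E_def)
      moreover have "(x, \<tau>, \<omega>) \<in> B0" "s (x, \<tau>, \<omega>) = y" "(r, w (r, x, y)) \<in> V"
        using n1(2) n(2) \<tau> by (auto simp: N0_def \<sigma>_def)
      moreover have "w0 (\<tau>, x, y) = \<omega>" using w0[OF \<open>(x, \<tau>, \<omega>) \<in> B0\<close>] \<open>s (x, \<tau>, \<omega>) = y\<close> by simp
      ultimately show ?thesis using diffeo_onD(9)[OF f, of "(r, w (r, x, y))"] \<tau> by (auto simp: graph_on_def)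
    qed
    have "(x, y) \<in> M" using on[OF m] by simp
    then obtain J v where v: "solves H J v" "f ` graph_on T (\<lambda>t. w0 (t, x, y)) = graph_on J v"
      using solF equiv by blast
    have wv: "r \<in> J \<and> v r = w (r, x, y)" if "(r, x, y) \<in> A" for r
    proof -
      have "(r, w (r, x, y)) \<in> f ` graph_on T (\<lambda>t. w0 (t, x, y))" using on[OF that] by (metis imageI)
      then show ?thesis unfolding v(2) by (auto simp: graph_on_def)
    qed
    have S: "open {r. (r, x, y) \<in> A}" by (rule open_slice[OF smooth_onD(2)[OF sw]])
    have dv: "(v has_real_derivative pd (1, 0, 0) w (r, x, y)) (at r)" if r: "(r, x, y) \<in> A" for r
      by (rule has_field_derivative_transform_within_open[OF pd_line1[OF sw r] S]) (use r wv in auto)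
    have "(deriv v has_real_derivative H (t, v t, deriv v t)) (at t)"
      using v(1) wv[OF m] unfolding solves_def by blast
    then have "((\<lambda>r. pd (1, 0, 0) w (r, x, y)) has_real_derivative H (t, v t, deriv v t)) (at t)"
      by (rule has_field_derivative_transform_within_open[OF _ S]) (use m DERIV_imp_deriv[OF dv] in auto)
    from DERIV_unique[OF pd_line1[OF smooth_on_pd[OF sw] m] this] show ?thesis
      using wv[OF m] DERIV_imp_deriv[OF dv[OF m]] by simp
  qed
  have AN: "(t, x, y) \<in> A \<Longrightarrow> (x, t, w (t, x, y)) \<in> N" for t x y using A by simp
  note sp = smooth_on_curve_slope[OF s\<sigma> sw AN]
  \<comment> \<open>Along the curve of the base point the initial data are \<open>(y0, p)\<close>.
    If \<open>p_t\<close> vanished, the derivative of \<open>initial\<close> would annihilate the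
    velocity of the curve, which in the old coordinates is \<open>(1 / r1, q0 / r1)\<close> and
    nonzero.\<close>
  have p1: "pd (1, 0, 0) (curve_slope \<sigma> w) (t1, x0, y0) \<noteq> 0"
  proof
    assume z: "pd (1, 0, 0) (curve_slope \<sigma> w) (t1, x0, y0) = 0"
    let ?\<gamma> = "\<lambda>t. (t, w (t, x0, y0))"
    have S: "open {r. (r, x0, y0) \<in> A}" by (rule open_slice[OF smooth_onD(2)[OF sw]])
    have "(?\<gamma> has_vector_derivative (1, q1)) (at t1)"
      by (rule has_vector_derivative_graph) (use pd_line1[OF sw m0(1)] q1 in simp)
    then have "((\<lambda>t. g (?\<gamma> t)) has_vector_derivative frechet_derivative g (at (?\<gamma> t1)) (1, q1)) (at t1)"
      by (rule smooth_on_curve_vector[OF diffeo_onD(2)[OF f], rotated]) (use m0 fU in simp)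
    then have "((\<lambda>t. g (?\<gamma> t)) has_vector_derivative (1 / r1, q0 / r1)) (at t1)"
      using derivative_g_direction m0(2) by simp
    then have d: "((\<lambda>t. initial (g (?\<gamma> t))) has_vector_derivative
        frechet_derivative initial (at (g (?\<gamma> t1))) (1 / r1, q0 / r1)) (at t1)"
      by (rule smooth_on_curve_vector[OF smooth_initial, rotated]) (use m0 fU \<Omega> in simp)
    have "((\<lambda>t. (y0, curve_slope \<sigma> w (t, x0, y0))) has_vector_derivative (0, 0)) (at t1)"
      using pd_line1[OF sp m0(1)] z
      by (auto intro!: derivative_eq_intros simp: has_real_derivative_iff_has_vector_derivative)
    then have "((\<lambda>t. initial (g (?\<gamma> t))) has_vector_derivative (0, 0)) (at t1)"
      unfolding has_vector_derivative_def
    proof (rule has_derivative_transform_within_open[OF _ S])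
      show "t1 \<in> {r. (r, x0, y0) \<in> A}" using m0 by simp
      fix r assume "r \<in> {r. (r, x0, y0) \<in> A}"
      then have r: "(r, x0, y0) \<in> A" by simp
      show "(y0, curve_slope \<sigma> w (r, x0, y0)) = initial (g (r, w (r, x0, y0)))"
        using A[OF r] \<sigma>_line[OF B0(1,3), of "(x0, r, w (r, x0, y0))"] NN0[of "(x0, r, w (r, x0, y0))"]
        by (simp add: initial_def curve_slope_def \<sigma>_def N0_def)
    qed
    from vector_derivative_unique_at[OF d this]
    have "frechet_derivative initial (at (t0, z0)) (1 / r1, q0 / r1) = 0"
      using m0 fU by (simp add: zero_prod_def)
    from initial_derivative_eq_0[OF this] show False using r1(1) by (simp add: zero_prod_def)
  qed
  have \<sigma>x0: "pd (1, 0, 0) \<sigma> (x0, t1, z1) = p0"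
    using \<sigma>_line[OF B0(1,3), of "(x0, t1, z1)"] NN0[OF N(3)] s0(2) fU deriv_s[OF I(3) \<Omega>(2)] by (simp add: N0_def)
  have \<sigma>xx: "pd (1, 0, 0) (pd (1, 0, 0) \<sigma>) (x, t, z) = \<Phi> (x, \<sigma> (x, t, z), pd (1, 0, 0) \<sigma> (x, t, z))"
    if "(x, t, z) \<in> N" for x t z
    using \<sigma>_ode[OF B0(1,3), of "(x, t, z)"] NN0[OF that] by (simp add: N0_def)
  have "dual_family \<Phi> (x0, y0, p0) \<sigma> N w A H (t1, z1, q1)"
    unfolding dual_family_def using s\<sigma> sw N(3) \<sigma>0 \<sigma>x0 q1 p1 NA \<sigma>xx A ode by simp
  moreover have "N \<subseteq> {n. snd n \<in> V \<and> fst n \<in> I \<and> g (snd n) \<in> \<Omega>}"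
    using NN0 B0(3) by (auto simp: N0_def)
  ultimately show ?thesis by blast
qed

end

section \<open>Equations with \<open>K\<^sub>0 = 0\<close> and derivatives of first order equations\<close>

lemma derived_ode_eq:
  assumes G: "smooth_on D G" "(x, y) \<in> D"
  shows "derived_ode G (x, y, p) = frechet_derivative G (at (x, y)) (1, p)"
proof -
  have "((\<lambda>r. G (r, y)) has_real_derivative frechet_derivative G (at (x, y)) (1, 0)) (at x)"
    by (rule smooth_on_curve[OF G(1)]) (use G(2) in \<open>auto intro!: derivative_eq_intros simp: has_vector_derivative_def\<close>)
  moreover have "((\<lambda>r. G (x, r)) has_real_derivative frechet_derivative G (at (x, y)) (0, 1)) (at y)"
    by (rule smooth_on_curve[OF G(1)]) (use G(2) in \<open>auto intro!: derivative_eq_intros simp: has_vector_derivative_def\<close>)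
  ultimately have "derived_ode G (x, y, p)
      = frechet_derivative G (at (x, y)) (1, 0) + frechet_derivative G (at (x, y)) (0, 1) * p"
    by (simp add: derived_ode_def DERIV_imp_deriv)
  also have "\<dots> = frechet_derivative G (at (x, y)) ((1, 0) + p *\<^sub>R (0, 1))"
    using smooth_on_linear_derivative[OF G] by (simp only: linear_add linear_cmul real_scaleR_def mult.commute)
  finally show ?thesis by simp
qed

section \<open>Differentials and jets along the incidence relation\<close>

locale incidence =
  fixes \<Phi> H :: ode and x0 y0 p0 t0 z0 q0 :: real
    and \<sigma> w :: "real \<times> real \<times> real \<Rightarrow> real" and N A :: "(real \<times> real \<times> real) set"
  assumes family: "dual_family \<Phi> (x0, y0, p0) \<sigma> N w A H (t0, z0, q0)"
begin

abbreviation "p \<equiv> curve_slope \<sigma> w"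
abbreviation "p1 \<equiv> pd (1, 0, 0) p"
abbreviation "p2 \<equiv> pd (1, 0, 0) p1"
abbreviation "wt \<equiv> pd (1, 0, 0) w"
abbreviation "wy \<equiv> pd (0, 0, 1) w"
abbreviation "wyt \<equiv> pd (1, 0, 0) wy"

definition dual_jet :: "real \<times> real \<times> real \<Rightarrow> jet" where "dual_jet m = (fst m, w m, wt m)"

lemma \<sigma>: "smooth_on N \<sigma>" "(x0, t0, z0) \<in> N" "\<sigma> (x0, t0, z0) = y0" "pd (1, 0, 0) \<sigma> (x0, t0, z0) = p0"
  and w: "smooth_on A w" "wt (t0, x0, y0) = q0" "p1 (t0, x0, y0) \<noteq> 0"
  and N_to_A: "(x, t, z) \<in> N \<Longrightarrow> (t, x, \<sigma> (x, t, z)) \<in> A" "(x, t, z) \<in> N \<Longrightarrow> w (t, x, \<sigma> (x, t, z)) = z"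
  and \<sigma>_ode: "(x, t, z) \<in> N \<Longrightarrow> pd (1, 0, 0) (pd (1, 0, 0) \<sigma>) (x, t, z) = \<Phi> (x, \<sigma> (x, t, z), pd (1, 0, 0) \<sigma> (x, t, z))"
  and A_to_N: "(t, x, y) \<in> A \<Longrightarrow> (x, t, w (t, x, y)) \<in> N" "(t, x, y) \<in> A \<Longrightarrow> \<sigma> (x, t, w (t, x, y)) = y"
  and w_ode: "(t, x, y) \<in> A \<Longrightarrow> pd (1, 0, 0) wt (t, x, y) = H (t, w (t, x, y), wt (t, x, y))"
  using family by (auto simp: dual_family_def)

lemma base: "(t0, x0, y0) \<in> A" "w (t0, x0, y0) = z0" "p (t0, x0, y0) = p0" "dual_jet (t0, x0, y0) = (t0, z0, q0)"
proof -
  show "(t0, x0, y0) \<in> A" "w (t0, x0, y0) = z0" using N_to_A[OF \<sigma>(2)] \<sigma>(3) by simp_all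
  then show "p (t0, x0, y0) = p0" "dual_jet (t0, x0, y0) = (t0, z0, q0)"
    using \<sigma>(4) w(2) by (simp_all add: curve_slope_def dual_jet_def)
qed

lemma open_A: "open A" using smooth_onD(2)[OF w(1)] .

lemma smooth_p: "smooth_on A p" by (rule smooth_on_curve_slope[OF \<sigma>(1) w(1) A_to_N(1)])

lemma smooth_dual_jet: "smooth_on A dual_jet"
  unfolding dual_jet_def[abs_def] using open_A by (intro smooth_intros smooth_on_pd w(1))

lemma wy_nonzero: "(t, x, y) \<in> A \<Longrightarrow> wy (t, x, y) \<noteq> 0"
  and wx: "(t, x, y) \<in> A \<Longrightarrow> pd (0, 1, 0) w (t, x, y) = - (p (t, x, y) * wy (t, x, y))"
  using implicit_family_derivatives(1,2)[OF \<sigma>(1) w(1)] A_to_N by (simp_all add: curve_slope_def)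

lemma wxt: "(t, x, y) \<in> A \<Longrightarrow> pd (1, 0, 0) (pd (0, 1, 0) w) (t, x, y)
    = - (p1 (t, x, y) * wy (t, x, y) + p (t, x, y) * wyt (t, x, y))"
  by (rule family_ratio_derivative[OF w(1) smooth_p wx])

text \<open>At fixed \<open>t\<close>, \<open>w\<close> is stationary in the direction of slope
  \<open>p\<close>. The two formulas give the differential of
  \<open>(x, y) \<mapsto> (w, w_t)\<close>, from which run and rise of the coordinate change are
  read off.\<close>

lemma transversal_derivatives:
  assumes m: "(t, x, y) \<in> A"
  shows "pd (0, a, b) w (t, x, y) = (b - a * p (t, x, y)) * wy (t, x, y)"
    and "pd (0, a, b) wt (t, x, y) = (b - a * p (t, x, y)) * wyt (t, x, y) - a * p1 (t, x, y) * wy (t, x, y)"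
proof -
  show "pd (0, a, b) w (t, x, y) = (b - a * p (t, x, y)) * wy (t, x, y)"
    by (simp add: pd_triple[OF w(1) m, of 0 a b] wx[OF m] algebra_simps)
  have "pd (0, a, b) wt (t, x, y) = a * pd (1, 0, 0) (pd (0, 1, 0) w) (t, x, y) + b * wyt (t, x, y)"
    by (simp add: pd_triple[OF smooth_on_pd[OF w(1), of "(1, 0, 0)"] m, of 0 a b]
        pd_commute[OF w(1) m, of "(0, 1, 0)" "(1, 0, 0)"] pd_commute[OF w(1) m, of "(0, 0, 1)" "(1, 0, 0)"])
  then show "pd (0, a, b) wt (t, x, y) = (b - a * p (t, x, y)) * wyt (t, x, y) - a * p1 (t, x, y) * wy (t, x, y)"
    by (simp add: wxt[OF m] algebra_simps)
qed

text \<open>The system is triangular in \<open>b - a p\<close> and \<open>a\<close>, with diagonal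
  entries \<open>w_y\<close> and \<open>- p_t w_y\<close>. So \<open>(w, w_t)\<close> at fixed
  \<open>t\<close> are local coordinates of the plane wherever \<open>p_t\<close> is
  nonzero.\<close>

lemma transversal_inj:
  assumes m: "(t, x, y) \<in> A" and p1: "p1 (t, x, y) \<noteq> 0"
    and z: "pd (0, a, b) w (t, x, y) = 0" "pd (0, a, b) wt (t, x, y) = 0"
  shows "a = 0 \<and> b = 0"
proof -
  have "(b - a * p (t, x, y)) * wy (t, x, y) = 0"
    using z(1) unfolding transversal_derivatives(1)[OF m, of a b] .
  then have b: "b = a * p (t, x, y)" using wy_nonzero[OF m] by simp
  have "(b - a * p (t, x, y)) * wyt (t, x, y) - a * p1 (t, x, y) * wy (t, x, y) = 0"
    using z(2) unfolding transversal_derivatives(2)[OF m, of a b] .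
  then have "a = 0" using b p1 wy_nonzero[OF m] by simp
  then show ?thesis using b by simp
qed

lemma K0_along_curves:
  assumes A1: "open A1" "A1 \<subseteq> A" and K: "smooth_on K H" "dual_jet ` A1 \<subseteq> K"
    and p1: "\<And>m. m \<in> A1 \<Longrightarrow> p1 m \<noteq> 0" and m: "(t, x, y) \<in> A1"
    and l: "((\<lambda>t. p2 (t, x, y) / p1 (t, x, y)) has_real_derivative l') (at t)" "l = p2 (t, x, y) / p1 (t, x, y)"
  shows "K0 H (dual_jet (t, x, y)) = l' / 2 - l\<^sup>2 / 4"
proof -
  have "K0 H (t, w (t, x, y), wt (t, x, y)) = l' / 2 - l\<^sup>2 / 4"
  proof (rule K0_eq_Schwarzian[OF smooth_on_subset[OF w(1) A1] K(1) _ _ smooth_on_subset[OF smooth_p A1] _ _ _ m l])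
    fix t x y assume "(t, x, y) \<in> A1"
    then have mA: "(t, x, y) \<in> A" and mA1: "(t, x, y) \<in> A1" using A1 by auto
    show "(t, w (t, x, y), wt (t, x, y)) \<in> K" using K(2) mA1 by (force simp: dual_jet_def)
    show "pd (1, 0, 0) wt (t, x, y) = H (t, w (t, x, y), wt (t, x, y))" by (rule w_ode[OF mA])
    show "pd (0, 1, 0) w (t, x, y) = - (p (t, x, y) * wy (t, x, y))" by (rule wx[OF mA])
    show "wy (t, x, y) \<noteq> 0" by (rule wy_nonzero[OF mA])
    show "p1 (t, x, y) \<noteq> 0" by (rule p1[OF mA1])
  qed
  then show ?thesis by (simp add: dual_jet_def)
qed

text \<open>\<open>K0\<close> is computed at jets of curves of points only. Since
  \<open>(w, w_t)\<close> are coordinates at fixed \<open>t\<close>, these jets fill a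
  neighbourhood, so vanishing on them is vanishing as a germ.\<close>

lemma dual_jets_cover:
  assumes A1: "open A1" "A1 \<subseteq> A" "(t0, x0, y0) \<in> A1"
  shows "\<forall>\<^sub>F j in nhds (t0, z0, q0). j \<in> dual_jet ` A1"
proof -
  note sj = smooth_on_subset[OF smooth_dual_jet A1(1,2)]
  have "v = 0" if v: "frechet_derivative dual_jet (at (t0, x0, y0)) v = 0" for v
  proof -
    obtain v1 a b where v123: "v = (v1, a, b)" by (cases v)
    have "(dual_jet has_derivative (\<lambda>v. (fst v, frechet_derivative w (at (t0, x0, y0)) v,
        frechet_derivative wt (at (t0, x0, y0)) v))) (at (t0, x0, y0))"
      unfolding dual_jet_def[abs_def]
      by (intro has_derivative_Pair bounded_linear_imp_has_derivative bounded_linear_fst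
          smooth_on_has_derivative[OF w(1) base(1)] smooth_on_has_derivative[OF smooth_on_pd[OF w(1)] base(1)])
    from frechet_derivative_at[OF this, symmetric] v
    have "v1 = 0" "pd v w (t0, x0, y0) = 0" "pd v wt (t0, x0, y0) = 0"
      by (auto simp: pd_def zero_prod_def v123)
    then show ?thesis
      using transversal_inj[OF base(1) w(3), of a b] by (simp add: v123 zero_prod_def)
  qed
  from smooth_inverse_function[OF sj A1(3) this] obtain B C
    where BC: "B \<subseteq> A1" "(t0, x0, y0) \<in> B" "open C" "diffeo_on B C dual_jet" by metis
  have "C \<subseteq> dual_jet ` A1" using diffeo_onD(5)[OF BC(4)] BC(1) by auto
  moreover have "(t0, z0, q0) \<in> C" using diffeo_onD(6)[OF BC(4,2)] base(4) by simp
  ultimately show ?thesis using BC(3) unfolding eventually_nhds by blast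
qed

text \<open>Where \<open>p_t\<close> is nonzero, \<open>t\<close> can replace the slope as third
  coordinate of a jet; this brings in a parameter that is constant along solutions.\<close>

lemma jets_cover:
  assumes A1: "open A1" "A1 \<subseteq> A" "(t0, x0, y0) \<in> A1"
  obtains C where "open C" "(x0, y0, p0) \<in> C" "C \<subseteq> (\<lambda>m. (fst (snd m), snd (snd m), p m)) ` A1"
proof -
  let ?e = "\<lambda>m. (fst (snd m), snd (snd m), p m)"
  have se: "smooth_on A1 ?e"
    using A1(1) by (intro smooth_intros smooth_on_subset[OF smooth_p A1(1,2)])
  have "v = 0" if v: "frechet_derivative ?e (at (t0, x0, y0)) v = 0" for v
  proof -
    obtain c a b where v123: "v = (c, a, b)" by (cases v)
    have "(?e has_derivative (\<lambda>v. (fst (snd v), snd (snd v), frechet_derivative p (at (t0, x0, y0)) v))) (at (t0, x0, y0))"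
      by (intro has_derivative_Pair bounded_linear_imp_has_derivative
          bounded_linear_compose[OF bounded_linear_fst bounded_linear_snd]
          bounded_linear_compose[OF bounded_linear_snd bounded_linear_snd]
          smooth_on_has_derivative[OF smooth_p base(1)])
    from frechet_derivative_at[OF this, symmetric] v
    have "a = 0" "b = 0" "pd v p (t0, x0, y0) = 0" by (auto simp: pd_def zero_prod_def v123)
    then show ?thesis using w(3) pd_triple[OF smooth_p base(1), of c 0 0] by (simp add: v123 zero_prod_def)
  qed
  from smooth_inverse_function[OF se A1(3) this] obtain B C
    where BC: "open B" "B \<subseteq> A1" "(t0, x0, y0) \<in> B" "open C" "diffeo_on B C ?e" .
  have "C \<subseteq> ?e ` A1" using diffeo_onD(5)[OF BC(5)] BC(2) by blast
  moreover have "(x0, y0, p0) \<in> C" using diffeo_onD(6)[OF BC(5,3)] base(3) by simp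
  ultimately show ?thesis using that[OF BC(4)] by blast
qed

theorem derived_if_K0_eq_0:
  assumes K: "smooth_on K H" "(t0, z0, q0) \<in> K" and K0: "\<And>j. j \<in> K \<Longrightarrow> K0 H j = 0"
  shows "\<exists>(G :: real \<times> real \<Rightarrow> real) a'. smooth_near (jet_pt a') G \<and> point_equivalent \<Phi> (x0, y0, p0) (derived_ode G) a'"
proof -
  define A1 where "A1 = (A \<inter> dual_jet -` K) \<inter> (A \<inter> p1 -` (- {0}))"
  have A1: "open A1" "A1 \<subseteq> A" "(t0, x0, y0) \<in> A1"
    unfolding A1_def using K base w(3) smooth_onD(2)[OF K(1)]
    by (auto intro!: continuous_open_preimage smooth_on_continuous_on[OF smooth_dual_jet]
        smooth_on_continuous_on[OF smooth_on_pd[OF smooth_p]] open_A)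
  have A1D: "m \<in> A" "dual_jet m \<in> K" "p1 m \<noteq> 0" if "m \<in> A1" for m using that by (auto simp: A1_def)
  obtain T' M where TM: "open T'" "open M" "t0 \<in> T'" "(x0, y0) \<in> M" "T' \<times> M \<subseteq> A1"
    using open_prod_elim[OF A1(1,3)] by (metis mem_Sigma_iff)
  obtain e where e: "e > 0" "ball t0 e \<subseteq> T'" using TM(1,3) open_contains_ball by blast
  define T where "T = ball t0 e"
  \<comment> \<open>\<open>run f\<close> will contain the factor \<open>r - p (c, x, y)\<close>: the
    solution with parameter \<open>c\<close> is turned vertical. With \<open>c = t0\<close> the base
    jet would not be prolongable.\<close>
  define c where "c = t0 + e / 2"
  have T: "open T" "is_interval T" "t0 \<in> T" "c \<in> T" "t0 \<noteq> c"
    using e by (auto simp: T_def c_def is_interval_ball_real dist_real_def)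
  have TA: "(t, m) \<in> A1" if "t \<in> T" "m \<in> M" for t m using that e(2) TM(5) by (auto simp: T_def)
  \<comment> \<open>Half of \<open>p_tt / p_t\<close>: with this factor a vanishing Schwarzian reads
    \<open>u' = u^2\<close>.\<close>
  define u where "u m = p2 m / p1 m / 2" for m
  have su: "smooth_on A1 u"
    unfolding u_def[abs_def] using A1D(3) A1(1)
    by (intro smooth_intros smooth_on_subset[OF _ A1(1,2)] smooth_on_pd smooth_p) auto
  have Moebius: "(p (t, x, y) - p (c, x, y)) * (1 - (t - c) * u (c, x, y)) = (t - c) * p1 (c, x, y)"
    if t: "t \<in> T" and m: "(x, y) \<in> M" for t x y
  proof (rule vanishing_Schwarzian[OF T(2,1,4) t])
    fix r assume r: "r \<in> T"
    note rA1 = TA[OF r m] and rA = A1D(1)[OF TA[OF r m]]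
    show "((\<lambda>t. p (t, x, y)) has_real_derivative p1 (r, x, y)) (at r)" by (rule pd_line1[OF smooth_p rA])
    show "p1 (r, x, y) \<noteq> 0" by (rule A1D(3)[OF rA1])
    show "((\<lambda>t. p1 (t, x, y)) has_real_derivative 2 * u (r, x, y) * p1 (r, x, y)) (at r)"
      using pd_line1[OF smooth_on_pd[OF smooth_p] rA] A1D(3)[OF rA1] by (simp add: u_def)
    have du: "((\<lambda>t. u (t, x, y)) has_real_derivative pd (1, 0, 0) u (r, x, y)) (at r)"
      by (rule pd_line1[OF su rA1])
    from DERIV_cmult[OF this, of 2]
    have "((\<lambda>t. p2 (t, x, y) / p1 (t, x, y)) has_real_derivative 2 * pd (1, 0, 0) u (r, x, y)) (at r)"
      by (simp add: u_def)
    from K0_along_curves[OF A1(1,2) K(1) _ A1D(3) rA1 this refl] K0[OF A1D(2)[OF rA1]]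
    have "pd (1, 0, 0) u (r, x, y) = (u (r, x, y))\<^sup>2"
      using A1D(2) by (auto simp: u_def power2_eq_square image_subset_iff)
    then show "((\<lambda>t. u (t, x, y)) has_real_derivative (u (r, x, y))\<^sup>2) (at r)" using du by simp
  qed
  have cA: "(c, m) \<in> A" "(c, m) \<in> A1" if "m \<in> M" for m using TA[OF T(4) that] A1D by auto
  have p_ne: "p (t, x, y) \<noteq> p (c, x, y)" if "t \<in> T" "t \<noteq> c" "(x, y) \<in> M" for t x y
    using Moebius[OF that(1,3)] that(2) A1D(3)[OF TA[OF T(4) that(3)]] by auto
  define f where "f m = (w (c, m), wt (c, m))" for m
  have sc: "smooth_on M (\<lambda>m. (c, m))" "(\<lambda>m. (c, m)) ` M \<subseteq> A"
    using TM(2) cA by (auto intro: smooth_intros)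
  have sf: "smooth_on M f"
    unfolding f_def[abs_def]
    by (rule smooth_on_Pair[OF smooth_on_compose[OF sc(1) w(1) sc(2)]
          smooth_on_compose[OF sc(1) smooth_on_pd[OF w(1)] sc(2)]])
  have df: "frechet_derivative f (at m) v = (pd (0, v) w (c, m), pd (0, v) wt (c, m))" if m: "m \<in> M" for m v
  proof -
    have i: "((\<lambda>m. (c, m)) has_derivative (\<lambda>v. (0, v))) (at m)" by (auto intro!: derivative_eq_intros)
    have "(f has_derivative (\<lambda>v. (pd (0, v) w (c, m), pd (0, v) wt (c, m)))) (at m)"
      unfolding f_def[abs_def] pd_def[of "(0, _)"]
      by (intro has_derivative_Pair has_derivative_compose[OF i] smooth_on_has_derivative[OF w(1) cA(1)[OF m]]
          smooth_on_has_derivative[OF smooth_on_pd[OF w(1)] cA(1)[OF m]])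
    from frechet_derivative_at[OF this, symmetric] show ?thesis by simp
  qed
  have runrise: "run f (x, y, r) = (r - p (c, x, y)) * wy (c, x, y)"
    "rise f (x, y, r) = (r - p (c, x, y)) * wyt (c, x, y) - p1 (c, x, y) * wy (c, x, y)" if "(x, y) \<in> M" for x y r
    unfolding run_def rise_def
    by (simp_all add: jet_pt_def df[OF that] transversal_derivatives[OF cA(1)[OF that], of 1 r, simplified])
  have inj: "v = 0" if v: "frechet_derivative f (at (x0, y0)) v = 0" for v
  proof -
    obtain a b where ab: "v = (a, b)" by (cases v)
    have "pd (0, a, b) w (c, x0, y0) = 0" "pd (0, a, b) wt (c, x0, y0) = 0"
      using v df[OF TM(4)] by (simp_all add: ab zero_prod_def)
    from transversal_inj[OF cA(1)[OF TM(4)] A1D(3)[OF cA(2)[OF TM(4)]] this] show ?thesis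
      by (simp add: ab zero_prod_def)
  qed
  obtain U V where UV: "open U" "U \<subseteq> M" "(x0, y0) \<in> U" "diffeo_on U V f"
    using smooth_inverse_function[OF sf TM(4) inj] by metis
  define G where "G = (\<lambda>m. dp H (c, m) / 2)"
  define D where "D = {m. (c, m) \<in> K}"
  have oD: "open D"
    using continuous_open_vimage[OF smooth_onD(2)[OF K(1)], of "\<lambda>m. (c, m)"]
    by (simp add: D_def vimage_def continuous_intros)
  have sG: "smooth_on D G"
  proof -
    have "smooth_on D (\<lambda>m. (c, m))" using oD by (intro smooth_intros)
    from smooth_on_compose[OF this smooth_on_dp[OF K(1)]]
    show ?thesis unfolding G_def using oD by (intro smooth_intros) (auto simp: D_def)
  qed
  have fD: "f m \<in> D" if "m \<in> M" for m
    using A1D(2)[OF cA(2)[OF that]] by (simp add: D_def f_def dual_jet_def)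
  \<comment> \<open>\<open>rise / run\<close> is \<open>w_yt / w_y - p_t / (r - p)\<close> taken at
    \<open>c\<close>. The reduced linearised equation gives \<open>H_p / 2 - u\<close> for the first
    term, and the Moebius relation gives \<open>1 / (t - c) - u\<close> for the second when
    \<open>r = p (t, x, y)\<close>; \<open>u\<close> cancels.\<close>
  have slope: "slope f (x, y, p (t, x, y)) = G (f (x, y)) - 1 / (t - c)"
    if t: "t \<in> T" "t \<noteq> c" and m: "(x, y) \<in> M" for t x y
  proof -
    let ?m = "(c, x, y)"
    have "p2 ?m * wy ?m + 2 * p1 ?m * wyt ?m = dp H (dual_jet ?m) * p1 ?m * wy ?m"
    proof (rule family_linearised_ratio[OF smooth_on_subset[OF w(1) A1(1,2)] K(1) _ _ smooth_on_subset[OF smooth_p A1(1,2)]])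
      fix t x y assume *: "(t, x, y) \<in> A1"
      show "(t, w (t, x, y), wt (t, x, y)) \<in> K" using A1D(2)[OF *] by (simp add: dual_jet_def)
      show "pd (1, 0, 0) wt (t, x, y) = H (t, w (t, x, y), wt (t, x, y))" by (rule w_ode[OF A1D(1)[OF *]])
      show "pd (0, 1, 0) w (t, x, y) = - (p (t, x, y) * wy (t, x, y))" by (rule wx[OF A1D(1)[OF *]])
    qed (use cA(2)[OF m] in \<open>simp_all add: dual_jet_def\<close>)
    moreover have "G (f (x, y)) = dp H (dual_jet ?m) / 2" by (simp add: G_def f_def dual_jet_def)
    moreover have "p2 ?m = 2 * u ?m * p1 ?m" using A1D(3)[OF cA(2)[OF m]] by (simp add: u_def)
    ultimately have "2 * p1 ?m * (wyt ?m - (G (f (x, y)) - u ?m) * wy ?m) = 0" by (simp add: algebra_simps)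
    then have wyt: "wyt ?m = (G (f (x, y)) - u ?m) * wy ?m" using A1D(3)[OF cA(2)[OF m]] by simp
    define d where "d = p (t, x, y) - p ?m"
    have d: "d \<noteq> 0" using p_ne[OF t m] by (simp add: d_def)
    have p1c: "(t - c) * p1 ?m = d * (1 - (t - c) * u ?m)" using Moebius[OF t(1) m] by (simp add: d_def)
    have "(t - c) * (rise f (x, y, p (t, x, y)))
        = wy ?m * (d * (t - c) * (G (f (x, y)) - u ?m) - (t - c) * p1 ?m)"
      unfolding runrise(2)[OF m] d_def[symmetric] wyt by (simp add: algebra_simps)
    also have "\<dots> = d * wy ?m * ((t - c) * G (f (x, y)) - 1)" unfolding p1c by (simp add: algebra_simps)
    also have "\<dots> = run f (x, y, p (t, x, y)) * ((t - c) * G (f (x, y)) - 1)"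
      by (simp add: runrise(1)[OF m] d_def)
    finally have "(t - c) * rise f (x, y, p (t, x, y)) = run f (x, y, p (t, x, y)) * ((t - c) * G (f (x, y)) - 1)" .
    moreover have "run f (x, y, p (t, x, y)) \<noteq> 0"
      using d wy_nonzero[OF cA(1)[OF m]] by (simp add: runrise(1)[OF m] d_def)
    ultimately show ?thesis using t(2) by (simp add: slope_def field_simps)
  qed
  \<comment> \<open>The parameter \<open>c\<close> is removed, since the slope formula has its pole
    there; the jets that remain still cover a neighbourhood of the base jet.\<close>
  define A2 where "A2 = A1 \<inter> ((T - {c}) \<times> U)"
  have A2: "open A2" "A2 \<subseteq> A" "(t0, x0, y0) \<in> A2"
    unfolding A2_def using A1 T UV(1,3) by (auto intro!: open_Int open_Times open_delete)
  from jets_cover[OF A2] obtain C where C: "open C" "(x0, y0, p0) \<in> C"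
    "C \<subseteq> (\<lambda>m. (fst (snd m), snd (snd m), p m)) ` A2" .
  have A2D: "t \<in> T" "t \<noteq> c" "(x, y) \<in> U" "(x, y) \<in> M" "(t, x, y) \<in> A" if "(t, x, y) \<in> A2" for t x y
    using that UV(2) A2(2) by (auto simp: A2_def)
  have over: "(x, y, p (t, x, y)) \<in> jets_over U f" if "(t, x, y) \<in> A2" for t x y
    using A2D[OF that] p_ne[of t x y] wy_nonzero[OF cA(1), of "x" "y"]
    by (simp add: jets_over_def jet_pt_def prolongable_eq runrise)
  have CE: "\<exists>t. (t, fst j, fst (snd j)) \<in> A2 \<and> snd (snd j) = p (t, fst j, fst (snd j))" if "j \<in> C" for j
    using C(3) that by fastforce
  have "point_equivalent \<Phi> (x0, y0, p0) (derived_ode G) (prolong f (x0, y0, p0))"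
  proof (rule point_equivalentI[OF UV(4) C(1,2) _ refl])
    show "C \<subseteq> jets_over U f" using C(3) over by auto
    fix j assume "j \<in> C"
    obtain x y r where j: "j = (x, y, r)" by (cases j)
    obtain t where t: "(t, x, y) \<in> A2" and r: "r = p (t, x, y)" using CE[OF \<open>j \<in> C\<close>] j by auto
    note mD = A2D[OF t]
    define z where "z = w (t, x, y)"
    have n: "(x, t, z) \<in> N" "\<sigma> (x, t, z) = y" using A_to_N[OF mD(5)] by (simp_all add: z_def)
    have \<sigma>x: "pd (1, 0, 0) \<sigma> (x, t, z) = r" by (simp add: r curve_slope_def z_def)
    \<comment> \<open>The lift to jets of the solution through \<open>j\<close>. Along it
      \<open>t\<close> is constant, so \<open>1 / (t - c)\<close> drops out on differentiation and
      only the derivative of \<open>G\<close> along the image is left. Computed instead along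
      \<open>(1, r, \<Phi> j)\<close>, the same derivative is the left side of
      \<open>intertwines\<close>.\<close>
    define k where "k \<xi> = (\<xi>, \<sigma> (\<xi>, t, z), pd (1, 0, 0) \<sigma> (\<xi>, t, z))" for \<xi>
    have kx: "k x = j" by (simp add: k_def n(2) \<sigma>x j)
    have d\<sigma>: "((\<lambda>\<xi>. \<sigma> (\<xi>, t, z)) has_real_derivative r) (at x)"
      using pd_line1[OF \<sigma>(1) n(1)] \<sigma>x by simp
    have d\<sigma>x: "((\<lambda>\<xi>. pd (1, 0, 0) \<sigma> (\<xi>, t, z)) has_real_derivative \<Phi> j) (at x)"
      using pd_line1[OF smooth_on_pd[OF \<sigma>(1), of "(1, 0, 0)"] n(1)] \<sigma>_ode[OF n(1)] by (simp add: n(2) \<sigma>x j)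
    have "(k has_vector_derivative (1, r, \<Phi> j)) (at x)"
      unfolding k_def[abs_def] using d\<sigma> d\<sigma>x
      by (auto intro!: derivative_eq_intros simp: has_real_derivative_iff_has_vector_derivative)
    from smooth_on_curve[OF smooth_on_slope[OF diffeo_onD(1)[OF UV(4)]] _ this] over[OF t]
    have 1: "((\<lambda>\<xi>. slope f (k \<xi>)) has_real_derivative frechet_derivative (slope f) (at j) (1, r, \<Phi> j)) (at x)"
      by (simp add: kx j r)
    have "((\<lambda>\<xi>. f (\<xi>, \<sigma> (\<xi>, t, z))) has_vector_derivative frechet_derivative f (at (x, y)) (1, r)) (at x)"
      using smooth_on_curve_vector[OF sf _ has_vector_derivative_graph[OF d\<sigma>]] mD(4) n(2) by simp
    from smooth_on_curve[OF sG _ this] fD[OF mD(4)]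
    have "((\<lambda>\<xi>. G (f (\<xi>, \<sigma> (\<xi>, t, z)))) has_real_derivative
        frechet_derivative G (at (f (x, y))) (frechet_derivative f (at (x, y)) (1, r))) (at x)"
      by (simp add: n(2))
    then have 2: "((\<lambda>\<xi>. G (f (\<xi>, \<sigma> (\<xi>, t, z))) - 1 / (t - c)) has_real_derivative
        frechet_derivative G (at (f (x, y))) (frechet_derivative f (at (x, y)) (1, r))) (at x)"
      by (auto intro!: derivative_eq_intros)
    define S where "S = {\<xi>. (\<xi>, t, z) \<in> N} \<inter> (\<lambda>\<xi>. (t, \<xi>, \<sigma> (\<xi>, t, z))) -` A2"
    have oS: "open S"
      unfolding S_def
    proof (rule continuous_open_preimage[OF _ open_slice A2(1)])
      show "open N" by (rule smooth_onD(2)[OF \<sigma>(1)])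
      have "continuous_on {\<xi>. (\<xi>, t, z) \<in> N} (\<lambda>\<xi>. \<sigma> (\<xi>, t, z))"
        by (rule continuous_on_compose2[OF smooth_on_continuous_on[OF \<sigma>(1)]]) (auto intro!: continuous_intros)
      then show "continuous_on {\<xi>. (\<xi>, t, z) \<in> N} (\<lambda>\<xi>. (t, \<xi>, \<sigma> (\<xi>, t, z)))"
        by (intro continuous_intros)
    qed
    have "((\<lambda>\<xi>. slope f (k \<xi>)) has_real_derivative
        frechet_derivative G (at (f (x, y))) (frechet_derivative f (at (x, y)) (1, r))) (at x)"
    proof (rule has_field_derivative_transform_within_open[OF 2 oS])
      show "x \<in> S" using n t by (simp add: S_def)
      fix \<xi> assume \<xi>: "\<xi> \<in> S"
      then have *: "(\<xi>, t, z) \<in> N" "(t, \<xi>, \<sigma> (\<xi>, t, z)) \<in> A2" by (auto simp: S_def)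
      have "k \<xi> = (\<xi>, \<sigma> (\<xi>, t, z), p (t, \<xi>, \<sigma> (\<xi>, t, z)))"
        using N_to_A(2)[OF *(1)] by (simp add: k_def curve_slope_def)
      then show "G (f (\<xi>, \<sigma> (\<xi>, t, z))) - 1 / (t - c) = slope f (k \<xi>)"
        using slope A2D[OF *(2)] by simp
    qed
    from DERIV_unique[OF 1 this]
    have "frechet_derivative (slope f) (at j) (1, r, \<Phi> j)
        = frechet_derivative G (at (f (x, y))) (run f j, rise f j)"
      using run_prolong_image[of f j] by (simp add: j jet_pt_def)
    also have "(run f j, rise f j) = run f j *\<^sub>R (1, slope f j)"
      using over[OF t] by (simp add: j r slope_def jets_over_def prolongable_eq)
    also have "frechet_derivative G (at (f (x, y))) \<dots> = derived_ode G (prolong f j) * run f j"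
      using derived_ode_eq[OF sG, of "fst (f (x, y))" "snd (f (x, y))" "slope f j"] fD[OF mD(4)]
        linear_cmul[OF smooth_on_linear_derivative[OF sG fD[OF mD(4)]], of "run f j" "(1, slope f j)"]
      by (simp add: prolong_eq j jet_pt_def)
    finally show "intertwines f \<Phi> (derived_ode G) j" by (simp add: intertwines_def j)
  qed
  moreover have "smooth_near (jet_pt (prolong f (x0, y0, p0))) G"
    using sG fD[OF TM(4)] by (auto simp: smooth_near_def jet_pt_prolong) (auto simp: jet_pt_def)
  ultimately show ?thesis by blast
qed

end

section \<open>From a first integral to \<open>K0 = 0\<close>\<close>

lemma Moebius_Schwarzian:
  fixes P P1 P2 :: "real \<Rightarrow> real"
  assumes T: "open T" "t \<in> T"
    and P: "\<And>t. t \<in> T \<Longrightarrow> (P has_real_derivative P1 t) (at t)" "\<And>t. t \<in> T \<Longrightarrow> P1 t \<noteq> 0"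
      "\<And>t. t \<in> T \<Longrightarrow> (P1 has_real_derivative P2 t) (at t)"
    and eq: "\<And>t. t \<in> T \<Longrightarrow> (\<gamma> + \<delta> * P t) * (t + k) = \<alpha> + \<beta> * P t" "\<And>t. t \<in> T \<Longrightarrow> \<gamma> + \<delta> * P t \<noteq> 0"
  obtains l' where "((\<lambda>t. P2 t / P1 t) has_real_derivative l') (at t)" "l' / 2 - (P2 t / P1 t)\<^sup>2 / 4 = 0"
proof -
  \<comment> \<open>The assumed relation makes \<open>t + k\<close> a Moebius function of
    \<open>P\<close>. Differentiating it gives \<open>P1 e = \<gamma> + \<delta> P\<close>, and once
    more \<open>P2 e = 2 \<delta> P1\<close>. Hence \<open>P2 / P1 = 2 \<delta> / e\<close>, where
    \<open>e\<close> is affine with derivative \<open>- \<delta>\<close>.\<close>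
  define e where "e t = \<beta> - \<delta> * (t + k)" for t
  have de: "(e has_real_derivative - \<delta>) (at t)" for t
    unfolding e_def by (auto intro!: derivative_eq_intros)
  have 1: "P1 t * e t = \<gamma> + \<delta> * P t" if t: "t \<in> T" for t
  proof -
    have "((\<lambda>t. (\<gamma> + \<delta> * P t) * (t + k)) has_real_derivative \<delta> * P1 t * (t + k) + (\<gamma> + \<delta> * P t)) (at t)"
      using P(1)[OF t] by (auto intro!: derivative_eq_intros)
    moreover have "((\<lambda>t. (\<gamma> + \<delta> * P t) * (t + k)) has_real_derivative \<beta> * P1 t) (at t)"
    proof (rule has_field_derivative_transform_within_open[OF _ T(1) t])
      show "((\<lambda>t. \<alpha> + \<beta> * P t) has_real_derivative \<beta> * P1 t) (at t)"
        using P(1)[OF t] by (auto intro!: derivative_eq_intros)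
    qed (use eq in simp)
    ultimately show ?thesis using DERIV_unique by (fastforce simp: e_def algebra_simps)
  qed
  have e: "e t \<noteq> 0" if "t \<in> T" for t using 1[OF that] eq(2)[OF that] by auto
  have 2: "P2 t / P1 t = 2 * \<delta> / e t" if t: "t \<in> T" for t
  proof -
    have "((\<lambda>t. P1 t * e t) has_real_derivative P2 t * e t + P1 t * - \<delta>) (at t)"
      by (rule DERIV_cong[OF DERIV_mult[OF P(3)[OF t] de]]) simp
    moreover have "((\<lambda>t. P1 t * e t) has_real_derivative \<delta> * P1 t) (at t)"
    proof (rule has_field_derivative_transform_within_open[OF _ T(1) t])
      show "((\<lambda>t. \<gamma> + \<delta> * P t) has_real_derivative \<delta> * P1 t) (at t)"
        using P(1)[OF t] by (auto intro!: derivative_eq_intros)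
    qed (use 1 in simp)
    ultimately have "P2 t * e t + P1 t * - \<delta> = \<delta> * P1 t" by (rule DERIV_unique)
    then show ?thesis using e[OF t] P(2)[OF t] by (simp add: field_simps)
  qed
  have "((\<lambda>t. 2 * \<delta> / e t) has_real_derivative 2 * \<delta>\<^sup>2 / (e t)\<^sup>2) (at t)"
    using e[OF T(2)] by (auto intro!: derivative_eq_intros de simp: power2_eq_square)
  then have "((\<lambda>t. P2 t / P1 t) has_real_derivative 2 * \<delta>\<^sup>2 / (e t)\<^sup>2) (at t)"
    by (rule has_field_derivative_transform_within_open[OF _ T]) (simp add: 2)
  moreover have "2 * \<delta>\<^sup>2 / (e t)\<^sup>2 / 2 - (P2 t / P1 t)\<^sup>2 / 4 = 0"
    using e[OF T(2)] by (simp add: 2[OF T(2)] power_divide power_mult_distrib)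
  ultimately show ?thesis by (rule that)
qed

text \<open>At a fixed point the image slope is a nondegenerate Moebius function of
  \<open>p\<close>. Instead of computing its determinant, a zero derivative is excluded by the
  injectivity of the derivative of \<open>prolong f\<close>.\<close>

lemma pd_slope_nonzero:
  assumes f: "diffeo_on U V f" and j: "(x, y, p) \<in> jets_over U f"
  shows "pd (0, 0, 1) (slope f) (x, y, p) \<noteq> 0"
proof
  note sf = diffeo_onD(1)[OF f]
  assume "pd (0, 0, 1) (slope f) (x, y, p) = 0"
  then have "frechet_derivative (slope f) (at (x, y, p)) (1, p, 1) = frechet_derivative (slope f) (at (x, y, p)) (1, p, 0)"
    using pd_triple[OF smooth_on_slope[OF sf] j, of 1 p 1] pd_triple[OF smooth_on_slope[OF sf] j, of 1 p 0]
    by (simp add: pd_def)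
  note eq = this
  have "(1 :: real, p, 1 :: real) = (1, p, 0)"
    by (rule prolong_derivative_inj[OF f j]) (simp only: smooth_prolong_derivative[OF sf j] eq)
  then show False by simp
qed

context dual_chart
begin

theorem K0_eq_0_if_derived:
  fixes G :: "real \<times> real \<Rightarrow> real"
  assumes F: "smooth_on KF F" "(t0, z0, q0) \<in> KF"
    and G: "smooth_on D G" "jet_pt (prolong h (x0, y0, p0)) \<in> D"
    and h: "diffeo_on U V h" and W2: "open W2" "(x0, y0, p0) \<in> W2" "jet_pt ` W2 \<subseteq> U"
    and pr: "prolongable h (x0, y0, p0)"
    and equiv: "\<And>I u. jets_in W2 I u \<Longrightarrow>
      solves \<Phi> I u \<longleftrightarrow> (\<exists>J v. solves (derived_ode G) J v \<and> h ` graph_on I u = graph_on J v)"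
  shows "\<exists>H b. smooth_near b H \<and> point_equivalent F (t0, z0, q0) H b \<and> (\<forall>\<^sub>F j in nhds b. K0 H j = 0)"
proof -
  let ?a = "(x0, y0, p0)" and ?c = "(t0, z0)"
  note sh = diffeo_onD(1)[OF h]
  define O' where "O' = jets_over U h \<inter> (\<lambda>j. h (jet_pt j)) -` D"
  have shj: "smooth_on (jets_over U h) (\<lambda>j. h (jet_pt j))"
    by (rule smooth_on_compose[OF smooth_on_jet_pt[OF open_jets_over[OF sh]] sh]) (auto simp: jets_over_def)
  have O': "open O'" "O' \<subseteq> jets_over U h"
    unfolding O'_def using smooth_onD(2)[OF G(1)]
    by (auto intro: continuous_open_preimage[OF smooth_on_continuous_on[OF shj] open_jets_over[OF sh]])
  \<comment> \<open>The first integral \<open>Y' - G (X, Y)\<close> pulled back to jets of the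
    original plane. \<open>G\<close> depends on the point only, so \<open>M\<close> inherits from
    \<open>slope h\<close> a nonzero derivative in the slope.\<close>
  define M where "M j = slope h j - G (h (jet_pt j))" for j
  have sM: "smooth_on O' M"
    unfolding M_def[abs_def]
    by (intro smooth_on_diff smooth_on_subset[OF smooth_on_slope[OF sh] O']
        smooth_on_compose[OF smooth_on_subset[OF shj O'] G(1)]) (auto simp: O'_def)
  have aO: "?a \<in> O'" using pr W2(2,3) G(2) by (auto simp: O'_def jets_over_def jet_pt_prolong)
  have Mp: "pd (0, 0, 1) M ?a \<noteq> 0"
  proof -
    have "((\<lambda>r. M (x0, y0, r)) has_real_derivative pd (0, 0, 1) (slope h) ?a) (at p0)"
      unfolding M_def jet_pt_def prod.case using aO O'(2)
      by (auto intro!: derivative_eq_intros pd_line3[OF smooth_on_slope[OF sh]])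
    then have "pd (0, 0, 1) M ?a = pd (0, 0, 1) (slope h) ?a"
      using DERIV_unique[OF pd_line3[OF sM aO]] by blast
    then show ?thesis using pd_slope_nonzero[OF h] aO O'(2) by auto
  qed
  define E where "E n = (fst n, s n, pd (1, 0, 0) s n)" for n
  have sE: "smooth_on (I \<times> \<Omega>) E"
    unfolding E_def[abs_def] using I(1) \<Omega>(1) by (intro smooth_intros smooth_s smooth_on_pd) (auto intro: open_Times)
  have E0: "E (x0, t0, z0) = ?a" using s0 deriv_s[OF I(3) \<Omega>(2)] by (simp add: E_def)
  have "open ((I \<times> \<Omega>) \<inter> E -` (W2 \<inter> O'))"
    using I(1) \<Omega>(1) W2(1) O'(1)
    by (intro continuous_open_preimage smooth_on_continuous_on[OF sE] open_Times open_Int)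
  moreover have "(x0, t0, z0) \<in> (I \<times> \<Omega>) \<inter> E -` (W2 \<inter> O')" using I \<Omega> E0 W2 aO by simp
  ultimately obtain I' \<Omega>' where I\<Omega>: "open I'" "open \<Omega>'" "x0 \<in> I'" "?c \<in> \<Omega>'"
    "I' \<times> \<Omega>' \<subseteq> (I \<times> \<Omega>) \<inter> E -` (W2 \<inter> O')"
    using open_prod_elim[of _ "(x0, ?c)"] by (metis mem_Sigma_iff)
  obtain e where e: "e > 0" "ball x0 e \<subseteq> I'" using I\<Omega>(1,3) open_contains_ball by blast
  define I0 where "I0 = ball x0 e"
  have I0: "open I0" "is_interval I0" "x0 \<in> I0" using e by (auto simp: I0_def is_interval_ball_real)
  have box: "x \<in> I" "\<zeta> \<in> \<Omega>" "E (x, \<zeta>) \<in> W2" "E (x, \<zeta>) \<in> O'" if "x \<in> I0" "\<zeta> \<in> \<Omega>'" for x \<zeta>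
  proof -
    have "(x, \<zeta>) \<in> I' \<times> \<Omega>'" using that e(2) by (auto simp: I0_def)
    then show "x \<in> I" "\<zeta> \<in> \<Omega>" "E (x, \<zeta>) \<in> W2" "E (x, \<zeta>) \<in> O'" using I\<Omega>(5) by auto
  qed
  \<comment> \<open>The equivalence takes the graph of a solution to that of a solution
    \<open>v\<close> of the derived equation, and \<open>M\<close> becomes
    \<open>v' - G (r, v)\<close>, whose derivative that equation makes zero. The interval
    \<open>I0\<close> serves all parameters, so values can be moved to \<open>x0\<close>.\<close>
  have first_integral: "M (E (x, \<zeta>)) = M (E (x0, \<zeta>))" if x: "x \<in> I0" and \<zeta>: "\<zeta> \<in> \<Omega>'" for x \<zeta>
  proof -
    define u where "u x = s (x, \<zeta>)" for x
    have du: "(u has_real_derivative deriv u x) (at x)" "E (x, \<zeta>) = (x, u x, deriv u x)" if "x \<in> I0" for x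
      using s_line[OF box(1,2)[OF that \<zeta>]] deriv_s[OF box(1,2)[OF that \<zeta>]]
      by (simp_all add: u_def[abs_def] E_def)
    have diff: "u differentiable (at x)" if "x \<in> I0" for x using du(1)[OF that] by (auto simp: real_differentiable_def)
    have over: "(x, u x, deriv u x) \<in> O'" if "x \<in> I0" for x using box(4)[OF that \<zeta>] du(2)[OF that] by simp
    have "jets_in W2 I0 u" using I0 diff box(3)[OF _ \<zeta>] du(2) by (auto simp: jets_in_def)
    moreover have "solves \<Phi> I0 u"
      using solves_s[OF box(2)[OF I0(3) \<zeta>]] I0 box(1)[OF _ \<zeta>] by (auto simp: solves_def u_def[abs_def])
    ultimately obtain J v where v: "solves (derived_ode G) J v" "h ` graph_on I0 u = graph_on J v"
      using equiv by blast
    define X where "X x = fst (h (x, u x))" for x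
    have dv: "v differentiable (at r)" "(deriv v has_real_derivative derived_ode G (r, v r, deriv v r)) (at r)"
      if "r \<in> J" for r using v(1) that by (auto simp: solves_def)
    have XJ: "X x \<in> J" and prX: "prolong h (x, u x, deriv u x) = (X x, v (X x), deriv v (X x))" if "x \<in> I0" for x
      using prolong_image_graph[OF sh I0(1) that diff _ dv(1) v(2)] over O'(2) by (auto simp: X_def)
    have Meq: "M (E (x, \<zeta>)) = deriv v (X x) - G (X x, v (X x))" and GD: "(X x, v (X x)) \<in> D" if "x \<in> I0" for x
    proof -
      have "h (x, u x) = (X x, v (X x))" "slope h (x, u x, deriv u x) = deriv v (X x)"
        using prX[OF that] by (simp_all add: prolong_eq jet_pt_def prod_eq_iff)
      then show "M (E (x, \<zeta>)) = deriv v (X x) - G (X x, v (X x))" "(X x, v (X x)) \<in> D"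
        using over[OF that] by (simp_all add: M_def du(2)[OF that] jet_pt_def O'_def)
    qed
    have "((\<lambda>x. M (E (x, \<zeta>))) has_real_derivative 0) (at x)" if x: "x \<in> I0" for x
    proof -
      have "((\<lambda>r. G (r, v r)) has_real_derivative derived_ode G (X x, v (X x), deriv v (X x))) (at (X x))"
        using smooth_on_curve[OF G(1) _ has_vector_derivative_graph[OF real_differentiable_deriv[OF dv(1)[OF XJ[OF x]]]]]
          GD[OF x] derived_ode_eq[OF G(1) GD[OF x]] by simp
      from DERIV_diff[OF dv(2)[OF XJ[OF x]] this]
      have 0: "((\<lambda>r. deriv v r - G (r, v r)) has_real_derivative 0) (at (X x))" by simp
      have "(x, u x) \<in> U" using over[OF x] O'(2) by (auto simp: jets_over_def jet_pt_def)
      from DERIV_chain2[OF 0 image_graph_derivative(1)[OF sh this du(1)[OF x], folded X_def]]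
      have "((\<lambda>x. deriv v (X x) - G (X x, v (X x))) has_real_derivative 0) (at x)" by simp
      then show ?thesis
        by (rule has_field_derivative_transform_within_open[OF _ I0(1) x]) (simp add: Meq)
    qed
    then have "\<exists>k. \<forall>x\<in>I0. M (E (x, \<zeta>)) = k"
      using I0(1,2)
      by (intro has_field_derivative_zero_constant)
        (auto simp: is_interval_convex_1 intro: has_field_derivative_at_within)
    then show ?thesis using x I0(3) by metis
  qed
  \<comment> \<open>New coordinates on the solution space: the first integral as \<open>t\<close>,
    the value at \<open>x0\<close> as \<open>z\<close>. They are independent because initial data
    are coordinates and \<open>M\<close> varies with the slope to first order.\<close>
  define k where "k \<zeta> = (M (x0, initial \<zeta>), fst (initial \<zeta>))" for \<zeta>
  have Ei: "E (x0, \<zeta>) = (x0, initial \<zeta>)" for \<zeta> by (simp add: E_def initial_def)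
  have \<Omega>'\<Omega>: "\<Omega>' \<subseteq> \<Omega>" using box(2)[OF I0(3)] by blast
  have si: "smooth_on \<Omega>' initial" by (rule smooth_on_subset[OF smooth_initial I\<Omega>(2) \<Omega>'\<Omega>])
  have "smooth_on \<Omega>' (\<lambda>\<zeta>. M (x0, initial \<zeta>))"
    by (rule smooth_on_compose[OF smooth_on_Pair[OF smooth_on_const[OF I\<Omega>(2)] si] sM])
       (use box(4)[OF I0(3)] Ei in auto)
  then have sk: "smooth_on \<Omega>' k"
    unfolding k_def[abs_def] by (intro smooth_on_Pair smooth_on_fst si)
  have i0: "initial ?c = (y0, p0)" using E0 Ei[of ?c] by simp
  define Di where "Di = frechet_derivative initial (at ?c)"
  have Di: "(initial has_derivative Di) (at ?c)"
    unfolding Di_def by (rule smooth_on_has_derivative[OF smooth_initial \<Omega>(2)])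
  have dk: "frechet_derivative k (at ?c) v = (pd (0, Di v) M ?a, fst (Di v))" for v
  proof -
    have "((\<lambda>\<zeta>. (x0, initial \<zeta>)) has_derivative (\<lambda>v. (0, Di v))) (at ?c)"
      by (intro has_derivative_Pair has_derivative_const Di)
    then have "((\<lambda>\<zeta>. M (x0, initial \<zeta>)) has_derivative (\<lambda>v. pd (0, Di v) M ?a)) (at ?c)"
      unfolding pd_def by (rule has_derivative_compose) (use smooth_on_has_derivative[OF sM aO] i0 in simp)
    then have "(k has_derivative (\<lambda>v. (pd (0, Di v) M ?a, fst (Di v)))) (at ?c)"
      unfolding k_def[abs_def] by (intro has_derivative_Pair bounded_linear.has_derivative[OF bounded_linear_fst] Di)
    from frechet_derivative_at[OF this, symmetric] show ?thesis by simp
  qed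
  have DM: "pd (0, Di v) M ?a = snd (Di v) * pd (0, 0, 1) M ?a" if "fst (Di v) = 0" for v
    using pd_triple[OF sM aO, of 0 0 "snd (Di v)"] that by (metis (no_types) add_0 mult_zero_left prod.collapse)
  have Di0: "v = 0" if "fst (Di v) = 0" "snd (Di v) = 0" for v
    using initial_derivative_eq_0[of v] that by (simp add: Di_def prod_eq_iff)
  have inj: "v = 0" if "frechet_derivative k (at ?c) v = 0" for v
  proof (rule Di0)
    show "fst (Di v) = 0" using that by (simp add: dk zero_prod_def)
    then show "snd (Di v) = 0" using that DM[of v] Mp by (simp add: dk zero_prod_def)
  qed
  obtain U1 V1 where UV: "open U1" "U1 \<subseteq> \<Omega>'" "?c \<in> U1" "open V1" "diffeo_on U1 V1 k"
    by (rule smooth_inverse_function[OF sk I\<Omega>(4) inj])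
  note sk1 = diffeo_onD(1)[OF UV(5)]
  have "fst (Di v) = pd (0, v) s (x0, ?c)" for v
  proof -
    have "((\<lambda>\<zeta>. (x0, \<zeta>)) has_derivative (\<lambda>v. (0, v))) (at ?c)" by (auto intro!: derivative_eq_intros)
    from has_derivative_compose[OF this smooth_on_has_derivative[OF smooth_s, of "(x0, ?c)"]]
    have "((\<lambda>\<zeta>. s (x0, \<zeta>)) has_derivative (\<lambda>v. pd (0, v) s (x0, ?c))) (at ?c)"
      using I \<Omega> by (simp add: pd_def)
    moreover have "((\<lambda>\<zeta>. s (x0, \<zeta>)) has_derivative (\<lambda>v. fst (Di v))) (at ?c)"
      using bounded_linear.has_derivative[OF bounded_linear_fst Di] by (simp add: initial_def)
    ultimately show ?thesis using has_derivative_unique by metis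
  qed
  \<comment> \<open>The solutions on the curve of the base point share their value at
    \<open>x0\<close>, so its direction \<open>(1, q0)\<close> changes only the slope in the initial
    data, and therefore \<open>M\<close>. This gives the nonzero \<open>run\<close> that makes
    \<open>k\<close> prolongable.\<close>
  then have Diq: "fst (Di (1, q0)) = 0"
    using pd_s0(2) pd_triple[OF smooth_s, of "(x0, ?c)" 0 1 q0] I \<Omega> by simp
  have "snd (Di (1, q0)) \<noteq> 0" using Di0[OF Diq] by (auto simp: zero_prod_def)
  then have "run k (t0, z0, q0) \<noteq> 0" by (simp add: run_def jet_pt_def dk DM[OF Diq] Mp)
  then have bk: "(t0, z0, q0) \<in> jets_over U1 k"
    using UV(3) by (simp add: jets_over_def prolongable_eq jet_pt_def)
  let ?k' = "inv_into U1 k"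
  note sk' = diffeo_onD(2)[OF UV(5)]
  \<comment> \<open>\<open>H\<close> is obtained by solving the intertwining identity for it, so the
    equivalence with \<open>F\<close> holds by construction.\<close>
  define H where "H j = frechet_derivative (slope k) (at (prolong ?k' j))
      (1, snd (snd (prolong ?k' j)), F (prolong ?k' j)) / run k (prolong ?k' j)" for j
  define Q where "Q = jets_over U1 k \<inter> KF"
  define K where "K = jets_over V1 ?k' \<inter> prolong ?k' -` Q"
  have Q: "open Q" "Q \<subseteq> jets_over U1 k" "Q \<subseteq> KF"
    unfolding Q_def using open_jets_over[OF sk1] smooth_onD(2)[OF F(1)] by auto
  have sK: "smooth_on K (prolong ?k')" "prolong ?k' ` K \<subseteq> Q"
  proof -
    have "open K"
      unfolding K_def using Q(1)
      by (intro continuous_open_preimage smooth_on_continuous_on[OF smooth_on_prolong[OF sk']] open_jets_over[OF sk'])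
    then show "smooth_on K (prolong ?k')" "prolong ?k' ` K \<subseteq> Q"
      by (auto simp: K_def intro: smooth_on_subset[OF smooth_on_prolong[OF sk']])
  qed
  have sH: "smooth_on K H"
  proof -
    have "smooth_on Q (\<lambda>j. j)" using Q(1) by (rule smooth_on_ident)
    moreover have "smooth_on Q (\<lambda>j. (1 :: real, snd (snd j), F j))"
      using Q(1) by (intro smooth_intros smooth_on_subset[OF F(1) Q(1,3)])
    ultimately have "smooth_on Q (\<lambda>j. frechet_derivative (slope k) (at j) (1, snd (snd j), F j))"
      using Q(2) by (intro smooth_on_frechet[OF smooth_on_slope[OF sk1]]) auto
    moreover have "smooth_on Q (run k)"
      using Q by (intro smooth_on_subset[OF smooth_on_run[OF sk1]]) (auto simp: jets_over_def)
    ultimately have "smooth_on Q (\<lambda>j. frechet_derivative (slope k) (at j) (1, snd (snd j), F j) / run k j)"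
      using Q(2) by (intro smooth_on_divide) (auto simp: jets_over_def prolongable_eq)
    from smooth_on_compose[OF sK(1) this sK(2)] show ?thesis by (simp add: H_def[abs_def])
  qed
  obtain t1 z1 q1 where b: "prolong k (t0, z0, q0) = (t1, z1, q1)" by (metis prod_cases3)
  have bK: "(t1, z1, q1) \<in> K"
    using prolong_inverse[OF UV(5) bk] bk F(2) by (simp add: K_def Q_def b)
  have rel: "intertwines k F H j" if "j \<in> jets_over U1 k" for j
    using that by (simp add: intertwines_def H_def prolong_inverse(2)[OF UV(5) that] jets_over_def prolongable_eq)
  have pe: "point_equivalent F (t0, z0, q0) H (t1, z1, q1)"
    using point_equivalentI[OF UV(5) open_jets_over[OF sk1] bk subset_refl b rel] .
  interpret dual_equivalent \<Phi> F x0 y0 p0 t0 z0 q0 s I \<Omega> P W H t1 z1 q1 k U1 V1 "jets_over U1 k"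
  proof unfold_locales
    show "solves F J u \<longleftrightarrow> (\<exists>J' v. solves H J' v \<and> k ` graph_on J u = graph_on J' v)"
      if "jets_in (jets_over U1 k) J u" for J u
      by (rule solves_iff_image[OF UV(5) subset_refl _ that]) (rule rel)
  qed (use UV(5) open_jets_over[OF sk1] bk b in \<open>auto simp: jets_over_def\<close>)
  obtain N w A where fam: "dual_family \<Phi> ?a \<sigma> N w A H (t1, z1, q1)"
    and N: "N \<subseteq> {n. snd n \<in> V1 \<and> fst n \<in> I \<and> g (snd n) \<in> \<Omega>}"
    using dual_family by blast
  interpret inc: incidence \<Phi> H x0 y0 p0 t1 z1 q1 \<sigma> w N A
    using fam by unfold_locales
  define A1 where "A1 = (A \<inter> inc.dual_jet -` K) \<inter> ((A \<inter> inc.p1 -` (- {0})) \<inter> (A \<inter> (\<lambda>m. fst (snd m)) -` I0))"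
  have A1: "open A1" "A1 \<subseteq> A" "(t1, x0, y0) \<in> A1"
    unfolding A1_def using inc.base bK inc.w(3) I0 smooth_onD(2)[OF sH]
    by (auto intro!: continuous_open_preimage smooth_on_continuous_on[OF inc.smooth_dual_jet]
        smooth_on_continuous_on[OF smooth_on_pd[OF inc.smooth_p]] inc.open_A continuous_intros)
  have A1D: "(t, x, y) \<in> A" "inc.dual_jet (t, x, y) \<in> K" "inc.p1 (t, x, y) \<noteq> 0" "x \<in> I0" if "(t, x, y) \<in> A1" for t x y
    using that by (auto simp: A1_def)
  \<comment> \<open>The coordinate \<open>t\<close> is \<open>M\<close> evaluated at
    \<open>x0\<close>. Being constant along the solution, \<open>M\<close> may be evaluated at
    \<open>x\<close> instead, where the jet is \<open>(x, y, p)\<close>.\<close>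
  have Mt: "M (x, y, inc.p (t, x, y)) = t" "(x, y, inc.p (t, x, y)) \<in> O'" if m: "(t, x, y) \<in> A1" for t x y
  proof -
    let ?z = "w (t, x, y)"
    note mA = A1D(1)[OF m]
    have n: "(x, t, ?z) \<in> N" "\<sigma> (x, t, ?z) = y" using inc.A_to_N[OF mA] by auto
    then have V1: "(t, ?z) \<in> V1" "g (t, ?z) \<in> \<Omega>" "x \<in> I" using N by auto
    have gU: "g (t, ?z) \<in> \<Omega>'" using diffeo_onD(8)[OF UV(5) V1(1)] UV(2) by blast
    have "pd (1, 0, 0) \<sigma> (x, t, ?z) = pd (1, 0, 0) s (x, g (t, ?z))"
      using \<sigma>_line[of "I \<times> \<Omega>" "(x, t, ?z)"] V1 I(1) \<Omega>(1) by (auto intro: open_Times)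
    then have Em: "E (x, g (t, ?z)) = (x, y, inc.p (t, x, y))"
      using n(2) by (simp add: E_def \<sigma>_def curve_slope_def)
    have "k (g (t, ?z)) = (t, ?z)" by (rule diffeo_onD(9)[OF UV(5) V1(1)])
    then have "M (E (x0, g (t, ?z))) = t" by (simp add: k_def Ei)
    then show "M (x, y, inc.p (t, x, y)) = t" "(x, y, inc.p (t, x, y)) \<in> O'"
      using first_integral[OF A1D(4)[OF m] gU] box(4)[OF A1D(4)[OF m] gU] Em by simp_all
  qed
  have "K0 H (inc.dual_jet (t, x, y)) = 0" if m: "(t, x, y) \<in> A1" for t x y
  proof -
    define T where "T = {t. (t, x, y) \<in> A1}"
    have T: "open T" "t \<in> T" using open_slice[OF A1(1)] m by (auto simp: T_def)
    let ?L = "frechet_derivative h (at (x, y))"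
    have xyU: "(x, y) \<in> U" using Mt(2)[OF m] O'(2) by (auto simp: jets_over_def jet_pt_def)
    \<comment> \<open>At a fixed point run and rise are affine in the slope, so
      \<open>M = t\<close>, that is \<open>rise = run (t + G)\<close>, becomes a Moebius relation
      between \<open>t\<close> and \<open>p\<close> with coefficients depending on
      \<open>(x, y)\<close> only.\<close>
    have lin: "run h (x, y, r) = fst (?L (1, 0)) + fst (?L (0, 1)) * r"
      "rise h (x, y, r) = snd (?L (1, 0)) + snd (?L (0, 1)) * r" for r
    proof -
      note L = smooth_on_linear_derivative[OF sh xyU]
      have "(1 :: real, r) = (1, 0) + r *\<^sub>R (0, 1)" by simp
      then have "?L (1, r) = ?L (1, 0) + r *\<^sub>R ?L (0, 1)"
        by (simp only: linear_add[OF L] linear_cmul[OF L])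
      then show "run h (x, y, r) = fst (?L (1, 0)) + fst (?L (0, 1)) * r"
        "rise h (x, y, r) = snd (?L (1, 0)) + snd (?L (0, 1)) * r"
        by (simp_all add: run_def rise_def jet_pt_def)
    qed
    have run: "fst (?L (1, 0)) + fst (?L (0, 1)) * inc.p (r, x, y) \<noteq> 0"
      and eq: "(fst (?L (1, 0)) + fst (?L (0, 1)) * inc.p (r, x, y)) * (r + G (h (x, y)))
        = snd (?L (1, 0)) + snd (?L (0, 1)) * inc.p (r, x, y)" if "r \<in> T" for r
    proof -
      have r: "(r, x, y) \<in> A1" using that by (simp add: T_def)
      show run: "fst (?L (1, 0)) + fst (?L (0, 1)) * inc.p (r, x, y) \<noteq> 0"
        using Mt(2)[OF r] O'(2) by (auto simp: jets_over_def prolongable_eq lin)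
      then show "(fst (?L (1, 0)) + fst (?L (0, 1)) * inc.p (r, x, y)) * (r + G (h (x, y)))
        = snd (?L (1, 0)) + snd (?L (0, 1)) * inc.p (r, x, y)"
        using Mt(1)[OF r] by (simp add: M_def slope_def lin jet_pt_def field_simps)
    qed
    have p: "((\<lambda>t. inc.p (t, x, y)) has_real_derivative inc.p1 (r, x, y)) (at r)"
      "((\<lambda>t. inc.p1 (t, x, y)) has_real_derivative inc.p2 (r, x, y)) (at r)" "inc.p1 (r, x, y) \<noteq> 0" if "r \<in> T" for r
    proof -
      have r: "(r, x, y) \<in> A1" using that by (simp add: T_def)
      note rA = A1D(1)[OF r]
      show "((\<lambda>t. inc.p (t, x, y)) has_real_derivative inc.p1 (r, x, y)) (at r)"
        "((\<lambda>t. inc.p1 (t, x, y)) has_real_derivative inc.p2 (r, x, y)) (at r)" "inc.p1 (r, x, y) \<noteq> 0"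
        by (rule pd_line1[OF inc.smooth_p rA] pd_line1[OF smooth_on_pd[OF inc.smooth_p] rA] A1D(3)[OF r])+
    qed
    obtain l' where l': "((\<lambda>t. inc.p2 (t, x, y) / inc.p1 (t, x, y)) has_real_derivative l') (at t)"
      "l' / 2 - (inc.p2 (t, x, y) / inc.p1 (t, x, y))\<^sup>2 / 4 = 0"
      by (rule Moebius_Schwarzian[OF T p(1) p(3) p(2) eq run])
    have "inc.dual_jet ` A1 \<subseteq> K" by (auto simp: A1_def)
    moreover have "inc.p1 m \<noteq> 0" if "m \<in> A1" for m using that by (auto simp: A1_def)
    ultimately show ?thesis using inc.K0_along_curves[OF A1(1,2) sH _ _ m l'(1) refl] l'(2) by simp
  qed
  then have "\<forall>\<^sub>F j in nhds (t1, z1, q1). K0 H j = 0"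
    using inc.dual_jets_cover[OF A1] by (auto elim!: eventually_mono)
  moreover have "smooth_near (t1, z1, q1) H" using sH bK by (auto simp: smooth_near_def)
  ultimately show ?thesis using pe by blast
qed

end

theorem corollary4p4:
  fixes \<Phi> F :: ode and a b :: jet
  assumes "smooth_near a \<Phi>"
    and "smooth_near b F"
    and "dual_ode \<Phi> a F b"
  shows "(\<exists>(G :: real \<times> real \<Rightarrow> real) a'.
            smooth_near (jet_pt a') G \<and> point_equivalent \<Phi> a (derived_ode G) a')
         \<longleftrightarrow>
         (\<exists>(H :: ode) b'.
            smooth_near b' H \<and> point_equivalent F b H b' \<and>
            (\<forall>\<^sub>F j in nhds b'. K0 H j = 0))"
proof -
  obtain x0 y0 p0 where a: "a = (x0, y0, p0)" by (metis prod_cases3)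
  obtain t0 z0 q0 where b: "b = (t0, z0, q0)" by (metis prod_cases3)
  obtain s I \<Omega> P W where "dual_chart \<Phi> F x0 y0 p0 t0 z0 q0 s I \<Omega> P W"
    using assms(3) by (auto simp: dual_ode_def a b dual_chart_def)
  then interpret dual_chart \<Phi> F x0 y0 p0 t0 z0 q0 s I \<Omega> P W .
  show ?thesis
  proof
    assume "\<exists>(G :: real \<times> real \<Rightarrow> real) a'.
      smooth_near (jet_pt a') G \<and> point_equivalent \<Phi> a (derived_ode G) a'"
    then obtain G :: "real \<times> real \<Rightarrow> real" and a'
      where G: "smooth_near (jet_pt a') G" and eq: "point_equivalent \<Phi> a (derived_ode G) a'" by blast
    obtain D where D: "smooth_on D G" "jet_pt a' \<in> D" using G by (auto simp: smooth_near_def)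
    obtain K where K: "smooth_on K F" "b \<in> K" using assms(2) by (auto simp: smooth_near_def)
    obtain h U V W2 where h: "diffeo_on U V h" "open W2" "a \<in> W2" "jet_pt ` W2 \<subseteq> U" "prolongable h a"
      "prolong h a = a'" "\<And>I u. jets_in W2 I u \<Longrightarrow>
        solves \<Phi> I u \<longleftrightarrow> (\<exists>J v. solves (derived_ode G) J v \<and> h ` graph_on I u = graph_on J v)"
      using eq unfolding point_equivalent_def by blast
    show "\<exists>(H :: ode) b'. smooth_near b' H \<and> point_equivalent F b H b' \<and> (\<forall>\<^sub>F j in nhds b'. K0 H j = 0)"
      using K0_eq_0_if_derived[OF K[unfolded b] D(1) _ h(1,2) h(3)[unfolded a] h(4) h(5)[unfolded a] h(7)]
        D(2) h(6) by (simp add: a b)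
  next
    assume "\<exists>(H :: ode) b'. smooth_near b' H \<and> point_equivalent F b H b' \<and> (\<forall>\<^sub>F j in nhds b'. K0 H j = 0)"
    then obtain H :: ode and b' where H: "smooth_near b' H" "point_equivalent F b H b'"
      "\<forall>\<^sub>F j in nhds b'. K0 H j = 0" by blast
    obtain t1 z1 q1 where b': "b' = (t1, z1, q1)" by (metis prod_cases3)
    obtain S where S: "open S" "b' \<in> S" "\<And>j. j \<in> S \<Longrightarrow> K0 H j = 0"
      using H(3) unfolding eventually_nhds by blast
    obtain K where K: "smooth_on K H" "b' \<in> K" using H(1) by (auto simp: smooth_near_def)
    have SK: "smooth_on (S \<inter> K) H"
      by (rule smooth_on_subset[OF K(1)]) (use S(1) smooth_onD(2)[OF K(1)] in auto)
    obtain f U V W1 where f: "diffeo_on U V f" "open W1" "b \<in> W1" "jet_pt ` W1 \<subseteq> U" "prolongable f b"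
      "prolong f b = b'" "\<And>I u. jets_in W1 I u \<Longrightarrow>
        solves F I u \<longleftrightarrow> (\<exists>J v. solves H J v \<and> f ` graph_on I u = graph_on J v)"
      using H(2) unfolding point_equivalent_def by blast
    \<comment> \<open>Here the equivalence is part of the hypothesis and supplies the coordinates on
      the solution space; in the other direction they are built from the first integral.\<close>
    interpret dual_equivalent \<Phi> F x0 y0 p0 t0 z0 q0 s I \<Omega> P W H t1 z1 q1 f U V W1
      by unfold_locales (use f in \<open>simp_all add: b b'\<close>)
    obtain N w A where "dual_family \<Phi> (x0, y0, p0) \<sigma> N w A H (t1, z1, q1)"
      using dual_family by blast
    then interpret incidence \<Phi> H x0 y0 p0 t1 z1 q1 \<sigma> w N A by unfold_locales
    show "\<exists>(G :: real \<times> real \<Rightarrow> real) a'.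
        smooth_near (jet_pt a') G \<and> point_equivalent \<Phi> a (derived_ode G) a'"
      using derived_if_K0_eq_0[OF SK] S(2,3) K(2) by (simp add: a b')
  qed
qed

end
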